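(* Let $F(x)=x^7+ax^5+b\in\mathbb{Z}[x]$ with $ab\neq 0$ be monic and irreducible over $\mathbb{Q}$, let $\theta$ be a complex root of $F(x)$ and $K=\mathbb{Q}(\theta)$. Then for every odd rational prime $p$, $p$ is not a common index divisor of $K$, i.e. $p\nmid i(K)$.
   Context: $A_K$ denotes the ring of integers of $K$. For $\eta\in A_K$ with $K=\mathbb{Q}(\eta)$, $(A_K:\mathbb{Z}[\eta])$ is the (finite) index of the additive group $\mathbb{Z}[\eta]$ in $A_K$. The index of $K$ is $i(K)=\gcd\{(A_K:\mathbb{Z}[\eta]) : \eta\in A_K,\ K=\mathbb{Q}(\eta)\}$. A rational prime dividing $i(K)$ is called a common index divisor of $K$. Standing assumption of the paper: for every prime $p$, $\nu_p(a)<2$ or $\nu_p(b)<7$, where $\nu_p$ is the $p$-adic valuation. *)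

theory Defs
  imports
    "HOL-Algebra.Algebraic_Closure_Type"
    "HOL-Algebra.Generated_Fields"
    "HOL-Computational_Algebra.Computational_Algebra"
begin

abbreviation complex_ring :: "complex ring" where
  "complex_ring \<equiv> ring_of_type_algebra"

text \<open>
  The smallest subfield of the complex numbers containing \<open>\<eta>\<close>; it contains the rationals,
  the characteristic being zero.
\<close>

definition rat_adjoin :: "complex \<Rightarrow> complex set" where
  "rat_adjoin \<eta> = generate_field complex_ring {\<eta>}"

definition int_adjoin :: "complex \<Rightarrow> complex set" where
  "int_adjoin \<eta> = generate_ring complex_ring {\<eta>}"

definition ring_of_integers :: "complex set \<Rightarrow> complex set" where
  "ring_of_integers K = {x \<in> K. algebraic_int x}"

text \<open>
  The index is the number of cosets of \<open>\<int>[\<eta>]\<close> in the additive group of the ring of integers.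
  It is meant for \<open>\<eta>\<close> in the ring of integers of \<open>K\<close> with \<open>K = \<rat>(\<eta>)\<close>, where it is finite.
\<close>

definition element_index :: "complex set \<Rightarrow> complex \<Rightarrow> nat" where
  "element_index K \<eta> =
     card (a_rcosets\<^bsub>complex_ring\<lparr>carrier := ring_of_integers K\<rparr>\<^esub> (int_adjoin \<eta>))"

definition field_index :: "complex set \<Rightarrow> nat" where
  "field_index K = Gcd {element_index K \<eta> | \<eta>. \<eta> \<in> ring_of_integers K \<and> K = rat_adjoin \<eta>}"

definition common_index_divisor :: "nat \<Rightarrow> complex set \<Rightarrow> bool" where
  "common_index_divisor p K \<longleftrightarrow> Factorial_Ring.prime p \<and> p dvd field_index K"

end

theory Submission
  imports
    Defs
    "HOL-Number_Theory.Number_Theory"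
    "Jordan_Normal_Form.Char_Poly"
begin

text \<open>
  Let \<open>A\<close> be the localization at \<open>p\<close> of the ring of integers of \<open>K\<close>, a principal ideal domain with
  finitely many maximal ideals \<open>P\<close>, of residue degrees \<open>f\<^sub>P\<close>. By Hensel's criterion \<open>A = \<int>[\<eta>] + p A\<close> for
  some \<open>\<eta>\<close> unless, for some \<open>f\<close>, the maximal ideals of residue degree \<open>f\<close> outnumber the monic irreducible
  polynomials of degree \<open>f\<close> over \<open>\<int>/p\<close>. In degree 7 with \<open>p \<ge> 3\<close> this can only happen for \<open>f = 1\<close>, and only for
  \<open>p = 3\<close> and \<open>p = 5\<close>, so it suffices that at most \<open>p\<close> of the \<open>P\<close> have degree one.

  The norm of \<open>\<theta> - m\<close> is \<open>\<plusminus>F m\<close>, so \<open>\<Sum>\<^sub>P f\<^sub>P v\<^sub>P (\<theta> - m)\<close> is the \<open>p\<close>-adic valuation of \<open>F m\<close>. If the Newton polygon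
  of \<open>F\<close> has one slope, either 7 divides every ramification index or the trinomial can be rescaled to one with
  few roots modulo \<open>p\<close>. If it has two slopes, the ideals split into a part of total degree 5 and a part of
  total degree 2; in the first one, a good choice of \<open>m = p ^ k m'\<close> bounds the number of ideals of degree one.

  Finally \<open>\<eta>\<close> may be taken integral. Then \<open>1, \<eta>, \<dots>, \<eta>\<^sup>6\<close> are independent modulo \<open>p A\<close>, hence \<open>K = \<rat>(\<eta>)\<close> and the
  quotient of the ring of integers by \<open>\<int>[\<eta>]\<close> is killed by an integer prime to \<open>p\<close>.
\<close>

section \<open>Indices of additive subgroups\<close>

text \<open>The obstacle is to get through prime ideal theory without determinants, completions or
  factorization of ideals. Everything is counted by indices of additive groups: the norm of
  \<open>x\<close> is the order of \<open>A / xA\<close>. Multiplication by \<open>x\<close> has the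
  same index on commensurable groups, so the norm of \<open>\<theta> - m\<close> can be computed in
  the explicit ring of polynomials in \<theta> over the integers localized at \<open>p\<close>.
  Residue degree 2 is harmless because at most 3 such ideals face (p^2 - p)/2 >= 3 quadratic
  irreducibles; higher degrees leave even more room. For \<open>p = 3\<close> and
  \<open>p = 5\<close> the decisive freedom is that an ideal of degree one only sees
  \<open>m'\<close> modulo \<open>p\<close>, whereas the valuation of \<open>F (p ^ k * m')\<close>
  varies inside the residue class. Congruences modulo 27, 25, 9 and 625 show that no coefficients
  make every lift highly divisible. With two slopes there is no slack: the part of degree 2 may
  contribute 2 ideals, so the part of degree 5 may contribute 1 for \<open>p = 3\<close> and 3 for
  \<open>p = 5\<close>, which dictates the moduli 3^2 and 5^4.\<close>

definition add_closed :: "'a::ab_group_add set \<Rightarrow> bool" where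
  "add_closed B \<longleftrightarrow> 0 \<in> B \<and> (\<forall>x\<in>B. \<forall>y\<in>B. x - y \<in> B)"

definition coset_of :: "'a::ab_group_add set \<Rightarrow> 'a \<Rightarrow> 'a set" where
  "coset_of B x = {y. y - x \<in> B}"

text \<open>An infinite index becomes 0 under \<open>card\<close>, so \<open>0 < idx A B\<close> is
  how finiteness is expressed throughout.\<close>

definition idx :: "'a::ab_group_add set \<Rightarrow> 'a set \<Rightarrow> nat" where
  "idx A B = card (coset_of B ` A)"

lemma add_closed_0: "add_closed B \<Longrightarrow> 0 \<in> B"
  and add_closed_diff: "add_closed B \<Longrightarrow> x \<in> B \<Longrightarrow> y \<in> B \<Longrightarrow> x - y \<in> B"
  by (auto simp: add_closed_def)

lemma add_closed_uminus: "add_closed B \<Longrightarrow> x \<in> B \<Longrightarrow> - x \<in> B"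
  using add_closed_diff[of B 0 x] add_closed_0[of B] by simp

lemma add_closed_add: "add_closed B \<Longrightarrow> x \<in> B \<Longrightarrow> y \<in> B \<Longrightarrow> x + y \<in> B"
  using add_closed_diff[of B x "- y"] add_closed_uminus[of B y] by simp

lemma add_closed_sum: "add_closed B \<Longrightarrow> (\<And>i. i \<in> I \<Longrightarrow> f i \<in> B) \<Longrightarrow> (\<Sum>i\<in>I. f i) \<in> B"
  by (induction I rule: infinite_finite_induct) (auto intro: add_closed_0 add_closed_add)

lemma coset_of_eq_iff: "add_closed B \<Longrightarrow> coset_of B x = coset_of B y \<longleftrightarrow> x - y \<in> B"
proof
  assume B: "add_closed B" and e: "coset_of B x = coset_of B y"
  have "x \<in> coset_of B x" using B by (simp add: coset_of_def add_closed_0)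
  with e show "x - y \<in> B" by (simp add: coset_of_def)
next
  assume B: "add_closed B" and e: "x - y \<in> B"
  have "z - x \<in> B \<longleftrightarrow> z - y \<in> B" for z
    using add_closed_add[OF B _ e, of "z - x"] add_closed_diff[OF B _ e, of "z - y"] by auto
  then show "coset_of B x = coset_of B y" by (auto simp: coset_of_def)
qed

lemma add_closed_image:
  assumes "add_closed B" "\<And>x y. h (x - y) = h x - h y"
  shows "add_closed (h ` B)"
proof -
  have h0: "h 0 = 0" using assms(2)[of 0 0] by simp
  show ?thesis unfolding add_closed_def
  proof safe
    show "0 \<in> h ` B" using h0 add_closed_0[OF assms(1)] by (metis imageI)
    fix x y assume "x \<in> B" "y \<in> B"
    then show "h x - h y \<in> h ` B" using add_closed_diff[OF assms(1)] assms(2) by (metis imageI)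
  qed
qed

text \<open>After fixing a representative of each coset of \<open>B\<close>, translation by it
  matches pairs from \<open>A/B\<close> and \<open>B/C\<close> with \<open>A/C\<close>. A bijection
  settles infinite indices at the same time.\<close>

lemma idx_tower:
  assumes A: "add_closed A" and B: "add_closed B" and C: "add_closed C" and CB: "C \<subseteq> B" and BA: "B \<subseteq> A"
  shows "idx A C = idx A B * idx B C"
proof -
  define rep where "rep S = (SOME x. x \<in> A \<and> coset_of B x = S)" for S
  have rep: "rep S \<in> A \<and> coset_of B (rep S) = S" if "S \<in> coset_of B ` A" for S
    unfolding rep_def by (rule someI_ex) (use that in auto)
  define f where "f = (\<lambda>(S, T). (\<lambda>t. rep S + t) ` T)"
  have im: "(\<lambda>t. r + t) ` coset_of C b = coset_of C (r + b)" for r b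
  proof -
    have "y \<in> (\<lambda>t. r + t) ` coset_of C b" if "y \<in> coset_of C (r + b)" for y
      using that by (intro image_eqI[of _ _ "y - r"]) (auto simp: coset_of_def algebra_simps)
    then show ?thesis by (auto simp: coset_of_def algebra_simps)
  qed
  have "bij_betw f ((coset_of B ` A) \<times> (coset_of C ` B)) (coset_of C ` A)"
  proof (rule bij_betw_imageI)
    show "inj_on f ((coset_of B ` A) \<times> (coset_of C ` B))"
    proof (rule inj_onI, clarify)
      fix a b a' b' assume *: "a \<in> A" "b \<in> B" "a' \<in> A" "b' \<in> B"
        and e: "f (coset_of B a, coset_of C b) = f (coset_of B a', coset_of C b')"
      let ?r = "rep (coset_of B a)" and ?r' = "rep (coset_of B a')"
      have r: "?r - a \<in> B" "?r' - a' \<in> B" using rep * coset_of_eq_iff[OF B] by blast+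
      have "(?r + b) - (?r' + b') \<in> C"
        using e by (simp add: f_def im coset_of_eq_iff[OF C])
      then have "(?r + b) - (?r' + b') \<in> B" using CB by auto
      moreover have "?r - ?r' = ((?r + b) - (?r' + b')) + (b' - b)" by simp
      ultimately have "?r - ?r' \<in> B"
        using add_closed_add[OF B] add_closed_diff[OF B] * by metis
      then have ee: "coset_of B a = coset_of B a'"
        using rep[of "coset_of B a"] rep[of "coset_of B a'"] * coset_of_eq_iff[OF B]
        by (metis imageI)
      then have "b - b' \<in> C" using \<open>(?r + b) - (?r' + b') \<in> C\<close> by simp
      then show "coset_of B a = coset_of B a' \<and> coset_of C b = coset_of C b'"
        using ee coset_of_eq_iff[OF C] by simp
    qed
    show "f ` ((coset_of B ` A) \<times> (coset_of C ` B)) = coset_of C ` A"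
    proof (intro equalityI subsetI)
      fix z assume "z \<in> f ` ((coset_of B ` A) \<times> (coset_of C ` B))"
      then obtain a b where "a \<in> A" "b \<in> B" "z = coset_of C (rep (coset_of B a) + b)"
        by (auto simp: f_def im)
      then show "z \<in> coset_of C ` A" using rep[of "coset_of B a"] BA add_closed_add[OF A] by blast
    next
      fix z assume "z \<in> coset_of C ` A"
      then obtain a where a: "a \<in> A" "z = coset_of C a" by auto
      let ?r = "rep (coset_of B a)"
      have "a - ?r \<in> B" using rep[of "coset_of B a"] a coset_of_eq_iff[OF B, of a ?r] by auto
      then have "z = f (coset_of B a, coset_of C (a - ?r))" "coset_of C (a - ?r) \<in> coset_of C ` B"
        using a by (auto simp: f_def im)
      then show "z \<in> f ` ((coset_of B ` A) \<times> (coset_of C ` B))" using a by blast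
    qed
  qed
  then show ?thesis
    unfolding idx_def by (metis bij_betw_same_card card_cartesian_product)
qed

lemma idx_image:
  assumes B: "add_closed B" and h: "\<And>x y. h (x - y) = h x - h y" and inj: "inj h"
  shows "idx (h ` A) (h ` B) = idx A B"
proof -
  have hB: "add_closed (h ` B)" by (rule add_closed_image[OF B h])
  have key: "coset_of (h ` B) (h x) = coset_of (h ` B) (h y) \<longleftrightarrow> coset_of B x = coset_of B y" for x y
    using inj by (simp add: coset_of_eq_iff[OF B] coset_of_eq_iff[OF hB] h[symmetric] inj_image_mem_iff)
  define g where "g S = coset_of (h ` B) (h (SOME x. coset_of B x = S))" for S
  have g: "g (coset_of B x) = coset_of (h ` B) (h x)" for x
    unfolding g_def key by (rule someI[of _ x]) simp
  have "bij_betw g (coset_of B ` A) (coset_of (h ` B) ` h ` A)"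
    by (rule bij_betw_imageI) (auto simp: inj_on_def g key image_image)
  then show ?thesis unfolding idx_def by (metis bij_betw_same_card)
qed

lemma idx_eq_card_reps:
  assumes B: "add_closed B" and R: "R \<subseteq> A"
    and ex: "\<And>x. x \<in> A \<Longrightarrow> \<exists>r\<in>R. x - r \<in> B"
    and uniq: "\<And>r r'. r \<in> R \<Longrightarrow> r' \<in> R \<Longrightarrow> r - r' \<in> B \<Longrightarrow> r = r'"
  shows "idx A B = card R"
proof -
  have "coset_of B x \<in> coset_of B ` R" if "x \<in> A" for x
    using ex[OF that] coset_of_eq_iff[OF B, of x] by blast
  then have "coset_of B ` A = coset_of B ` R"
    using R by auto
  moreover have "inj_on (coset_of B) R"
    using uniq by (auto simp: inj_on_def coset_of_eq_iff[OF B])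
  ultimately show ?thesis unfolding idx_def by (simp add: card_image)
qed

lemma obtain_reps:
  assumes B: "add_closed B"
  obtains R where "R \<subseteq> A" "\<And>x. x \<in> A \<Longrightarrow> \<exists>r\<in>R. x - r \<in> B"
    "\<And>r r'. r \<in> R \<Longrightarrow> r' \<in> R \<Longrightarrow> r - r' \<in> B \<Longrightarrow> r = r'" "card R = idx A B"
    "0 < idx A B \<Longrightarrow> finite R"
proof -
  define rep where "rep S = (SOME x. x \<in> A \<and> coset_of B x = S)" for S
  have rep: "rep S \<in> A \<and> coset_of B (rep S) = S" if "S \<in> coset_of B ` A" for S
    unfolding rep_def by (rule someI_ex) (use that in auto)
  define R where "R = rep ` coset_of B ` A"
  have 1: "R \<subseteq> A" using rep by (auto simp: R_def)
  have 2: "\<exists>r\<in>R. x - r \<in> B" if "x \<in> A" for x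
    using rep[of "coset_of B x"] that coset_of_eq_iff[OF B, of x] unfolding R_def by blast
  have 3: "r = r'" if "r \<in> R" "r' \<in> R" "r - r' \<in> B" for r r'
    using that rep coset_of_eq_iff[OF B] unfolding R_def by (smt (verit) image_iff)
  have 4: "card R = idx A B" using idx_eq_card_reps[OF B 1 2 3] by simp
  show ?thesis using that[OF 1 2 3 4] 4 by (metis card.infinite less_irrefl)
qed

lemma idx_le_card:
  assumes B: "add_closed B" and R: "finite R" and ex: "\<And>x. x \<in> A \<Longrightarrow> \<exists>r\<in>R. x - r \<in> B" and A: "A \<noteq> {}"
  shows "0 < idx A B" "idx A B \<le> card R"
proof -
  have sub: "coset_of B ` A \<subseteq> coset_of B ` R"
  proof (rule image_subsetI)
    fix x assume "x \<in> A"
    then show "coset_of B x \<in> coset_of B ` R" using ex[of x] coset_of_eq_iff[OF B, of x] by blast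
  qed
  with R have fin: "finite (coset_of B ` A)" by (meson finite_imageI finite_subset)
  then show "0 < idx A B" using A by (simp add: idx_def card_gt_0_iff)
  show "idx A B \<le> card R" unfolding idx_def
    using card_mono[OF _ sub] card_image_le[OF R, of "coset_of B"] R by (meson finite_imageI le_trans)
qed

lemma idx_inj_le:
  assumes B: "add_closed B" and pos: "0 < idx A B" and R: "R \<subseteq> A"
    and uniq: "\<And>r r'. r \<in> R \<Longrightarrow> r' \<in> R \<Longrightarrow> r - r' \<in> B \<Longrightarrow> r = r'"
  shows "finite R" "card R \<le> idx A B"
proof -
  have inj: "inj_on (coset_of B) R" using uniq by (auto simp: inj_on_def coset_of_eq_iff[OF B])
  have fin: "finite (coset_of B ` A)" using pos by (simp add: idx_def card_gt_0_iff)
  have sub: "coset_of B ` R \<subseteq> coset_of B ` A" using R by auto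
  show "finite R" using inj fin sub finite_imageD finite_subset by metis
  show "card R \<le> idx A B" unfolding idx_def using inj fin sub by (metis card_image card_mono)
qed

lemma idx_eq_1_iff:
  assumes A: "add_closed A" and B: "add_closed B" and "B \<subseteq> A"
  shows "idx A B = 1 \<longleftrightarrow> A = B"
proof
  assume "idx A B = 1"
  then obtain S where S: "coset_of B ` A = {S}" unfolding idx_def by (auto simp: card_1_singleton_iff)
  have "x \<in> B" if "x \<in> A" for x
  proof -
    have "coset_of B x = S" "coset_of B 0 = S" using S that add_closed_0[OF A] by blast+
    then show ?thesis using coset_of_eq_iff[OF B, of x 0] by simp
  qed
  then show "A = B" using assms by auto
next
  assume "A = B"
  then have "coset_of B ` A = {coset_of B 0}"
    using coset_of_eq_iff[OF B, of _ 0] add_closed_0[OF A] by auto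
  then show "idx A B = 1" by (simp add: idx_def)
qed

text \<open>The index of \<open>h\<close>
  B\<open>in\<close>A\<open>is computed once through\<close>B\<open>and once through\<close>h
  \<open>A\<close>; as \<open>h\<close> carries \<open>A, B\<close> to their images, the finite
  factor \<open>idx A B\<close> cancels. With \<open>h\<close> a multiplication this transports
  norms between commensurable rings.\<close>

lemma idx_endo_eq:
  assumes A: "add_closed A" and B: "add_closed B" and BA: "B \<subseteq> A"
    and h: "\<And>x y. h (x - y) = h x - h y" and inj: "inj h"
    and hA: "h ` A \<subseteq> A" and hB: "h ` B \<subseteq> B" and pos: "0 < idx A B"
  shows "idx A (h ` A) = idx B (h ` B)"
proof -
  have hA': "add_closed (h ` A)" and hB': "add_closed (h ` B)"
    using add_closed_image[of A h] add_closed_image[of B h] A B h by blast+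
  have "idx A B * idx B (h ` B) = idx A (h ` B)"
    by (rule idx_tower[symmetric]) (use A B hB' BA hB in auto)
  also have "\<dots> = idx A (h ` A) * idx (h ` A) (h ` B)"
    by (rule idx_tower) (use A hA' hB' BA hA in auto)
  also have "idx (h ` A) (h ` B) = idx A B" by (rule idx_image[OF B h inj])
  finally show ?thesis using pos by simp
qed

section \<open>Semilocal rings\<close>

text \<open>The polynomials \<open>X ^ j - X ^ i\<close> are the only instances of integral closedness that are needed:
  by finiteness modulo \<open>p\<close>, integral dependence can be produced by the pigeonhole principle.\<close>

locale semilocal =
  fixes A :: "'a::field_char_0 set" and p d :: nat
  assumes one_in: "1 \<in> A"
    and diff_in: "x \<in> A \<Longrightarrow> y \<in> A \<Longrightarrow> x - y \<in> A"
    and mult_in: "x \<in> A \<Longrightarrow> y \<in> A \<Longrightarrow> x * y \<in> A"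
    and p_prime: "Factorial_Ring.prime p"
    and int_unit: "\<not> int p dvd m \<Longrightarrow> inverse (of_int m) \<in> A"
    and p_nonunit: "inverse (of_nat p) \<notin> A"
    and idx_p: "idx A ((*) (of_nat p) ` A) = p ^ d"
    and int_closed: "of_nat p * x \<in> A \<Longrightarrow> i < j \<Longrightarrow> x ^ j - x ^ i \<in> A \<Longrightarrow> x \<in> A"
    and dvd_p_power: "x \<in> A \<Longrightarrow> x \<noteq> 0 \<Longrightarrow> \<exists>n. of_nat p ^ n / x \<in> A"
begin

abbreviation \<pi> :: 'a where "\<pi> \<equiv> of_nat p"

lemma zero_in: "0 \<in> A"
  using diff_in[OF one_in one_in] by simp

lemma A_closed: "add_closed A"
  by (simp add: add_closed_def zero_in diff_in)

lemma add_in: "x \<in> A \<Longrightarrow> y \<in> A \<Longrightarrow> x + y \<in> A"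
  and uminus_in: "x \<in> A \<Longrightarrow> - x \<in> A"
  and sum_in: "(\<And>i. i \<in> I \<Longrightarrow> f i \<in> A) \<Longrightarrow> sum f I \<in> A"
  using A_closed by (auto intro: add_closed_add add_closed_uminus add_closed_sum)

lemma prod_in: "(\<And>i. i \<in> I \<Longrightarrow> f i \<in> A) \<Longrightarrow> prod f I \<in> A"
  by (induction I rule: infinite_finite_induct) (auto intro: one_in mult_in)

lemma power_in: "x \<in> A \<Longrightarrow> x ^ n \<in> A"
  by (induction n) (auto intro: one_in mult_in)

lemma of_nat_in: "of_nat n \<in> A"
  by (induction n) (auto intro: zero_in one_in add_in)

lemma of_int_in: "of_int n \<in> A"
  by (cases n rule: int_cases2) (auto intro: of_nat_in uminus_in)

lemma p_gt_1: "p > 1" using p_prime by (rule prime_gt_1_nat)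

lemma pi_nonzero: "\<pi> \<noteq> 0" using p_gt_1 by simp

abbreviation ipoly :: "int poly \<Rightarrow> 'a \<Rightarrow> 'a" where
  "ipoly h x \<equiv> poly (map_poly of_int h) x"

lemma ipoly_in: "x \<in> A \<Longrightarrow> ipoly h x \<in> A"
  unfolding poly_altdef by (intro sum_in mult_in power_in) (auto intro: of_int_in)

section \<open>Ideals, norms as indices, and maximal ideals\<close>

definition is_ideal :: "'a set \<Rightarrow> bool" where
  "is_ideal I \<longleftrightarrow> I \<subseteq> A \<and> add_closed I \<and> (\<forall>a\<in>A. \<forall>x\<in>I. a * x \<in> I)"

lemma is_idealD:
  assumes "is_ideal I"
  shows "x \<in> I \<Longrightarrow> x \<in> A" "0 \<in> I" "x \<in> I \<Longrightarrow> y \<in> I \<Longrightarrow> x + y \<in> I" "x \<in> I \<Longrightarrow> y \<in> I \<Longrightarrow> x - y \<in> I"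
    "x \<in> I \<Longrightarrow> - x \<in> I" "a \<in> A \<Longrightarrow> x \<in> I \<Longrightarrow> a * x \<in> I" "a \<in> A \<Longrightarrow> x \<in> I \<Longrightarrow> x * a \<in> I"
    "add_closed I" "(\<And>i. i \<in> J \<Longrightarrow> f i \<in> I) \<Longrightarrow> sum f J \<in> I"
  using assms
  by (auto simp: is_ideal_def mult.commute[of x a]
      intro: add_closed_0 add_closed_add add_closed_diff add_closed_uminus add_closed_sum)

lemma is_idealI:
  assumes "\<And>x. x \<in> I \<Longrightarrow> x \<in> A" "0 \<in> I" "\<And>x y. x \<in> I \<Longrightarrow> y \<in> I \<Longrightarrow> x - y \<in> I"
    "\<And>a x. a \<in> A \<Longrightarrow> x \<in> I \<Longrightarrow> a * x \<in> I"
  shows "is_ideal I"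
  using assms by (auto simp: is_ideal_def add_closed_def)

definition princ :: "'a \<Rightarrow> 'a set" where "princ x = (*) x ` A"

lemma princ_iff: "x \<noteq> 0 \<Longrightarrow> y \<in> princ x \<longleftrightarrow> y / x \<in> A"
  by (auto simp: princ_def image_iff intro: bexI[of _ "y / x"])

lemma princE: "y \<in> princ x \<Longrightarrow> (\<And>z. z \<in> A \<Longrightarrow> y = x * z \<Longrightarrow> thesis) \<Longrightarrow> thesis"
  by (auto simp: princ_def)

lemma princI: "z \<in> A \<Longrightarrow> x * z \<in> princ x"
  by (auto simp: princ_def)

lemma princ_ideal: "x \<in> A \<Longrightarrow> is_ideal (princ x)"
proof (rule is_idealI)
  assume x: "x \<in> A"
  show "0 \<in> princ x" using princI[OF zero_in, of x] by simp
  fix y assume y: "y \<in> princ x"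
  show "y \<in> A" using y x by (auto elim!: princE intro: mult_in)
  show "y - z \<in> princ x" if "z \<in> princ x" for z
    using y that by (auto elim!: princE simp: right_diff_distrib[symmetric] intro!: princI diff_in)
  show "a * y \<in> princ x" if "a \<in> A" for a
  proof -
    obtain z where z: "z \<in> A" "y = x * z" using y by (rule princE)
    then have "a * y = x * (a * z)" by (simp add: mult.left_commute)
    moreover have "x * (a * z) \<in> princ x" using z that by (intro princI mult_in)
    ultimately show ?thesis by (simp only:)
  qed
qed

lemma self_in_princ: "x \<in> princ x"
  using princI[OF one_in, of x] by simp

text \<open>The absolute norm. As an index it is multiplicative by \<open>idx_tower\<close>, with no
  embeddings or determinants involved.\<close>

definition nrm :: "'a \<Rightarrow> nat" where "nrm x = idx A (princ x)"

lemma nrm_pi: "nrm \<pi> = p ^ d"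
  using idx_p by (simp add: nrm_def princ_def)

lemma princ_antimono: "z \<in> A \<Longrightarrow> princ (x * z) \<subseteq> princ x"
proof
  fix w assume z: "z \<in> A" and "w \<in> princ (x * z)"
  then obtain u where "u \<in> A" "w = x * (z * u)" by (auto elim!: princE simp: mult.assoc)
  then show "w \<in> princ x" using z by (simp only: princI mult_in)
qed

lemma nrm_mult:
  assumes "x \<in> A" "y \<in> A" "x \<noteq> 0"
  shows "nrm (x * y) = nrm x * nrm y"
proof -
  have e: "princ (x * y) = (*) x ` princ y" by (auto simp: princ_def image_image mult.assoc)
  have "nrm (x * y) = idx A (princ x) * idx (princ x) (princ (x * y))"
    unfolding nrm_def
  proof (rule idx_tower)
    show "princ (x * y) \<subseteq> princ x"
      using assms(2) by (rule princ_antimono)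
    show "princ x \<subseteq> A" using princ_ideal[OF assms(1)] by (simp add: is_ideal_def)
    show "add_closed (princ x)" "add_closed (princ (x * y))"
      using is_idealD(8) princ_ideal assms mult_in by blast+
  qed (rule A_closed)
  also have "idx (princ x) (princ (x * y)) = idx A (princ y)"
  proof -
    have "idx ((*) x ` A) ((*) x ` princ y) = idx A (princ y)"
    proof (rule idx_image)
      show "add_closed (princ y)" using is_idealD(8) princ_ideal assms by blast
      show "inj ((*) x)" using assms by (simp add: inj_def)
    qed (simp add: right_diff_distrib)
    then show ?thesis unfolding e princ_def[of x] .
  qed
  finally show ?thesis by (simp add: nrm_def)
qed

lemma nrm_power: "x \<in> A \<Longrightarrow> x \<noteq> 0 \<Longrightarrow> nrm (x ^ n) = nrm x ^ n"
proof (induction n)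
  case 0
  have "princ 1 = A" by (simp add: princ_def)
  then show ?case using idx_eq_1_iff[OF A_closed A_closed] by (simp add: nrm_def)
qed (simp add: nrm_mult power_in)

lemma obtain_pi_power:
  assumes "x \<in> A" "x \<noteq> 0"
  obtains y n where "y \<in> A" "y \<noteq> 0" "x * y = \<pi> ^ n"
proof -
  obtain n where "\<pi> ^ n / x \<in> A" using dvd_p_power assms by blast
  then show ?thesis using assms pi_nonzero by (intro that[of "\<pi> ^ n / x" n]) auto
qed

text \<open>Some power of \<pi> is a multiple of \<open>x\<close>, and the norm of that power is a
  positive power of \<open>p\<close>, so the factor \<open>nrm x\<close> cannot vanish:
  \<open>A / xA\<close> is finite.\<close>

lemma nrm_pos: 
  assumes "x \<in> A" "x \<noteq> 0"
  shows "nrm x > 0"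
proof -
  obtain y n where y: "y \<in> A" "y \<noteq> 0" "x * y = \<pi> ^ n" using obtain_pi_power assms by blast
  then have "nrm x * nrm y = p ^ (d * n)"
    using nrm_mult[OF assms(1) y(1) assms(2)] nrm_power[OF of_nat_in pi_nonzero, of n]
    by (simp add: nrm_pi power_mult)
  then show ?thesis using p_gt_1 by (metis gr0I mult_0 power_not_zero not_one_less_zero)
qed

lemma idx_pos:
  assumes "is_ideal I" "x \<in> I" "x \<noteq> 0"
  shows "idx A I > 0"
proof -
  have "x \<in> A" using assms is_idealD by blast
  have "nrm x = idx A I * idx I (princ x)"
    unfolding nrm_def
  proof (rule idx_tower)
    show "princ x \<subseteq> I" using assms is_idealD(7) by (auto elim!: princE)
  qed (use assms(1) princ_ideal[OF \<open>x \<in> A\<close>] A_closed in \<open>auto simp: is_ideal_def\<close>)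
  then show ?thesis using nrm_pos[OF \<open>x \<in> A\<close> assms(3)] by (cases "idx A I") auto
qed

text \<open>Maximality is phrased as \<open>A / P\<close> being a field, which is the form in which
  it is applied; containing \<pi> places all these ideals inside the finite ring
  \<open>A / \<pi>A\<close>.\<close>

definition maxid :: "'a set \<Rightarrow> bool" where
  "maxid P \<longleftrightarrow> is_ideal P \<and> \<pi> \<in> P \<and> 1 \<notin> P \<and> (\<forall>x\<in>A-P. \<exists>y\<in>A. 1 - x * y \<in> P)"

lemma maxidD:
  assumes "maxid P"
  shows "is_ideal P" "\<pi> \<in> P" "1 \<notin> P" "x \<in> A \<Longrightarrow> x \<notin> P \<Longrightarrow> \<exists>y\<in>A. 1 - x * y \<in> P"
  using assms by (auto simp: maxid_def)

lemma maxid_prime: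
  assumes "maxid P" "x \<in> A" "y \<in> A" "x * y \<in> P" "x \<notin> P"
  shows "y \<in> P"
proof -
  note I = is_idealD[OF maxidD(1)[OF assms(1)]]
  obtain z where z: "z \<in> A" "1 - x * z \<in> P" using maxidD(4)[OF assms(1)] assms by blast
  have "y = y * (1 - x * z) + z * (x * y)" by (simp add: algebra_simps)
  then show ?thesis using I z assms by metis
qed

text \<open>An ideal containing \<pi> is the union of the cosets of \<open>princ \<pi>\<close> that
  it meets, hence is determined by a subset of a finite quotient.\<close>

lemma finite_ideals: "finite {I. is_ideal I \<and> \<pi> \<in> I}"
proof -
  let ?C = "coset_of (princ \<pi>) ` A"
  have fin: "finite ?C" using nrm_pi p_gt_1 unfolding nrm_def idx_def
    by (metis card.infinite power_not_zero not_one_less_zero)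
  let ?f = "\<lambda>I. coset_of (princ \<pi>) ` I"
  have "inj_on ?f {I. is_ideal I \<and> \<pi> \<in> I}"
  proof (rule inj_on_inverseI[of _ "\<lambda>S. \<Union>S"])
    fix I assume "I \<in> {I. is_ideal I \<and> \<pi> \<in> I}"
    then have I: "is_ideal I" "\<pi> \<in> I" by auto
    have sub: "princ \<pi> \<subseteq> I" using I is_idealD by (auto elim!: princE)
    show "\<Union> (?f I) = I"
    proof (intro equalityI subsetI)
      fix x assume "x \<in> \<Union> (?f I)"
      then obtain y where y: "y \<in> I" "x - y \<in> princ \<pi>" by (auto simp: coset_of_def)
      then have "x - y \<in> I" using sub by auto
      then have "x - y + y \<in> I" using y I is_idealD by blast
      then show "x \<in> I" by simp
    next
      fix x assume "x \<in> I"
      then show "x \<in> \<Union> (?f I)"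
        using is_idealD(2)[OF princ_ideal[OF of_nat_in]] by (auto simp: coset_of_def intro!: bexI[of _ x])
    qed
  qed
  moreover have "?f ` {I. is_ideal I \<and> \<pi> \<in> I} \<subseteq> Pow ?C" by (auto simp: is_ideal_def)
  ultimately show ?thesis using fin by (meson finite_Pow_iff finite_imageD finite_subset)
qed

definition spec :: "'a set set" where "spec = {P. maxid P}"

lemma finite_spec: "finite spec"
  by (rule finite_subset[OF _ finite_ideals]) (auto simp: spec_def maxid_def)

lemma spec_iff: "P \<in> spec \<longleftrightarrow> maxid P" by (simp add: spec_def)

lemma ideal_sum:
  assumes "is_ideal I" "x \<in> A"
  shows "is_ideal {i + a * x |i a. i \<in> I \<and> a \<in> A}" (is "is_ideal ?J")
proof (rule is_idealI)
  note I = is_idealD[OF assms(1)]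
  show "y \<in> A" if "y \<in> ?J" for y using that assms I(1) by (auto intro: add_in mult_in)
  show "0 \<in> ?J" using I(2) zero_in by force
  show "y - z \<in> ?J" if "y \<in> ?J" "z \<in> ?J" for y z
  proof -
    obtain i a i' a' where "y = i + a * x" "z = i' + a' * x" "i \<in> I" "a \<in> A" "i' \<in> I" "a' \<in> A"
      using \<open>y \<in> ?J\<close> \<open>z \<in> ?J\<close> by auto
    then have "y - z = (i - i') + (a - a') * x" "i - i' \<in> I" "a - a' \<in> A"
      using I by (auto simp: algebra_simps intro: diff_in)
    then show ?thesis by auto
  qed
  show "b * y \<in> ?J" if "b \<in> A" "y \<in> ?J" for b y
  proof -
    obtain i a where "y = i + a * x" "i \<in> I" "a \<in> A" using \<open>y \<in> ?J\<close> by auto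
    then have "b * y = b * i + (b * a) * x" "b * i \<in> I" "b * a \<in> A"
      using I \<open>b \<in> A\<close> by (auto simp: algebra_simps intro: mult_in)
    then show ?thesis by auto
  qed
qed

lemma subset_ideal_sum: "I \<subseteq> {i + a * x |i a. i \<in> I \<and> a \<in> A}"
proof
  fix i assume "i \<in> I"
  moreover have "i = i + 0 * x" by simp
  ultimately show "i \<in> {i + a * x |i a. i \<in> I \<and> a \<in> A}" using zero_in by blast
qed

lemma in_ideal_sum:
  assumes "is_ideal I"
  shows "x \<in> {i + a * x |i a. i \<in> I \<and> a \<in> A}"
proof -
  have "x = 0 + 1 * x" by simp
  then show ?thesis using is_idealD(2)[OF assms] one_in by blast
qed

text \<open>Finitely many ideals contain \<pi>, so one above \<open>I\<close> avoiding 1 can be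
  taken maximal. If some \<open>x\<close> had no inverse modulo it, adjoining \<open>x\<close> would
  enlarge it.\<close>

lemma exists_maxid:
  assumes I: "is_ideal I" "\<pi> \<in> I" "1 \<notin> I"
  obtains P where "maxid P" "I \<subseteq> P"
proof -
  define S where "S = {J. is_ideal J \<and> \<pi> \<in> J \<and> 1 \<notin> J \<and> I \<subseteq> J}"
  have "finite S" unfolding S_def by (rule finite_subset[OF _ finite_ideals]) auto
  moreover have "I \<in> S" using I by (auto simp: S_def)
  ultimately have "\<exists>P\<in>S. I \<subseteq> P \<and> (\<forall>J\<in>S. P \<subseteq> J \<longrightarrow> P = J)"
    by (rule finite_has_maximal2)
  then obtain P where PS: "P \<in> S" and Pmax: "\<forall>J\<in>S. P \<subseteq> J \<longrightarrow> P = J" by blast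
  have P: "is_ideal P" "\<pi> \<in> P" "1 \<notin> P" "I \<subseteq> P" using PS by (auto simp: S_def)
  have "\<exists>y\<in>A. 1 - x * y \<in> P" if x: "x \<in> A - P" for x
  proof (rule ccontr)
    assume neg: "\<not> ?thesis"
    let ?J = "{i + a * x |i a. i \<in> P \<and> a \<in> A}"
    have J: "is_ideal ?J" using ideal_sum[OF P(1)] x by blast
    have sub: "P \<subseteq> ?J" by (rule subset_ideal_sum)
    have xJ: "x \<in> ?J" by (rule in_ideal_sum[OF P(1)])
    have "1 \<notin> ?J"
    proof
      assume "1 \<in> ?J"
      then obtain i a where "1 = i + a * x" "i \<in> P" "a \<in> A" by auto
      then have "1 - x * a = i" by (metis add_diff_cancel_right' mult.commute)
      with \<open>i \<in> P\<close> have "1 - x * a \<in> P" by simp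
      with \<open>a \<in> A\<close> neg show False by auto
    qed
    moreover have "\<pi> \<in> ?J" "I \<subseteq> ?J" using sub P(2,4) by blast+
    ultimately have "?J \<in> S" using J unfolding S_def by simp
    from Pmax[rule_format, OF this sub] have "?J = P" by (rule sym)
    then show False using xJ x by auto
  qed
  then have "maxid P" using P by (simp add: maxid_def)
  then show ?thesis using that P(4) by simp
qed

text \<open>This is the local-global principle. Since \<open>maxid\<close> only concerns ideals
  containing \<pi>, it first yields \<open>1 = i + a * \<pi>\<close>; multiplying by powers of \<pi>
  then lowers a known \<open>\<pi> ^ n \<in> I\<close> step by step to
  \<open>\<pi> ^ 0\<close>.\<close>

lemma ideal_eq_A:
  assumes I: "is_ideal I" and x: "x \<in> I" "x \<noteq> 0" and no: "\<And>P. maxid P \<Longrightarrow> \<exists>y\<in>I. y \<notin> P"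
  shows "1 \<in> I"
proof -
  note I' = is_idealD[OF I]
  let ?J = "{i + a * \<pi> |i a. i \<in> I \<and> a \<in> A}"
  have J: "is_ideal ?J" by (rule ideal_sum[OF I of_nat_in])
  have "I \<subseteq> ?J" by (rule subset_ideal_sum)
  moreover have "\<pi> \<in> ?J" by (rule in_ideal_sum[OF I])
  moreover have "1 \<in> ?J"
  proof (rule ccontr)
    assume "1 \<notin> ?J"
    then obtain P where P: "maxid P" "?J \<subseteq> P" using exists_maxid[OF J \<open>\<pi> \<in> ?J\<close>] by blast
    then show False using no[OF P(1)] \<open>I \<subseteq> ?J\<close> by blast
  qed
  then obtain i a where ia: "1 = i + a * \<pi>" "i \<in> I" "a \<in> A" by auto
  have "\<exists>y n. y \<in> A \<and> y \<noteq> 0 \<and> x * y = \<pi> ^ n" using obtain_pi_power[of x] x I'(1) by metis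
  then obtain y n where "y \<in> A" "x * y = \<pi> ^ n" by auto
  then have "\<pi> ^ n \<in> I" using I' x by metis
  then show ?thesis
  proof (induction n)
    case (Suc n)
    have "\<pi> ^ n = \<pi> ^ n * (i + a * \<pi>)" using ia(1) by simp
    also have "\<dots> = \<pi> ^ n * i + a * \<pi> ^ Suc n" by (simp add: algebra_simps)
    finally have e: "\<pi> ^ n = \<pi> ^ n * i + a * \<pi> ^ Suc n" .
    have "\<pi> ^ n * i \<in> I" "a * \<pi> ^ Suc n \<in> I" using I'(6) ia power_in[OF of_nat_in] Suc.prems by blast+
    then have "\<pi> ^ n \<in> I" using I'(3) e by metis
    then show ?case by (rule Suc.IH)
  qed simp
qed

lemma exists_separating:
  assumes "maxid P" "maxid Q" "P \<noteq> Q"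
  obtains c where "c \<in> Q" "c \<in> A" "1 - c \<in> P"
proof -
  have "\<not> Q \<subseteq> P"
  proof
    assume "Q \<subseteq> P"
    then obtain x where x: "x \<in> P" "x \<notin> Q" using assms by auto
    then have "x \<in> A" using is_idealD(1) maxidD(1) assms by blast
    then obtain y where y: "y \<in> A" "1 - x * y \<in> Q" using maxidD(4)[OF assms(2)] x by blast
    then have "1 - x * y \<in> P" using \<open>Q \<subseteq> P\<close> by auto
    moreover have "x * y \<in> P" using x y is_idealD(7) maxidD(1) assms by blast
    ultimately have "1 - x * y + x * y \<in> P" using is_idealD(3) maxidD(1) assms by blast
    then show False using maxidD(3) assms by simp
  qed
  then obtain x where x: "x \<in> Q" "x \<notin> P" by auto
  then have xA: "x \<in> A" using is_idealD(1) maxidD(1) assms by blast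
  then obtain y where y: "y \<in> A" "1 - x * y \<in> P" using maxidD(4)[OF assms(1)] x by blast
  then show ?thesis using x xA is_idealD(7) maxidD(1) assms(2) by (intro that[of "x * y"]) (auto intro: mult_in)
qed

lemma maxid_one_minus_mult:
  assumes "maxid P" "x \<in> A" "y \<in> A" "1 - x \<in> P" "1 - y \<in> P"
  shows "1 - x * y \<in> P"
proof -
  have "1 - x * y = (1 - x) + x * (1 - y)" by (simp add: algebra_simps)
  then show ?thesis using assms is_idealD[OF maxidD(1)[OF assms(1)]] by metis
qed

section \<open>The Chinese remainder theorem for the maximal ideals\<close>

text \<open>Each \<open>e P\<close> is a product of separating elements, one for every other maximal
  ideal. They are idempotent only modulo the radical, which is all that \<open>crt\<close>
  needs.\<close>

lemma idempotents:
  obtains e where "\<And>P. maxid P \<Longrightarrow> e P \<in> A" "\<And>P. maxid P \<Longrightarrow> 1 - e P \<in> P"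
    "\<And>P Q. maxid P \<Longrightarrow> maxid Q \<Longrightarrow> P \<noteq> Q \<Longrightarrow> e P \<in> Q"
proof -
  have "\<exists>e. e \<in> A \<and> 1 - e \<in> P \<and> (\<forall>Q\<in>spec - {P}. e \<in> Q)" if P: "maxid P" for P
  proof -
    have "\<exists>c. c \<in> Q \<and> c \<in> A \<and> 1 - c \<in> P" if "Q \<in> spec - {P}" for Q
      using exists_separating[OF P, of Q] that spec_iff by (metis DiffD1 DiffD2 insertI1)
    then obtain c where c: "\<And>Q. Q \<in> spec - {P} \<Longrightarrow> c Q \<in> Q \<and> c Q \<in> A \<and> 1 - c Q \<in> P" by metis
    have fin: "finite (spec - {P})" using finite_spec by simp
    have "1 - prod c S \<in> P" if "finite S" "S \<subseteq> spec - {P}" for S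
      using that
    proof (induction S)
      case empty
      then show ?case using is_idealD(2)[OF maxidD(1)[OF P]] by simp
    next
      case (insert Q S)
      then show ?case using maxid_one_minus_mult[OF P, of "c Q" "prod c S"] c by (auto intro!: prod_in)
    qed
    then have "1 - prod c (spec - {P}) \<in> P" using fin by auto
    moreover have "prod c (spec - {P}) \<in> Q" if Q: "Q \<in> spec - {P}" for Q
    proof -
      have "prod c (spec - {P}) = c Q * prod c (spec - {P} - {Q})" by (rule prod.remove[OF fin Q])
      moreover have "prod c (spec - {P} - {Q}) \<in> A" using c by (intro prod_in) auto
      ultimately show ?thesis using c[OF Q] Q is_idealD(7)[OF maxidD(1)] spec_iff by (metis DiffD1)
    qed
    moreover have "prod c (spec - {P}) \<in> A" using c by (intro prod_in) auto
    ultimately show ?thesis by blast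
  qed
  then obtain e where "\<And>P. maxid P \<Longrightarrow> e P \<in> A \<and> 1 - e P \<in> P \<and> (\<forall>Q\<in>spec - {P}. e P \<in> Q)" by metis
  then show ?thesis by (intro that[of e]) (auto simp: spec_iff)
qed

lemma crt:
  assumes "\<And>P. maxid P \<Longrightarrow> g P \<in> A"
  obtains x where "x \<in> A" "\<And>P. maxid P \<Longrightarrow> x - g P \<in> P"
proof -
  obtain e where e: "\<And>P. maxid P \<Longrightarrow> e P \<in> A" "\<And>P. maxid P \<Longrightarrow> 1 - e P \<in> P"
    "\<And>P Q. maxid P \<Longrightarrow> maxid Q \<Longrightarrow> P \<noteq> Q \<Longrightarrow> e P \<in> Q" by (rule idempotents) blast
  let ?x = "\<Sum>P\<in>spec. g P * e P"
  have "?x \<in> A" using assms e by (intro sum_in mult_in) (auto simp: spec_iff)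
  moreover have "?x - g P \<in> P" if P: "maxid P" for P
  proof -
    note I = is_idealD[OF maxidD(1)[OF P]]
    have "?x = g P * e P + (\<Sum>Q\<in>spec - {P}. g Q * e Q)"
      by (rule sum.remove) (use P finite_spec spec_iff in auto)
    then have "?x - g P = (\<Sum>Q\<in>spec - {P}. g Q * e Q) - g P * (1 - e P)" by (simp add: algebra_simps)
    moreover have "(\<Sum>Q\<in>spec - {P}. g Q * e Q) \<in> P"
    proof (rule I(9), rule I(6))
      fix Q assume "Q \<in> spec - {P}"
      then show "g Q \<in> A" "e Q \<in> P" using assms e(3)[of Q P] P by (auto simp: spec_iff)
    qed
    moreover have "g P * (1 - e P) \<in> P" using I(6) assms e P by blast
    ultimately show ?thesis using I(4) by metis
  qed
  ultimately show ?thesis using that by blast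
qed

end

section \<open>Principality of the maximal ideals\<close>

context semilocal
begin

lemma finite_A_mod_pi: "finite (coset_of (princ \<pi>) ` A)"
  using nrm_pos[OF of_nat_in pi_nonzero] by (simp add: nrm_def idx_def card_gt_0_iff)

lemma pigeonhole_mod_pi:
  fixes f :: "nat \<Rightarrow> 'a"
  assumes "\<And>n. f n \<in> A"
  obtains i j where "i < j" "f j - f i \<in> princ \<pi>"
proof -
  let ?g = "\<lambda>n. coset_of (princ \<pi>) (f n)"
  have "\<not> inj ?g"
  proof
    assume "inj ?g"
    moreover have "finite (range ?g)"
      by (rule finite_subset[OF _ finite_A_mod_pi]) (use assms in auto)
    ultimately have "finite (UNIV :: nat set)" by (rule finite_imageD[rotated])
    then show False by simp
  qed
  then obtain a b where ab: "a \<noteq> b" "?g a = ?g b" by (auto simp: inj_def)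
  note eq = coset_of_eq_iff[OF is_idealD(8)[OF princ_ideal[OF of_nat_in]]]
  show ?thesis
  proof (cases "a < b")
    case True
    then show ?thesis using that[OF True] ab(2) eq[of p "f b" "f a"] by simp
  next
    case False
    then show ?thesis using that[of b a] ab eq[of p "f a" "f b"] by simp
  qed
qed

text \<open>Finiteness of \<open>A / \<pi>A\<close> replaces the usual determinant trick: by the pigeonhole principle two of
  the elements \<open>\<pi> z ^ n\<close> agree modulo \<open>\<pi>\<close>, which makes \<open>z\<close> integral.\<close>

lemma bounded_powers_imp_in:
  assumes "\<And>n. \<pi> * z ^ n \<in> A"
  shows "z \<in> A"
proof -
  obtain i j where ij: "i < j" "\<pi> * z ^ j - \<pi> * z ^ i \<in> princ \<pi>"
    using pigeonhole_mod_pi[of "\<lambda>n. \<pi> * z ^ n"] assms by blast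
  then have "z ^ j - z ^ i \<in> A"
    using pi_nonzero by (simp add: princ_iff right_diff_distrib[symmetric])
  then show ?thesis using int_closed[OF _ ij(1)] assms[of 1] by simp
qed

text \<open>In the finite ring obtained from \<open>A / \<pi>A\<close> by localizing at
  \<open>P\<close>, the ideal \<open>P\<close> is an associated prime, so it annihilates a nonzero
  class; \<open>x\<close> represents such a class.\<close>

lemma local_generator_aux:
  assumes P: "maxid P"
  obtains x where "x \<in> A" "x \<notin> princ \<pi>" "\<And>y. y \<in> P \<Longrightarrow> x * y \<in> princ \<pi>"
proof -
  note I = is_idealD[OF maxidD(1)[OF P]]
  note Ip = is_idealD[OF princ_ideal[OF of_nat_in, of p]]
  \<comment> \<open>The contraction to \<open>A\<close> of the ideal generated by \<pi> in the
    localization at \<open>P\<close>: elements outside \<open>P\<close> are treated as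
    units.\<close>
  define J where "J = {y \<in> A. \<exists>s\<in>A-P. s * y \<in> princ \<pi>}"
  have J1: "1 \<notin> J"
  proof
    assume "1 \<in> J"
    then obtain s where "s \<in> A - P" "s \<in> princ \<pi>" by (auto simp: J_def)
    then show False using I(7) maxidD(2)[OF P] by (auto elim!: princE)
  qed
  have J: "is_ideal J"
  proof (rule is_idealI)
    show "x \<in> A" if "x \<in> J" for x using that by (simp add: J_def)
    show "0 \<in> J" using J_def zero_in Ip(2) one_in maxidD(3)[OF P] by auto
    show "x - y \<in> J" if xy: "x \<in> J" "y \<in> J" for x y
    proof -
      obtain s t where s: "s \<in> A - P" "s * x \<in> princ \<pi>" "t \<in> A - P" "t * y \<in> princ \<pi>"
        using xy by (auto simp: J_def)
      have "s * t * (x - y) = t * (s * x) - s * (t * y)" by (simp add: algebra_simps)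
      then have "s * t * (x - y) \<in> princ \<pi>" using s Ip by (metis DiffD1)
      moreover have "s * t \<in> A - P" using s maxid_prime[OF P] mult_in by blast
      ultimately show ?thesis using xy by (auto simp: J_def intro: diff_in)
    qed
    show "a * x \<in> J" if ax: "a \<in> A" "x \<in> J" for a x
    proof -
      obtain s where s: "s \<in> A - P" "s * x \<in> princ \<pi>" using ax by (auto simp: J_def)
      then have "s * (a * x) \<in> princ \<pi>" using Ip(6)[OF ax(1), of "s * x"] by (simp add: mult.left_commute)
      then show ?thesis using ax s by (auto simp: J_def intro: mult_in)
    qed
  qed
  \<comment> \<open>Among these ideal quotients with \<open>x \<notin> J\<close> a largest one is
    prime, because passing from \<open>x\<close> to \<open>b * x\<close> can only enlarge
    it.\<close>
  define Ann where "Ann x = {y \<in> A. y * x \<in> J}" for x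
  note IJ = is_idealD[OF J]
  have piJ: "\<pi> \<in> J" using of_nat_in one_in maxidD(3)[OF P] self_in_princ by (auto simp: J_def intro!: bexI[of _ 1])
  have Ann: "is_ideal (Ann x) \<and> \<pi> \<in> Ann x" if "x \<in> A" for x
  proof
    show "is_ideal (Ann x)"
    proof (rule is_idealI)
      show "0 \<in> Ann x" using zero_in IJ(2) by (simp add: Ann_def)
      show "a - b \<in> Ann x" if "a \<in> Ann x" "b \<in> Ann x" for a b
        using that IJ(4) by (auto simp: Ann_def left_diff_distrib intro: diff_in)
      show "a * b \<in> Ann x" if "a \<in> A" "b \<in> Ann x" for a b
        using that IJ(6) by (auto simp: Ann_def mult.assoc intro: mult_in)
    qed (simp add: Ann_def)
    show "\<pi> \<in> Ann x" using IJ(7)[OF that piJ] of_nat_in by (simp add: Ann_def)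
  qed
  define S where "S = Ann ` (A - J)"
  have "finite S" by (rule finite_subset[OF _ finite_ideals]) (use Ann in \<open>auto simp: S_def\<close>)
  moreover have "Ann 1 \<in> S" using J1 one_in by (auto simp: S_def)
  ultimately have "\<exists>m\<in>S. Ann 1 \<subseteq> m \<and> (\<forall>K\<in>S. m \<subseteq> K \<longrightarrow> m = K)" by (rule finite_has_maximal2)
  then obtain m where m: "m \<in> S" "\<forall>K\<in>S. m \<subseteq> K \<longrightarrow> m = K" by blast
  obtain x where xm: "x \<in> A - J" "m = Ann x" using m(1) unfolding S_def by (auto elim: imageE)
  then have x: "x \<in> A" "x \<notin> J" by auto
  have max: "Ann x = Ann y" if "y \<in> A - J" "Ann x \<subseteq> Ann y" for y
    using m(2) that xm(2) unfolding S_def by (metis imageI)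
  have prime: "a \<in> Ann x" if "a \<in> A" "b \<in> A" "a * b \<in> Ann x" "b \<notin> Ann x" for a b
  proof -
    have "b * x \<in> A - J" using that x by (auto simp: Ann_def intro: mult_in)
    moreover have "Ann x \<subseteq> Ann (b * x)"
    proof
      fix c assume "c \<in> Ann x"
      then show "c \<in> Ann (b * x)" using IJ(6)[OF that(2), of "c * x"] by (simp add: Ann_def mult.left_commute)
    qed
    ultimately have "Ann x = Ann (b * x)" by (rule max)
    moreover have "a \<in> Ann (b * x)" using that by (simp add: Ann_def mult.assoc)
    ultimately show ?thesis by simp
  qed
  have sub: "Ann x \<subseteq> P"
  proof
    fix s assume s: "s \<in> Ann x"
    show "s \<in> P"
    proof (rule ccontr)
      assume "s \<notin> P"
      obtain t where t: "t \<in> A - P" "t * (s * x) \<in> princ \<pi>" using s by (auto simp: Ann_def J_def)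
      moreover have "t * s \<in> A - P" using t s \<open>s \<notin> P\<close> maxid_prime[OF P] mult_in by (auto simp: Ann_def)
      ultimately have "x \<in> J" using x unfolding J_def by (metis (mono_tags, lifting) mem_Collect_eq mult.assoc)
      then show False using x by simp
    qed
  qed
  have "P \<subseteq> Ann x"
  proof
    fix y assume y: "y \<in> P"
    show "y \<in> Ann x"
    proof (rule ccontr)
      assume ny: "y \<notin> Ann x"
      have yA: "y \<in> A" using y I by blast
      note IA = is_idealD[OF conjunct1[OF Ann[OF x(1)]]]
      have "1 \<notin> Ann x" using x by (simp add: Ann_def)
      have np: "y ^ n \<notin> Ann x" for n
      proof (induction n)
        case (Suc n)
        then show ?case using prime[of y "y ^ n"] yA ny power_in by auto
      qed (use \<open>1 \<notin> Ann x\<close> in simp)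
      \<comment> \<open>Two powers of \<open>y\<close> agree modulo \<pi>. Cancelling
        \<open>y ^ i\<close> modulo the prime \<open>Ann x\<close> puts
        \<open>1 - y ^ (j - i)\<close> into \<open>P\<close>, which is absurd for
        \<open>y \<in> P\<close>.\<close>
      obtain i j where ij: "i < j" "y ^ j - y ^ i \<in> princ \<pi>"
        using pigeonhole_mod_pi[of "\<lambda>n. y ^ n"] power_in[OF yA] by blast
      then have "y ^ i - y ^ j \<in> princ \<pi>" using Ip(5) by fastforce
      then have "y ^ i - y ^ j \<in> Ann x"
        using conjunct2[OF Ann[OF x(1)]] IA(7) by (auto elim!: princE)
      moreover have "y ^ i - y ^ j = (1 - y ^ (j - i)) * y ^ i"
        using ij by (simp add: algebra_simps flip: power_add)
      ultimately have "1 - y ^ (j - i) \<in> Ann x"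
        using prime[of "1 - y ^ (j - i)" "y ^ i"] np diff_in one_in power_in yA by auto
      then have "1 - y ^ (j - i) \<in> P" using sub by auto
      moreover have "y ^ (j - i) \<in> P"
        using I(7)[OF power_in[OF yA] y, of "j - i - 1"] ij by (metis Suc_diff_Suc diff_Suc_1 power_Suc)
      ultimately have "1 - y ^ (j - i) + y ^ (j - i) \<in> P" by (rule I(3))
      then show False using maxidD(3)[OF P] by simp
    qed
  qed
  then have Px: "\<exists>s\<in>A-P. s * (y * x) \<in> princ \<pi>" if "y \<in> P" for y
    using that by (auto simp: Ann_def J_def)
  \<comment> \<open>The multiplier \<open>s\<close> outside \<open>P\<close> still depends on
    \<open>y\<close>; only finitely many \<open>y\<close> matter modulo \<pi>, and the product of
    their multipliers serves all of \<open>P\<close>.\<close>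
  obtain R where R: "R \<subseteq> P" "\<And>y. y \<in> P \<Longrightarrow> \<exists>r\<in>R. y - r \<in> princ \<pi>" "card R = idx P (princ \<pi>)" 
     "0 < idx P (princ \<pi>) \<Longrightarrow> finite R" using obtain_reps[OF Ip(8)] by metis
  have "coset_of (princ \<pi>) ` P \<subseteq> coset_of (princ \<pi>) ` A" using I(1) by auto
  then have "finite (coset_of (princ \<pi>) ` P)" using finite_A_mod_pi finite_subset by blast
  moreover have "P \<noteq> {}" using I(2) by auto
  ultimately have "finite R" by (intro R(4)) (simp add: idx_def card_gt_0_iff)
  obtain s where s: "\<And>y. y \<in> P \<Longrightarrow> s y \<in> A - P \<and> s y * (y * x) \<in> princ \<pi>" using Px by metis
  have key: "prod s T \<in> A - P \<and> (\<forall>y\<in>T. prod s T * (y * x) \<in> princ \<pi>)" if "finite T" "T \<subseteq> P" for T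
    using that
  proof (induction T)
    case empty
    then show ?case using one_in maxidD(3)[OF P] by simp
  next
    case (insert z T)
    have z: "s z \<in> A - P" "s z * (z * x) \<in> princ \<pi>" using s insert.prems by auto
    have T: "prod s T \<in> A - P" "\<And>y. y \<in> T \<Longrightarrow> prod s T * (y * x) \<in> princ \<pi>" using insert by auto
    have "s z * prod s T \<in> A - P" using z T maxid_prime[OF P] mult_in by blast
    moreover have "s z * prod s T * (z * x) \<in> princ \<pi>"
      using Ip(6)[of "prod s T" "s z * (z * x)"] z T by (simp add: mult_ac)
    moreover have "s z * prod s T * (y * x) \<in> princ \<pi>" if "y \<in> T" for y
      using Ip(6)[of "s z" "prod s T * (y * x)"] z T(2)[OF that] by (simp add: mult_ac)
    ultimately show ?case using insert.hyps by simp
  qed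
  let ?t = "prod s R"
  have t: "?t \<in> A - P" "\<And>y. y \<in> R \<Longrightarrow> ?t * (y * x) \<in> princ \<pi>" using key[OF \<open>finite R\<close> R(1)] by auto
  have txA: "?t * x \<in> A" using t x by (auto intro: mult_in)
  have "(?t * x) * y \<in> princ \<pi>" if y: "y \<in> P" for y
  proof -
    obtain r where r: "r \<in> R" "y - r \<in> princ \<pi>" using R(2) y by blast
    have "(?t * x) * y = (?t * x) * (y - r) + ?t * (r * x)" by (simp add: algebra_simps)
    then show ?thesis using Ip(3) Ip(6)[OF txA r(2)] t(2)[OF r(1)] by metis
  qed
  moreover have "?t * x \<notin> princ \<pi>"
    using x t(1) by (auto simp: J_def)
  ultimately show ?thesis using that txA by blast
qed

text \<open>For \<open>z = x / \<pi>\<close> the products \<open>z * y\<close> with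
  \<open>y \<in> P\<close> lie in \<open>A\<close>. If they all lay in \<open>P\<close>, every
  \<open>\<pi> * z ^ n\<close> would be in \<open>A\<close>, hence \<open>z\<close> itself, against
  \<open>x \<notin> princ \<pi>\<close>. So some \<open>z * w\<close> is a unit at \<open>P\<close>,
  and \<open>(z * w) * y = w * (z * y)\<close> makes \<open>w\<close> a local generator.\<close>

lemma local_generator:
  assumes P: "maxid P"
  obtains w t where "w \<in> P" "t \<in> A" "t \<notin> P" "\<And>y. y \<in> P \<Longrightarrow> t * y \<in> princ w"
proof -
  note I = is_idealD[OF maxidD(1)[OF P]]
  obtain x where x: "x \<in> A" "x \<notin> princ \<pi>" "\<And>y. y \<in> P \<Longrightarrow> x * y \<in> princ \<pi>"
    using local_generator_aux[OF P] by blast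
  define z where "z = x / \<pi>"
  have xz: "x = \<pi> * z" using pi_nonzero by (simp add: z_def)
  have zP: "z * y \<in> A" if "y \<in> P" for y
    using x(3)[OF that] pi_nonzero by (simp add: z_def princ_iff)
  have "\<exists>w\<in>P. z * w \<notin> P"
  proof (rule ccontr)
    assume neg: "\<not> ?thesis"
    have pz: "\<pi> * z ^ n \<in> P" for n
    proof (induction n)
      case (Suc n)
      then have "z * (\<pi> * z ^ n) \<in> P" using neg by auto
      then show ?case by (simp add: mult.left_commute)
    qed (simp add: maxidD(2)[OF P])
    have "z \<in> A" by (rule bounded_powers_imp_in, rule I(1), rule pz)
    then show False using x(2) xz princI[of z \<pi>] by simp
  qed
  then obtain w where w: "w \<in> P" "z * w \<notin> P" by blast
  show ?thesis
  proof (rule that[of w "z * w"])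
    show "z * w * y \<in> princ w" if "y \<in> P" for y
      using princI[OF zP[OF that], of w] by (simp add: mult_ac)
  qed (use w zP in auto)
qed

text \<open>A local generator \<open>w\<close> at \<open>P\<close> may lie in other maximal ideals
  as well. Adding the square of a suitable \<open>c \<in> P\<close> moves it out of all of them
  without spoiling it at \<open>P\<close>; equality with \<open>P\<close> is then checked
  locally.\<close>

lemma maxid_principal:
  assumes P: "maxid P"
  obtains w where "w \<noteq> 0" "P = princ w"
proof -
  note I = is_idealD[OF maxidD(1)[OF P]]
  obtain w t where w: "w \<in> P" "t \<in> A" "t \<notin> P" "\<And>y. y \<in> P \<Longrightarrow> t * y \<in> princ w"
    using local_generator[OF P] by blast
  have wA: "w \<in> A" using w I by blast
  \<comment> \<open>At every \<open>Q\<close> other than \<open>P\<close> exactly one of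
    \<open>w\<close> and \<open>c\<close> lies in \<open>Q\<close>, so \<open>w + c * c\<close> does
    not.\<close>
  obtain c where c: "c \<in> A" "\<And>Q. maxid Q \<Longrightarrow> c - (if Q \<noteq> P \<and> w \<in> Q then 1 else 0) \<in> Q"
    using crt[of "\<lambda>Q. if Q \<noteq> P \<and> w \<in> Q then 1 else 0"] zero_in one_in by (smt (verit, ccfv_SIG))
  have cP: "c \<in> P" using c(2)[OF P] by simp
  define u where "u = w + c * c"
  have uP: "u \<in> P" using w cP I(3) I(6)[OF c(1) cP] by (simp add: u_def)
  have uA: "u \<in> A" using uP I by blast
  have uQ: "u \<notin> Q" if Q: "maxid Q" "Q \<noteq> P" for Q
  proof
    note IQ = is_idealD[OF maxidD(1)[OF Q(1)]]
    assume u: "u \<in> Q"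
    show False
    proof (cases "w \<in> Q")
      case True
      then have "c - 1 \<in> Q" using c(2)[OF Q(1)] Q by simp
      have "u - w \<in> Q" using u True by (rule IQ(4))
      then have "c * c \<in> Q" by (simp add: u_def)
      then have "c \<in> Q" using maxid_prime[OF Q(1) c(1) c(1)] by blast
      then have "c - (c - 1) \<in> Q" using \<open>c - 1 \<in> Q\<close> by (rule IQ(4))
      then show False using maxidD(3)[OF Q(1)] by simp
    next
      case False
      then have "c \<in> Q" using c(2)[OF Q(1)] by simp
      then have "c * c \<in> Q" using c(1) IQ(6) by blast
      then have "u - c * c \<in> Q" using IQ(4)[OF u] by blast
      then show False using False by (simp add: u_def)
    qed
  qed
  obtain v where v: "v \<in> A" "t * c = w * v" using w(4)[OF cP] by (auto elim: princE)
  \<comment> \<open>Because \<open>t * c\<close> is a multiple of \<open>w\<close>, the square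
    contributes a multiple of \<open>w * w\<close>; the cofactor of \<open>w\<close> is therefore
    still congruent to \<open>t * t\<close> modulo \<open>P\<close>.\<close>
  have "t * t * u = w * (t * t + w * v * v)"
  proof -
    have "t * t * u = t * t * w + (t * c) * (t * c)" by (simp add: u_def algebra_simps)
    also have "\<dots> = w * (t * t + w * v * v)" by (simp only: v(2)) (simp add: algebra_simps)
    finally show ?thesis .
  qed
  define k where "k = t * t + w * v * v"
  have kA: "k \<in> A" using w wA v by (auto simp: k_def intro: mult_in add_in)
  have k: "k \<notin> P"
  proof
    assume "k \<in> P"
    moreover have "w * v * v \<in> P" using w v I(7) by blast
    ultimately have "k - w * v * v \<in> P" by (rule I(4))
    then show False using maxid_prime[OF P w(2) w(2)] w(3) by (simp add: k_def)
  qed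
  have loc: "t * k * y \<in> princ u" if y: "y \<in> P" for y
  proof -
    obtain b where b: "b \<in> A" "t * y = w * b" using w(4)[OF y] by (auto elim: princE)
    have "t * k * y = (w * k) * b" using b by (simp add: mult_ac)
    also have "w * k = t * t * u" using \<open>t * t * u = w * (t * t + w * v * v)\<close> by (simp add: k_def)
    also have "t * t * u * b = u * (t * t * b)" by (simp only: mult_ac)
    finally have "t * k * y = u * (t * t * b)" .
    moreover have "u * (t * t * b) \<in> princ u" using b w by (intro princI mult_in)
    ultimately show ?thesis by (simp only:)
  qed
  have u0: "u \<noteq> 0"
  proof
    assume "u = 0"
    then have "t * k * \<pi> \<in> princ 0" using loc maxidD(2)[OF P] by auto
    then have "t * k = 0" using pi_nonzero by (auto simp: princ_def)
    then show False using w(3) k I(2) by auto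
  qed
  have "P \<subseteq> princ u"
  proof
    fix y assume y: "y \<in> P"
    then have yA: "y \<in> A" using I by blast
    note Iu = is_idealD[OF princ_ideal[OF uA]]
    have "1 \<in> {a \<in> A. a * y \<in> princ u}"
    proof (rule ideal_eq_A)
      show "is_ideal {a \<in> A. a * y \<in> princ u}"
      proof (rule is_idealI)
        show "a - b \<in> {a \<in> A. a * y \<in> princ u}" if "a \<in> {a \<in> A. a * y \<in> princ u}" "b \<in> {a \<in> A. a * y \<in> princ u}" for a b
          using that Iu(4) by (auto simp: left_diff_distrib intro: diff_in)
        show "a * b \<in> {a \<in> A. a * y \<in> princ u}" if "a \<in> A" "b \<in> {a \<in> A. a * y \<in> princ u}" for a b
          using that Iu(6) by (auto simp: mult.assoc intro: mult_in)
      qed (use zero_in Iu(2) in auto)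
      show "u \<in> {a \<in> A. a * y \<in> princ u}" using uA princI[OF yA, of u] by simp
      show "u \<noteq> 0" by (rule u0)
      show "\<exists>a\<in>{a \<in> A. a * y \<in> princ u}. a \<notin> Q" if Q: "maxid Q" for Q
      proof (cases "Q = P")
        case True
        have "t * k \<notin> P" using w(2,3) k kA maxid_prime[OF P] by blast
        then show ?thesis using True loc[OF y] w(2) kA by (auto intro!: bexI[of _ "t * k"] mult_in)
      next
        case False
        then show ?thesis using uQ[OF Q] uA princI[OF yA, of u] by (auto intro!: bexI[of _ u])
      qed
    qed
    then show "y \<in> princ u" by simp
  qed
  moreover have "princ u \<subseteq> P" using uP I(7) by (auto elim!: princE)
  ultimately show ?thesis using that[OF u0] by blast
qed

end

section \<open>Valuations and norms\<close>

context semilocal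
begin

definition gen :: "'a set \<Rightarrow> 'a" where "gen P = (SOME w. w \<noteq> 0 \<and> P = princ w)"

lemma gen:
  assumes "maxid P"
  shows "gen P \<noteq> 0" "princ (gen P) = P" "gen P \<in> P" "gen P \<in> A"
proof -
  have "\<exists>w. w \<noteq> 0 \<and> P = princ w" using maxid_principal[OF assms] by metis
  then have *: "gen P \<noteq> 0 \<and> P = princ (gen P)" unfolding gen_def by (rule someI_ex)
  then show "gen P \<noteq> 0" "princ (gen P) = P" by auto
  then show "gen P \<in> P" using self_in_princ[of "gen P"] by simp
  then show "gen P \<in> A" using is_idealD(1)[OF maxidD(1)[OF assms]] by blast
qed

lemma nrm_gen_gt_1: 
  assumes P: "maxid P" shows "nrm (gen P) > 1"
proof -
  have "nrm (gen P) \<noteq> 1"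
    using idx_eq_1_iff[OF A_closed is_idealD(8)[OF maxidD(1)[OF P]]] gen(2)[OF P] maxidD[OF P] one_in
    by (auto simp: nrm_def is_ideal_def)
  moreover have "nrm (gen P) > 0" by (rule nrm_pos) (use gen P in auto)
  ultimately show ?thesis by simp
qed

text \<open>With the exponent \<open>Suc n\<close> the first failure is the valuation itself. For
  \<open>x = 0\<close> nothing fails and the value is arbitrary, whence the conditions
  \<open>x \<noteq> 0\<close> below.\<close>

definition val :: "'a set \<Rightarrow> 'a \<Rightarrow> nat" where
  "val P x = (LEAST n. x / gen P ^ Suc n \<notin> A)"

lemma val_decomp:
  assumes P: "maxid P" and x: "x \<in> A" "x \<noteq> 0"
  obtains y where "y \<in> A" "y \<notin> P" "x = gen P ^ val P x * y"
proof -
  note g = gen[OF P]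
  have "\<exists>n. x / gen P ^ Suc n \<notin> A"
  proof (rule ccontr)
    assume "\<not> ?thesis"
    then have all: "x / gen P ^ Suc n \<in> A" for n by blast
    \<comment> \<open>The finite number \<open>nrm x\<close> would have the factor
      \<open>nrm (gen P) ^ Suc n\<close>, at least \<open>2 ^ Suc n\<close>, for every
      \<open>n\<close>.\<close>
    have "Suc n \<le> nrm x" for n
    proof -
      define z where "z = x / gen P ^ Suc n"
      have z: "z \<in> A" "z \<noteq> 0" "x = gen P ^ Suc n * z" using all[of n] x g(1) by (auto simp: z_def)
      have "nrm x = nrm (gen P ^ Suc n) * nrm z"
        unfolding z(3) by (rule nrm_mult) (use z power_in[OF g(4)] g(1) in \<open>auto simp del: power_Suc\<close>)
      then have "nrm x = nrm (gen P) ^ Suc n * nrm z" by (simp only: nrm_power[OF g(4,1)])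
      moreover have "nrm z \<ge> 1" using nrm_pos[OF z(1,2)] by simp
      moreover have "nrm (gen P) ^ Suc n \<ge> 2 ^ Suc n" using nrm_gen_gt_1[OF P] by (intro power_mono) auto
      ultimately have "nrm x \<ge> 2 ^ Suc n * 1" using mult_le_mono by presburger
      moreover have "(2::nat) ^ Suc n > Suc n" by (rule less_exp)
      ultimately show ?thesis by linarith
    qed
    then show False using not_less_eq_eq by blast
  qed
  then have 1: "x / gen P ^ Suc (val P x) \<notin> A" unfolding val_def by (rule LeastI_ex)
  have 2: "x / gen P ^ val P x \<in> A"
  proof (cases "val P x")
    case (Suc m)
    then have "m < val P x" by simp
    then have "\<not> x / gen P ^ Suc m \<notin> A" unfolding val_def by (rule not_less_Least)
    then show ?thesis using Suc by simp
  qed (use x in simp)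
  define y where "y = x / gen P ^ val P x"
  have "y \<notin> P"
  proof
    assume "y \<in> P"
    then have "y / gen P \<in> A" using g princ_iff by metis
    then show False using 1 by (simp add: y_def mult.commute)
  qed
  then show ?thesis using 2 g(1) by (intro that[of y]) (auto simp: y_def)
qed

lemma gen_power_mult_in: 
  assumes P: "maxid P" and "y \<in> A" "n > 0" shows "gen P ^ n * y \<in> P"
proof -
  note I = is_idealD[OF maxidD(1)[OF P]]
  have "gen P ^ n = gen P ^ (n - 1) * gen P" using assms by (cases n) auto
  then have "gen P ^ n \<in> P" using I(6) power_in gen P by simp
  then show ?thesis using I(7) assms by blast
qed

lemma val_unique_aux:
  assumes P: "maxid P" and e: "gen P ^ n * y = gen P ^ m * z" and "y \<in> A" "y \<notin> P" "z \<in> A"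
  shows "m \<le> n"
proof (rule ccontr)
  assume "\<not> m \<le> n"
  then have "gen P ^ m = gen P ^ n * gen P ^ (m - n)" by (simp flip: power_add)
  then have "gen P ^ n * y = gen P ^ n * (gen P ^ (m - n) * z)" using e by (simp add: mult.assoc)
  then have "y = gen P ^ (m - n) * z" using gen(1)[OF P] by simp
  then show False using gen_power_mult_in[OF P, of z "m - n"] assms \<open>\<not> m \<le> n\<close> by simp
qed

lemma val_eqI:
  assumes P: "maxid P" and x: "x = gen P ^ n * y" "y \<in> A" "y \<notin> P"
  shows "val P x = n"
proof -
  have y0: "y \<noteq> 0" using x is_idealD(2)[OF maxidD(1)[OF P]] by auto
  have "x \<in> A" "x \<noteq> 0" using x y0 gen[OF P] by (auto intro: mult_in power_in)
  then obtain z where z: "z \<in> A" "z \<notin> P" "x = gen P ^ val P x * z" using val_decomp[OF P] by blast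
  have "gen P ^ n * y = gen P ^ val P x * z" using x(1) z(3) by simp
  then show ?thesis using val_unique_aux[OF P] x z by (metis le_antisym)
qed

lemma val_mult:
  assumes P: "maxid P" and "x \<in> A" "x \<noteq> 0" "y \<in> A" "y \<noteq> 0"
  shows "val P (x * y) = val P x + val P y"
proof -
  obtain u where u: "u \<in> A" "u \<notin> P" "x = gen P ^ val P x * u" using val_decomp[OF P] assms by blast
  obtain w where w: "w \<in> A" "w \<notin> P" "y = gen P ^ val P y * w" using val_decomp[OF P] assms by blast
  have "x * y = (gen P ^ val P x * u) * (gen P ^ val P y * w)" using u w by simp
  also have "\<dots> = gen P ^ (val P x + val P y) * (u * w)" by (simp only: power_add mult_ac)
  finally have e: "x * y = gen P ^ (val P x + val P y) * (u * w)" .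
  have "u * w \<notin> P" using maxid_prime[OF P u(1) w(1)] u(2) w(2) by blast
  then show ?thesis by (rule val_eqI[OF P e mult_in[OF u(1) w(1)]])
qed

lemma val_eq_0: "maxid P \<Longrightarrow> x \<in> A \<Longrightarrow> x \<notin> P \<Longrightarrow> val P x = 0"
  using val_eqI[of P x 0 x] by simp

lemma val_pos: 
  assumes P: "maxid P" and x: "x \<in> P" "x \<noteq> 0"
  shows "val P x > 0"
proof (rule ccontr)
  assume "\<not> val P x > 0"
  moreover have "x \<in> A" using x is_idealD(1)[OF maxidD(1)[OF P]] by blast
  ultimately show False using val_decomp[OF P, of x] x by auto
qed

lemma val_power:
  assumes P: "maxid P" and "x \<in> A" "x \<noteq> 0"
  shows "val P (x ^ n) = n * val P x"
proof (induction n)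
  case 0
  then show ?case using val_eq_0[OF P one_in maxidD(3)[OF P]] by simp
next
  case (Suc n)
  then show ?case using val_mult[OF P assms(2,3) power_in[OF assms(2)]] assms by simp
qed

lemma val_ge_iff:
  assumes P: "maxid P" and x: "x \<in> A" "x \<noteq> 0"
  shows "n \<le> val P x \<longleftrightarrow> x \<in> princ (gen P ^ n)"
proof
  obtain z where z: "z \<in> A" "z \<notin> P" "x = gen P ^ val P x * z" using val_decomp[OF P] x by blast
  {
    assume "n \<le> val P x"
    then have "gen P ^ val P x = gen P ^ n * gen P ^ (val P x - n)" by (simp flip: power_add)
    then have "x = gen P ^ n * (gen P ^ (val P x - n) * z)" using z(3) by (simp only: mult.assoc)
    moreover have "gen P ^ n * (gen P ^ (val P x - n) * z) \<in> princ (gen P ^ n)"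
      using z gen(4)[OF P] by (intro princI mult_in power_in)
    ultimately show "x \<in> princ (gen P ^ n)" by (simp only:)
  }
  assume "x \<in> princ (gen P ^ n)"
  then obtain y where "y \<in> A" "x = gen P ^ n * y" by (auto elim: princE)
  then show "n \<le> val P x" using val_unique_aux[OF P _ z(1,2)] z by metis
qed

lemma val_add_ge:
  assumes P: "maxid P" and x: "x \<in> A" "x \<noteq> 0" and y: "y \<in> A" "y \<noteq> 0" and "x + y \<noteq> 0"
    and "n \<le> val P x" "n \<le> val P y"
  shows "n \<le> val P (x + y)"
proof -
  have "x \<in> princ (gen P ^ n)" "y \<in> princ (gen P ^ n)"
    using assms val_ge_iff[OF P x] val_ge_iff[OF P y] by simp_all
  then have "x + y \<in> princ (gen P ^ n)"
    by (rule is_idealD(3)[OF princ_ideal[OF power_in[OF gen(4)[OF P]]]])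
  then show ?thesis using val_ge_iff[OF P add_in[OF x(1) y(1)] assms(6)] by simp
qed

lemma val_uminus:
  assumes P: "maxid P" and x: "x \<in> A" "x \<noteq> 0"
  shows "val P (- x) = val P x"
proof -
  obtain z where z: "z \<in> A" "z \<notin> P" "x = gen P ^ val P x * z" using val_decomp[OF P] x by blast
  have "- x = gen P ^ val P x * (- z)" using z(3) by simp
  moreover have "- z \<notin> P" using z is_idealD(5)[OF maxidD(1)[OF P], of "- z"] by auto
  ultimately show ?thesis using z uminus_in by (intro val_eqI[OF P]) auto
qed

lemma val_add_eq:
  assumes P: "maxid P" and x: "x \<in> A" "x \<noteq> 0" and y: "y \<in> A" "y = 0 \<or> val P x < val P y"
  shows "x + y \<noteq> 0" "val P (x + y) = val P x"
proof -
  show ne: "x + y \<noteq> 0"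
  proof
    assume "x + y = 0"
    then have "y = - x" by (simp add: eq_neg_iff_add_eq_0 add.commute)
    then show False using y(2) val_uminus[OF P x] x(2) by auto
  qed
  show "val P (x + y) = val P x"
  proof (cases "y = 0")
    case False
    then have v: "val P x < val P y" using y by auto
    have le: "val P x \<le> val P (x + y)" using val_add_ge[OF P x y(1) False ne] v by simp
    have "\<not> Suc (val P x) \<le> val P (x + y)"
    proof
      assume *: "Suc (val P x) \<le> val P (x + y)"
      have "Suc (val P x) \<le> val P ((x + y) + (- y))"
        by (rule val_add_ge[OF P]) (use * v x y False ne val_uminus[OF P y(1) False] in \<open>auto intro: add_in uminus_in\<close>)
      then show False by simp
    qed
    then show ?thesis using le by simp
  qed simp
qed

lemma val_unit:
  assumes P: "maxid P" and "x \<in> A" "y \<in> A" "x * y = 1"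
  shows "val P x = 0"
proof (rule val_eq_0[OF P assms(2)])
  show "x \<notin> P" using is_idealD(7)[OF maxidD(1)[OF P] assms(3), of x] maxidD(3)[OF P] assms(4) by auto
qed

text \<open>Integers prime to \<open>p\<close> are units of \<open>A\<close>, so only the
  \<open>p\<close>-part counts; \<open>val P \<pi>\<close> is the ramification index of
  \<open>P\<close>.\<close>

lemma val_of_int:
  assumes P: "maxid P" and m: "m \<noteq> 0"
  shows "val P (of_int m) = val P \<pi> * multiplicity (int p) m"
proof -
  define k where "k = multiplicity (int p) m"
  have np: "\<not> is_unit (int p)" using p_gt_1 by simp
  obtain u where u: "m = int p ^ k * u" "\<not> int p dvd u"
    using multiplicity_decompose'[OF m np] unfolding k_def by metis
  have u0: "u \<noteq> 0" using u m by auto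
  have "val P (of_int u) = 0"
    by (rule val_unit[OF P of_int_in int_unit[OF u(2)]]) (use u0 in simp)
  moreover have "(of_int m :: 'a) = \<pi> ^ k * of_int u" unfolding u(1) by simp
  ultimately have "val P (of_int m) = k * val P \<pi>"
    using val_mult[OF P power_in[OF of_nat_in] _ of_int_in, of p k u] val_power[OF P of_nat_in pi_nonzero]
      pi_nonzero u0 by simp
  then show ?thesis by (simp add: k_def mult.commute)
qed

lemma val_pi_pos: "maxid P \<Longrightarrow> val P \<pi> > 0"
  using val_pos[of P \<pi>] maxidD(2)[of P] pi_nonzero by simp

text \<open>The residue degree: the order of \<open>A / P\<close> divides \<open>nrm \<pi>\<close>
  and is thus a power of \<open>p\<close>.\<close>

definition rdeg :: "'a set \<Rightarrow> nat" where "rdeg P = multiplicity p (nrm (gen P))"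

lemma idx_maxid:
  assumes P: "maxid P"
  shows "idx A P = p ^ rdeg P" "nrm (gen P) = p ^ rdeg P" "rdeg P > 0"
proof -
  obtain z where z: "z \<in> A" "\<pi> = gen P * z" using maxidD(2)[OF P] gen(2)[OF P] by (metis princE)
  have "nrm (gen P) dvd p ^ d"
    using nrm_mult[OF gen(4)[OF P] z(1) gen(1)[OF P]] nrm_pi z(2) by (metis dvd_triv_left)
  then obtain k where "nrm (gen P) = p ^ k" using divides_primepow_nat[OF p_prime] by blast
  then show 1: "nrm (gen P) = p ^ rdeg P" using p_prime by (simp add: rdeg_def)
  then show "idx A P = p ^ rdeg P" using gen(2)[OF P] by (simp add: nrm_def)
  show "rdeg P > 0" using 1 nrm_gen_gt_1[OF P] by (cases "rdeg P") auto
qed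

lemma gen_notin:
  assumes "maxid P" "maxid Q" "P \<noteq> Q"
  shows "gen Q \<notin> P"
proof
  assume g: "gen Q \<in> P"
  note I = is_idealD[OF maxidD(1)[OF assms(1)]]
  obtain c where c: "c \<in> Q" "c \<in> A" "1 - c \<in> P" using exists_separating[OF assms] by blast
  have "c \<in> princ (gen Q)" using c(1) gen(2)[OF assms(2)] by simp
  then have "c \<in> P" using g I(7) by (auto elim!: princE)
  then have "1 - c + c \<in> P" using c(3) I(3) by blast
  then show False using maxidD(3)[OF assms(1)] by simp
qed

lemma val_gen:
  assumes "maxid P" "maxid Q"
  shows "val P (gen Q) = (if P = Q then 1 else 0)"
proof (cases "P = Q")
  case True
  then show ?thesis using val_eqI[OF assms(1), of "gen P" 1 1] one_in maxidD(3)[OF assms(1)] by simp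
next
  case False
  then show ?thesis using val_eq_0[OF assms(1) gen(4)[OF assms(2)] gen_notin[OF assms]] by simp
qed

text \<open>Splitting off one generator at a time lowers the norm and ends at a unit; this takes the
  place of unique factorization of ideals.\<close>

lemma nrm_eq:
  assumes "x \<in> A" "x \<noteq> 0"
  shows "nrm x = p ^ (\<Sum>P\<in>spec. rdeg P * val P x)"
  using assms
proof (induction "nrm x" arbitrary: x rule: less_induct)
  case less
  show ?case
  proof (cases "\<exists>Q. maxid Q \<and> x \<in> Q")
    case False
    have "1 \<in> princ x"
      by (rule ideal_eq_A[OF princ_ideal[OF less.prems(1)] self_in_princ less.prems(2)])
        (use False self_in_princ in blast)
    then have "princ x = A"
      using is_idealD(1,6)[OF princ_ideal[OF less.prems(1)]] by (metis mult.right_neutral subsetI subset_antisym)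
    then have "nrm x = 1" using idx_eq_1_iff[OF A_closed A_closed] by (simp add: nrm_def)
    moreover have "val P x = 0" if "P \<in> spec" for P
      using False val_eq_0[of P x] less.prems that by (auto simp: spec_iff)
    ultimately show ?thesis by simp
  next
    case True
    then obtain Q where Q: "maxid Q" "x \<in> Q" by blast
    then obtain y where y: "y \<in> A" "x = gen Q * y" using gen(2)[OF Q(1)] by (metis princE)
    have y0: "y \<noteq> 0" using y less.prems by auto
    have n: "nrm x = p ^ rdeg Q * nrm y"
      using nrm_mult[OF gen(4)[OF Q(1)] y(1) gen(1)[OF Q(1)]] idx_maxid[OF Q(1)] y(2) by simp
    have "nrm y > 0" using y y0 nrm_pos by simp
    moreover have "1 < p ^ rdeg Q" using nrm_gen_gt_1[OF Q(1)] idx_maxid(2)[OF Q(1)] by simp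
    ultimately have "nrm y < nrm x" unfolding n by simp
    then have IH: "nrm y = p ^ (\<Sum>P\<in>spec. rdeg P * val P y)" using less.hyps y y0 by blast
    have "(\<Sum>P\<in>spec. rdeg P * val P x) = (\<Sum>P\<in>spec. (if P = Q then rdeg Q else 0) + rdeg P * val P y)"
    proof (rule sum.cong)
      fix P assume "P \<in> spec"
      then have P: "maxid P" by (simp add: spec_iff)
      have "val P x = (if P = Q then 1 else 0) + val P y"
        unfolding y(2) using val_mult[OF P gen(4)[OF Q(1)] gen(1)[OF Q(1)] y(1) y0] val_gen[OF P Q(1)] by simp
      then show "rdeg P * val P x = (if P = Q then rdeg Q else 0) + rdeg P * val P y"
        by (simp add: algebra_simps)
    qed simp
    also have "\<dots> = rdeg Q + (\<Sum>P\<in>spec. rdeg P * val P y)"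
      using Q finite_spec by (simp add: sum.distrib sum.delta spec_iff)
    finally show ?thesis using n IH by (simp add: power_add)
  qed
qed

lemma sum_val_eq:
  assumes "x \<in> A" "x \<noteq> 0" "nrm x = p ^ k"
  shows "(\<Sum>P\<in>spec. rdeg P * val P x) = k"
  using nrm_eq[OF assms(1,2)] assms(3) p_gt_1 by simp

text \<open>The fundamental identity between residue degrees, ramification indices and the
  degree.\<close>

lemma sum_val_pi: "(\<Sum>P\<in>spec. rdeg P * val P \<pi>) = d"
  by (rule sum_val_eq[OF of_nat_in pi_nonzero nrm_pi])

lemma sum_rdeg_le: "(\<Sum>P\<in>spec. rdeg P) \<le> d"
proof -
  have "(\<Sum>P\<in>spec. rdeg P) \<le> (\<Sum>P\<in>spec. rdeg P * val P \<pi>)"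
    by (rule sum_mono) (use val_pi_pos spec_iff in \<open>simp add: Suc_leI\<close>)
  then show ?thesis using sum_val_pi by simp
qed

text \<open>The ideal of all \<open>a\<close> with \<open>a * x \<in> princ y\<close> contains, for
  each \<open>P\<close>, the part of \<open>y\<close> prime to \<open>P\<close>; lying in no maximal
  ideal, it contains 1.\<close>

lemma val_dvd:
  assumes x: "x \<in> A" and y: "y \<in> A" "y \<noteq> 0"
    and le: "\<And>P. maxid P \<Longrightarrow> x = 0 \<or> val P y \<le> val P x"
  shows "x \<in> princ y"
proof (cases "x = 0")
  case True
  then show ?thesis using is_idealD(2)[OF princ_ideal[OF y(1)]] by simp
next
  case x0: False
  note Iy = is_idealD[OF princ_ideal[OF y(1)]]
  define I where "I = {a \<in> A. a * x \<in> princ y}"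
  have "1 \<in> I"
  proof (rule ideal_eq_A)
    show "is_ideal I"
    proof (rule is_idealI)
      show "a - b \<in> I" if "a \<in> I" "b \<in> I" for a b
        using that Iy(4) by (auto simp: I_def left_diff_distrib intro: diff_in)
      show "a * b \<in> I" if "a \<in> A" "b \<in> I" for a b
        using that Iy(6) by (auto simp: I_def mult.assoc intro: mult_in)
    qed (use zero_in Iy(2) in \<open>auto simp: I_def\<close>)
    show "y \<in> I" using y princI[OF x, of y] by (simp add: I_def)
    show "y \<noteq> 0" by (rule y(2))
    show "\<exists>a\<in>I. a \<notin> P" if P: "maxid P" for P
    proof -
      obtain u where u: "u \<in> A" "u \<notin> P" "x = gen P ^ val P x * u" using val_decomp[OF P x x0] by blast
      obtain w where w: "w \<in> A" "w \<notin> P" "y = gen P ^ val P y * w" using val_decomp[OF P y] by blast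
      have "gen P ^ val P x = gen P ^ val P y * gen P ^ (val P x - val P y)"
        using le[OF P] x0 by (simp flip: power_add)
      then have "w * x = (gen P ^ val P y * w) * (gen P ^ (val P x - val P y) * u)"
        using u(3) by (metis mult.assoc mult.left_commute)
      then have "w * x = y * (gen P ^ (val P x - val P y) * u)" using w(3) by simp
      moreover have "y * (gen P ^ (val P x - val P y) * u) \<in> princ y"
        using u gen(4)[OF P] by (intro princI mult_in power_in)
      ultimately have "w \<in> I" using w by (simp add: I_def)
      then show ?thesis using w by blast
    qed
  qed
  then show ?thesis by (simp add: I_def)
qed

end

section \<open>Polynomials over residue fields\<close>

lemma int_diff_not_dvd:
  fixes a b p :: nat
  assumes "a < p" "b < p" "a \<noteq> b"
  shows "\<not> int p dvd int a - int b"
proof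
  assume "int p dvd int a - int b"
  then have "int a mod int p = int b mod int p" by (simp add: mod_eq_dvd_iff)
  then show False using assms by simp
qed

lemma monic_division:
  fixes g h :: "int poly"
  assumes "lead_coeff g = 1"
  obtains q r where "h = g * q + r" "r = 0 \<or> degree r < degree g"
proof -
  obtain q r where qr: "pseudo_divmod h g = (q, r)" by force
  have "g \<noteq> 0" using assms by auto
  from pseudo_divmod[OF this qr] that assms show ?thesis by auto
qed

context semilocal
begin

lemma ipoly_add: "ipoly (g + h) x = ipoly g x + ipoly h x"
  and ipoly_diff: "ipoly (g - h) x = ipoly g x - ipoly h x"
  and ipoly_mult: "ipoly (g * h) x = ipoly g x * ipoly h x"
  and ipoly_smult: "ipoly (Polynomial.smult c h) x = of_int c * ipoly h x"
  and ipoly_1: "ipoly 1 x = 1"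
  and ipoly_0: "ipoly 0 x = 0"
  and ipoly_monom: "ipoly (Polynomial.monom c n) x = of_int c * x ^ n"
  and ipoly_power: "ipoly (g ^ n) x = ipoly g x ^ n"
  and ipoly_pCons: "ipoly (pCons c h) x = of_int c + x * ipoly h x"
  by (simp_all add: hom_distribs poly_monom map_poly_monom)

lemma ipoly_sum: "ipoly (sum f S) x = (\<Sum>i\<in>S. ipoly (f i) x)"
  by (induction S rule: infinite_finite_induct) (simp_all add: ipoly_add ipoly_0)

lemma ipoly_cong:
  assumes I: "is_ideal I" and "x \<in> A" "y \<in> A" "x - y \<in> I"
  shows "ipoly h x - ipoly h y \<in> I"
proof (induction h)
  case (pCons a h)
  have "ipoly (pCons a h) x - ipoly (pCons a h) y
      = x * (ipoly h x - ipoly h y) + ipoly h y * (x - y)"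
    by (simp add: ipoly_pCons algebra_simps)
  then show ?case using is_idealD(3,6)[OF I] pCons assms ipoly_in by metis
qed (use is_idealD(2)[OF I] in simp)

text \<open>The bound on roots over the field \<open>A / P\<close>, carried out with
  representatives: splitting off a linear factor keeps coefficients in \<open>A\<close>, and
  primality of \<open>P\<close> replaces the absence of zero divisors.\<close>

lemma card_roots_le:
  fixes g :: "'a poly"
  assumes P: "maxid P"
    and "\<And>i. Polynomial.coeff g i \<in> A" "lead_coeff g = 1" "Y \<subseteq> A" "\<And>x. x \<in> Y \<Longrightarrow> poly g x \<in> P"
    "\<And>x y. x \<in> Y \<Longrightarrow> y \<in> Y \<Longrightarrow> x - y \<in> P \<Longrightarrow> x = y" "finite Y"
  shows "card Y \<le> degree g"
  using assms(2-)
proof (induction "degree g" arbitrary: g Y)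
  case 0
  then obtain c where "g = [:c:]" by (metis degree_0_id)
  then have "g = 1" using 0 by (simp add: one_pCons)
  then have "Y = {}" using 0 maxidD(3)[OF P] by force
  then show ?case by simp
next
  case (Suc n)
  note I = is_idealD[OF maxidD(1)[OF P]]
  show ?case
  proof (cases "Y = {}")
    case False
    then obtain x where x: "x \<in> Y" by blast
    then have xA: "x \<in> A" using Suc.prems by blast
    define s where "s = synthetic_div g x"
    have g: "g = [:- x, 1:] * s + [:poly g x:]" unfolding s_def by (rule synthetic_div_correct'[symmetric])
    have ds: "degree s = n" using Suc.hyps(2) by (simp add: s_def degree_synthetic_div)
    have coeffA: "(\<And>i. Polynomial.coeff q i \<in> A) \<Longrightarrow> poly q x \<in> A \<and> (\<forall>i. Polynomial.coeff (synthetic_div q x) i \<in> A)"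
      for q :: "'a poly"
    proof (induction q)
      case (pCons a q)
      have "Polynomial.coeff q i \<in> A" for i using pCons.prems[of "Suc i"] by simp
      then have IH: "poly q x \<in> A" "\<And>i. Polynomial.coeff (synthetic_div q x) i \<in> A" using pCons.IH by auto
      have "a \<in> A" using pCons.prems[of 0] by simp
      then show ?case using IH xA
        by (auto simp: coeff_pCons split: nat.splits intro: add_in mult_in)
    qed (simp add: zero_in)
    have sA: "Polynomial.coeff s i \<in> A" for i using coeffA Suc.prems(1) unfolding s_def by blast
    have "Polynomial.coeff g (Suc n) = Polynomial.coeff s n - x * Polynomial.coeff s (Suc n)"
      by (subst g) (simp add: coeff_pCons)
    moreover have "Polynomial.coeff s (Suc n) = 0" using ds by (simp add: coeff_eq_0)
    ultimately have "lead_coeff s = 1" using Suc.prems(2) Suc.hyps(2) ds by simp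
    have "card (Y - {x}) \<le> degree s"
    proof (rule Suc.hyps(1))
      show "n = degree s" using ds by simp
      show "poly s y \<in> P" if y: "y \<in> Y - {x}" for y
      proof -
        have "poly g y - poly g x = (y - x) * poly s y"
          by (subst g) (simp add: algebra_simps)
        moreover have "poly g y - poly g x \<in> P" using I(4) Suc.prems(4) x y by blast
        moreover have "y - x \<notin> P" using Suc.prems(5) x y by blast
        moreover have yA: "y \<in> A" using y Suc.prems(3) by blast
        moreover have "poly s y \<in> A" unfolding poly_altdef using sA yA
          by (intro sum_in mult_in power_in) auto
        ultimately show ?thesis using maxid_prime[OF P, of "y - x" "poly s y"] diff_in xA by metis
      qed
    qed (use Suc.prems sA \<open>lead_coeff s = 1\<close> in auto)
    then show ?thesis using x Suc.prems(6) ds Suc.hyps(2) by simp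
  qed simp
qed

lemma exists_nonroot:
  fixes G :: "int poly"
  assumes P: "maxid P" and G: "lead_coeff G = 1" "degree G < idx A P"
  obtains x where "x \<in> A" "ipoly G x \<notin> P"
proof -
  obtain R where R: "R \<subseteq> A" "\<And>r r'. r \<in> R \<Longrightarrow> r' \<in> R \<Longrightarrow> r - r' \<in> P \<Longrightarrow> r = r'" "card R = idx A P"
    "0 < idx A P \<Longrightarrow> finite R" using obtain_reps[OF is_idealD(8)[OF maxidD(1)[OF P]], of A] by metis
  have fin: "finite R" using R(4) G(2) by simp
  have "\<exists>x\<in>R. ipoly G x \<notin> P"
  proof (rule ccontr)
    assume "\<not> ?thesis"
    then have "card R \<le> degree (map_poly of_int G :: 'a poly)"
      using R fin G(1) by (intro card_roots_le[OF P]) (auto simp: of_int_in)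
    then show False using R(3) G(2) by simp
  qed
  then show ?thesis using R(1) that by blast
qed

lemma ipoly_in_ideal:
  assumes I: "is_ideal I" "\<pi> \<in> I" and "x \<in> A" and r: "\<And>i. int p dvd Polynomial.coeff r i"
  shows "ipoly r x \<in> I"
proof -
  have "\<forall>i. \<exists>c. Polynomial.coeff r i = int p * c" using r by (auto simp: dvd_def)
  then have "[:int p:] dvd r" using r by (simp add: const_poly_dvd_iff)
  then obtain q where "r = [:int p:] * q" by (auto simp: dvd_def)
  then have "ipoly r x = \<pi> * ipoly q x" by (simp add: hom_distribs)
  then show ?thesis using is_idealD(7)[OF I(1)] I(2) ipoly_in assms by metis
qed

text \<open>Take the last coefficient prime to \<open>p\<close>, scale by its inverse modulo
  \<open>p\<close>, set it to 1 and drop everything above it. The result differs from the scaled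
  \<open>h\<close> by a multiple of \<open>p\<close>, hence by an element of \<open>I\<close> at
  \<open>x\<close>.\<close>

lemma exists_monic:
  fixes h :: "int poly"
  assumes I: "is_ideal I" "\<pi> \<in> I" and x: "x \<in> A" and h: "ipoly h x \<in> I" and nd: "\<not> int p dvd Polynomial.coeff h k"
  obtains g :: "int poly" where "lead_coeff g = 1" "degree g \<le> degree h" "ipoly g x \<in> I"
proof -
  define S where "S = {i. \<not> int p dvd Polynomial.coeff h i}"
  have Sle: "i \<le> degree h" if "i \<in> S" for i using that by (auto simp: S_def intro: le_degree)
  then have fin: "finite S" by (meson finite_nat_set_iff_bounded_le)
  have "k \<in> S" using nd by (simp add: S_def)
  define n where "n = Max S"
  have n: "n \<in> S" "\<And>i. i \<in> S \<Longrightarrow> i \<le> n" using fin \<open>k \<in> S\<close> by (auto simp: n_def intro: Max_in)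
  have "coprime (Polynomial.coeff h n) (int p)"
    using n(1) p_prime by (simp add: S_def prime_imp_coprime coprime_commute)
  then obtain c where "[Polynomial.coeff h n * c = 1] (mod int p)" using cong_solve_coprime_int by blast
  then have c: "int p dvd c * Polynomial.coeff h n - 1" by (simp add: cong_iff_dvd_diff mult.commute)
  define g where "g = poly_cutoff n (Polynomial.smult c h) + Polynomial.monom 1 n"
  have cg: "Polynomial.coeff g i = (if i < n then c * Polynomial.coeff h i else if i = n then 1 else 0)" for i
    by (simp add: g_def coeff_poly_cutoff)
  have dg: "degree g = n"
  proof (rule antisym)
    show "degree g \<le> n" by (rule degree_le) (simp add: cg)
    show "n \<le> degree g" by (rule le_degree) (simp add: cg)
  qed
  have "int p dvd Polynomial.coeff (g - Polynomial.smult c h) i" for i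
  proof -
    consider "i < n" | "i = n" | "i > n" by linarith
    then show ?thesis
    proof cases
      case 2
      then show ?thesis using c dvd_minus_iff[of "int p" "c * Polynomial.coeff h n - 1"] by (simp add: cg)
    next
      case 3
      then have "i \<notin> S" using n(2) by force
      then show ?thesis using 3 by (simp add: cg S_def)
    qed (simp add: cg)
  qed
  then have "ipoly (g - Polynomial.smult c h) x \<in> I" by (intro ipoly_in_ideal[OF I x])
  moreover have "of_int c * ipoly h x \<in> I" using is_idealD(6)[OF I(1) of_int_in h] .
  ultimately have "ipoly (g - Polynomial.smult c h) x + of_int c * ipoly h x \<in> I" by (rule is_idealD(3)[OF I(1)])
  then have "ipoly g x \<in> I" by (simp add: ipoly_diff ipoly_smult)
  moreover have "degree g \<le> degree h" using dg Sle n(1) by simp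
  moreover have "lead_coeff g = 1" using dg cg by simp
  ultimately show ?thesis using that by blast
qed

text \<open>Pigeonhole: the \<open>p ^ m\<close> polynomials of degree below \<open>m\<close> with
  coefficients in \<open>{..<p}\<close> outnumber the classes modulo \<open>I\<close>. The
  difference of two that collide has a coefficient prime to \<open>p\<close> and can be made
  monic.\<close>

lemma exists_monic_degree_less:
  assumes I: "is_ideal I" "\<pi> \<in> I" and x: "x \<in> A" and le: "idx A I < p ^ m"
  obtains g :: "int poly" where "lead_coeff g = 1" "degree g < m" "ipoly g x \<in> I"
proof -
  let ?F = "{..<m} \<rightarrow>\<^sub>E {..<p}"
  define \<phi> where "\<phi> c = (\<Sum>i<m. of_nat (c i) * x ^ i)" for c :: "nat \<Rightarrow> nat"
  have pos: "0 < idx A I" using idx_pos[OF I pi_nonzero] .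
  have \<phi>A: "\<phi> c \<in> A" for c unfolding \<phi>_def using x by (intro sum_in mult_in power_in of_nat_in)
  have finF: "finite ?F" by (rule finite_PiE) auto
  have "\<not> inj_on (coset_of I \<circ> \<phi>) ?F"
  proof
    assume "inj_on (coset_of I \<circ> \<phi>) ?F"
    then have "card ?F = card ((coset_of I \<circ> \<phi>) ` ?F)" by (rule card_image[symmetric])
    also have "\<dots> \<le> idx A I" unfolding idx_def
      using \<phi>A pos by (intro card_mono) (auto simp: idx_def card_gt_0_iff)
    finally show False using le by (simp add: card_PiE)
  qed
  then obtain a b where ab: "a \<in> ?F" "b \<in> ?F" "a \<noteq> b" "coset_of I (\<phi> a) = coset_of I (\<phi> b)"
    by (auto simp: inj_on_def)
  then have d: "\<phi> a - \<phi> b \<in> I" using coset_of_eq_iff[OF is_idealD(8)[OF I(1)]] by blast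
  obtain k where k: "k < m" "a k \<noteq> b k" using ab PiE_ext by (metis lessThan_iff)
  define h :: "int poly" where "h = (\<Sum>i<m. Polynomial.monom (int (a i) - int (b i)) i)"
  have ch: "Polynomial.coeff h i = (if i < m then int (a i) - int (b i) else 0)" for i
    by (simp add: h_def coeff_sum)
  have "ipoly h x = \<phi> a - \<phi> b"
    by (simp add: h_def ipoly_sum ipoly_monom poly_monom \<phi>_def sum_subtractf left_diff_distrib)
  then have hI: "ipoly h x \<in> I" using d by simp
  have "a k < p" "b k < p" using ab k by auto
  then have "\<not> int p dvd int (a k) - int (b k)" using k(2) by (rule int_diff_not_dvd)
  then have "\<not> int p dvd Polynomial.coeff h k" using k by (simp add: ch)
  then obtain g :: "int poly" where g: "lead_coeff g = 1" "degree g \<le> degree h" "ipoly g x \<in> I"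
    using exists_monic[OF I x hI] by blast
  have "degree h \<le> m - 1" by (rule degree_le) (auto simp: ch)
  then show ?thesis using that g k by simp
qed

text \<open>\<open>T\<close> is the preimage in \<open>A\<close> of the subring of
  \<open>A / I\<close> generated by the class of \<open>x\<close>.\<close>

lemma adjoin_closed:
  assumes I: "is_ideal I" and x: "x \<in> A"
  defines "T \<equiv> {a \<in> A. \<exists>h. a - ipoly h x \<in> I}"
  shows "add_closed T" "I \<subseteq> T" "1 \<in> T" "\<And>a b. a \<in> T \<Longrightarrow> b \<in> T \<Longrightarrow> a * b \<in> T"
proof -
  note I' = is_idealD[OF I]
  show IT: "I \<subseteq> T" using I'(1) ipoly_0 by (auto simp: T_def intro!: exI[of _ 0])
  show "1 \<in> T" using I'(2) one_in ipoly_1 by (auto simp: T_def intro!: exI[of _ 1])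
  show "add_closed T" unfolding add_closed_def
  proof safe
    show "0 \<in> T" using IT I'(2) by blast
    fix a b assume "a \<in> T" "b \<in> T"
    then obtain g h where gh: "a \<in> A" "b \<in> A" "a - ipoly g x \<in> I" "b - ipoly h x \<in> I" by (auto simp: T_def)
    have "(a - b) - ipoly (g - h) x = (a - ipoly g x) - (b - ipoly h x)" by (simp add: ipoly_diff)
    then have "(a - b) - ipoly (g - h) x \<in> I" using gh I'(4) by metis
    then show "a - b \<in> T" using gh by (auto simp: T_def intro: diff_in)
  qed
  fix a b assume "a \<in> T" "b \<in> T"
  then obtain g h where gh: "a \<in> A" "b \<in> A" "a - ipoly g x \<in> I" "b - ipoly h x \<in> I" by (auto simp: T_def)
  have "a * b - ipoly (g * h) x = b * (a - ipoly g x) + ipoly g x * (b - ipoly h x)"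
    by (simp add: ipoly_mult algebra_simps)
  then have "a * b - ipoly (g * h) x \<in> I" using gh I'(3,6) ipoly_in[OF x] by metis
  then show "a * b \<in> T" using gh by (auto simp: T_def intro: mult_in)
qed

text \<open>Division by the monic \<open>g\<close>, followed by reduction of the remainder modulo
  \<open>p\<close>, leaves at most \<open>p ^ degree g\<close> representatives.\<close>

lemma idx_adjoin_le:
  fixes g :: "int poly"
  assumes I: "is_ideal I" "\<pi> \<in> I" and x: "x \<in> A" and g: "lead_coeff g = 1" "ipoly g x \<in> I"
  shows "idx {a \<in> A. \<exists>h. a - ipoly h x \<in> I} I \<le> p ^ degree g"
proof -
  note I' = is_idealD[OF I(1)]
  let ?T = "{a \<in> A. \<exists>h. a - ipoly h x \<in> I}" and ?n = "degree g"
  let ?F = "{..<?n} \<rightarrow>\<^sub>E {..<p}"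
  define \<phi> where "\<phi> c = (\<Sum>i<?n. of_nat (c i) * x ^ i)" for c :: "nat \<Rightarrow> nat"
  have fin: "finite (\<phi> ` ?F)" by (intro finite_imageI finite_PiE) auto
  have "\<exists>r\<in>\<phi> ` ?F. a - r \<in> I" if a: "a \<in> ?T" for a
  proof -
    obtain h where h: "a - ipoly h x \<in> I" using a by blast
    obtain q r where qr: "h = g * q + r" "r = 0 \<or> degree r < ?n" using monic_division[OF g(1)] by blast
    define c where "c = (\<lambda>i\<in>{..<?n}. nat (Polynomial.coeff r i mod int p))"
    have cF: "c \<in> ?F" using p_gt_1 by (auto simp: c_def nat_less_iff)
    define s :: "int poly" where "s = (\<Sum>i<?n. Polynomial.monom (int (c i)) i)"
    have "\<phi> c = ipoly s x" by (simp add: s_def ipoly_sum ipoly_monom \<phi>_def poly_monom)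
    moreover have "int p dvd Polynomial.coeff (r - s) i" for i
    proof (cases "i < ?n")
      case True
      then have "Polynomial.coeff s i = Polynomial.coeff r i mod int p" using p_gt_1 by (simp add: s_def coeff_sum c_def)
      then show ?thesis by (simp add: mod_eq_dvd_iff[symmetric])
    next
      case False
      then have "Polynomial.coeff r i = 0" using qr(2) by (auto intro: coeff_eq_0)
      then show ?thesis using False by (simp add: s_def coeff_sum)
    qed
    then have "ipoly (r - s) x \<in> I" by (intro ipoly_in_ideal[OF I x])
    moreover have "ipoly g x * ipoly q x \<in> I" using I'(7) ipoly_in[OF x] g(2) by blast
    ultimately have "(a - ipoly h x) + (ipoly g x * ipoly q x + ipoly (r - s) x) \<in> I" "\<phi> c = ipoly s x"
      using h I'(3) by blast+
    then have "a - \<phi> c \<in> I" by (simp add: qr ipoly_add ipoly_mult ipoly_diff)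
    then show ?thesis using cF by blast
  qed
  then have "idx ?T I \<le> card (\<phi> ` ?F)"
    using adjoin_closed(3)[OF I(1) x] by (intro idx_le_card(2)[OF I'(8) fin]) auto
  also have "\<dots> \<le> card ?F" by (rule card_image_le) (intro finite_PiE, auto)
  also have "\<dots> = p ^ ?n" by (simp add: card_PiE)
  finally show ?thesis .
qed

end

text \<open>\<open>T / P\<close> is a finite domain, so multiplication by \<open>x\<close> permutes
  its nonzero classes; comparing the product of all of them before and after gives Fermat's theorem.
  A general \<open>T\<close> is allowed because it will also be a subring generated by one
  element.\<close>

lemma fermat_quotient:
  fixes T P :: "'a::idom set"
  assumes T: "add_closed T" "1 \<in> T" "\<And>a b. a \<in> T \<Longrightarrow> b \<in> T \<Longrightarrow> a * b \<in> T"
    and P: "add_closed P" "P \<subseteq> T" "\<And>a b. a \<in> T \<Longrightarrow> b \<in> P \<Longrightarrow> a * b \<in> P"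
    and prime: "\<And>a b. a \<in> T \<Longrightarrow> b \<in> T \<Longrightarrow> a * b \<in> P \<Longrightarrow> a \<notin> P \<Longrightarrow> b \<in> P"
    and one: "1 \<notin> P" and pos: "0 < idx T P" and x: "x \<in> T"
  shows "x ^ idx T P - x \<in> P"
proof -
  have xn: "x ^ n \<in> T" for n by (induction n) (use T x in auto)
  obtain q where q: "idx T P = Suc q" using pos by (cases "idx T P") auto
  show ?thesis
  proof (cases "x \<in> P")
    case True
    then have "x ^ q * x \<in> P" using P(3) xn by blast
    then show ?thesis using True add_closed_diff[OF P(1)] q by (simp add: mult.commute)
  next
    case False
    obtain R where R: "R \<subseteq> T" "\<And>x. x \<in> T \<Longrightarrow> \<exists>r\<in>R. x - r \<in> P"
      "\<And>r r'. r \<in> R \<Longrightarrow> r' \<in> R \<Longrightarrow> r - r' \<in> P \<Longrightarrow> r = r'" "card R = idx T P" "finite R"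
      using obtain_reps[OF P(1), of T] pos by metis
    obtain r0 where r0: "r0 \<in> R" "0 - r0 \<in> P" using R(2) add_closed_0[OF T(1)] by blast
    then have r0P: "r0 \<in> P" using add_closed_uminus[OF P(1), of "0 - r0"] by simp
    define R' where "R' = R - {r0}"
    have R'P: "r \<notin> P" if "r \<in> R'" for r
      using that R(3)[of r r0] r0 r0P add_closed_diff[OF P(1)] by (auto simp: R'_def)
    have R'T: "r \<in> T" if "r \<in> R'" for r using that R(1) by (auto simp: R'_def)
    have fin: "finite R'" and cR: "card R' = q" using R(4,5) r0 q by (auto simp: R'_def)
    have "\<exists>s. s \<in> R' \<and> x * r - s \<in> P" if r: "r \<in> R'" for r
    proof -
      obtain s where s: "s \<in> R" "x * r - s \<in> P" using R(2) T(3) x R'T[OF r] by blast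
      have "s \<noteq> r0"
      proof
        assume "s = r0"
        then have "x * r - s + s \<in> P" using add_closed_add[OF P(1) s(2)] r0P by blast
        then show False using prime[OF x R'T[OF r]] False R'P[OF r] by simp
      qed
      then show ?thesis using s by (auto simp: R'_def)
    qed
    then obtain \<sigma> where \<sigma>: "\<And>r. r \<in> R' \<Longrightarrow> \<sigma> r \<in> R' \<and> x * r - \<sigma> r \<in> P" by metis
    have "inj_on \<sigma> R'"
    proof (rule inj_onI)
      fix r r' assume r: "r \<in> R'" "r' \<in> R'" "\<sigma> r = \<sigma> r'"
      have "x * (r - r') = (x * r - \<sigma> r) - (x * r' - \<sigma> r')" using r by (simp add: algebra_simps)
      then have "x * (r - r') \<in> P" using \<sigma> r add_closed_diff[OF P(1)] by metis
      moreover have "r - r' \<in> T" using R'T r add_closed_diff[OF T(1)] by blast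
      ultimately have "r - r' \<in> P" using prime[OF x] False by blast
      then show "r = r'" using R(3) r by (auto simp: R'_def)
    qed
    moreover have "\<sigma> ` R' \<subseteq> R'" using \<sigma> by blast
    ultimately have im: "\<sigma> ` R' = R'" using fin by (simp add: endo_inj_surj)
    have prT: "prod f S \<in> T" if "\<And>i. i \<in> S \<Longrightarrow> f i \<in> T" for f :: "'a \<Rightarrow> 'a" and S
      using that by (induction S rule: infinite_finite_induct) (use T in auto)
    have prP: "(\<Prod>r\<in>S. x * r) - prod \<sigma> S \<in> P \<and> prod id S \<notin> P" if "finite S" "S \<subseteq> R'" for S
      using that
    proof (induction S)
      case empty
      then show ?case using one add_closed_0[OF P(1)] by simp
    next
      case (insert r S)
      then have r: "r \<in> R'" and S: "S \<subseteq> R'" and IH: "(\<Prod>r\<in>S. x * r) - prod \<sigma> S \<in> P" "prod id S \<notin> P" by auto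
      have "(\<Prod>r\<in>insert r S. x * r) - prod \<sigma> (insert r S)
        = x * r * ((\<Prod>r\<in>S. x * r) - prod \<sigma> S) + prod \<sigma> S * (x * r - \<sigma> r)"
        using insert by (simp add: algebra_simps)
      moreover have "x * r \<in> T" using T(3)[OF x R'T[OF r]] .
      moreover have "prod \<sigma> S \<in> T" using \<sigma> S R'T by (intro prT) blast
      ultimately have "(\<Prod>r\<in>insert r S. x * r) - prod \<sigma> (insert r S) \<in> P"
        using P(3) add_closed_add[OF P(1)] IH(1) \<sigma>[OF r] by metis
      moreover have "prod id S \<in> T" using S R'T by (intro prT) auto
      then have "r * prod id S \<notin> P" using prime[OF R'T[OF r]] IH(2) R'P[OF r] by blast
      ultimately show ?case using insert by simp
    qed
    have "prod \<sigma> R' = prod id R'" using prod.reindex[OF \<open>inj_on \<sigma> R'\<close>, of id] im by simp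
    then have "(x ^ q - 1) * prod id R' \<in> P"
      using prP[OF fin order_refl] cR by (simp add: prod.distrib left_diff_distrib)
    moreover have "prod id R' \<in> T" using R'T by (intro prT) auto
    moreover have "x ^ q - 1 \<in> T" using xn T(2) add_closed_diff[OF T(1)] by blast
    ultimately have "x ^ q - 1 \<in> P"
      using prime[of "prod id R'" "x ^ q - 1"] prP[OF fin order_refl] by (simp add: mult.commute)
    then have "x * (x ^ q - 1) \<in> P" using P(3) x by blast
    then show ?thesis by (simp add: q algebra_simps)
  qed
qed

section \<open>Generators of residue fields\<close>

text \<open>Compares a residue field of \<open>p ^ f\<close> elements with those to be avoided in
  it: the elements of proper subfields, and the roots of polynomials of total degree at most
  \<open>d - f\<close>. It is sharp: \<open>p = 3\<close>, \<open>f = 2\<close>,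
  \<open>d = 7\<close> gives 8 < 9.\<close>

lemma geometric_bound:
  fixes p f d :: nat
  assumes "p \<ge> 3" "f \<ge> 2" "f \<le> d" "d \<le> 7"
  shows "(d - f) + (\<Sum>i\<in>{1..<f}. p ^ i) < p ^ f"
proof -
  have "2 * (\<Sum>i\<in>{1..<f}. p ^ i) + p \<le> p ^ f" using assms(2)
  proof (induction f rule: dec_induct)
    case base
    have "3 * p \<le> p * p" using assms(1) by simp
    moreover have "{1..<2::nat} = {1}" by auto
    ultimately show ?case by (simp add: power2_eq_square)
  next
    case (step n)
    have "2 * (\<Sum>i\<in>{1..<Suc n}. p ^ i) + p = 2 * (\<Sum>i\<in>{1..<n}. p ^ i) + p + 2 * p ^ n"
      using step.hyps by (simp add: sum.atLeastLessThan_Suc)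
    also have "\<dots> \<le> 3 * p ^ n" using step by simp
    also have "\<dots> \<le> p ^ Suc n" using assms(1) by simp
    finally show ?case .
  qed
  moreover have "3 * 3 \<le> p * p" using assms(1) by (intro mult_le_mono) auto
  moreover have "p ^ 2 \<le> p ^ f" using assms(1,2) by (intro power_increasing) auto
  ultimately have "2 * (\<Sum>i\<in>{1..<f}. p ^ i) + p \<le> p ^ f" "p ^ f \<ge> 9"
    by (simp_all add: power2_eq_square)
  then show ?thesis using assms by linarith
qed

context semilocal
begin

definition generates :: "'a set \<Rightarrow> 'a \<Rightarrow> bool" where
  "generates P x \<longleftrightarrow> (\<forall>a\<in>A. \<exists>h. a - ipoly h x \<in> P)"

text \<open>Equivalently, the minimal polynomials of the two residue classes over the field with
  \<open>p\<close> elements differ; this form avoids speaking of minimal polynomials.\<close>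

definition separated :: "'a set \<Rightarrow> 'a \<Rightarrow> 'a set \<Rightarrow> 'a \<Rightarrow> bool" where
  "separated P x Q y \<longleftrightarrow> (\<exists>h. ipoly h x \<in> P \<and> ipoly h y \<notin> Q)"

lemma fermat_maxid:
  assumes P: "maxid P" and x: "x \<in> A"
  shows "x ^ (p ^ rdeg P) - x \<in> P"
proof -
  note I = is_idealD[OF maxidD(1)[OF P]]
  have "x ^ idx A P - x \<in> P"
  proof (rule fermat_quotient)
    show "P \<subseteq> A" using I(1) by blast
    show "b \<in> P" if "a \<in> A" "b \<in> A" "a * b \<in> P" "a \<notin> P" for a b
      using maxid_prime[OF P that] .
    show "0 < idx A P" using idx_maxid[OF P] p_gt_1 by simp
  qed (use A_closed one_in mult_in I(6,8) maxidD(3)[OF P] x in auto)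
  then show ?thesis using idx_maxid[OF P] by simp
qed

text \<open>A class that does not generate lies in a proper subring of the residue field, of order
  \<open>p ^ i\<close> with \<open>i < rdeg P\<close>, and Fermat's theorem holds in that
  subring.\<close>

lemma fermat_nongenerator:
  assumes P: "maxid P" and x: "x \<in> A" and ng: "\<not> generates P x"
  obtains i where "1 \<le> i" "i < rdeg P" "x ^ (p ^ i) - x \<in> P"
proof -
  note I = is_idealD[OF maxidD(1)[OF P]]
  define T where "T = {a \<in> A. \<exists>h. a - ipoly h x \<in> P}"
  note T = adjoin_closed[OF maxidD(1)[OF P] x, folded T_def]
  have TA: "T \<subseteq> A" by (auto simp: T_def)
  have tower: "p ^ rdeg P = idx A T * idx T P"
    using idx_tower[OF A_closed T(1) I(8) T(2) TA] idx_maxid[OF P] by simp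
  then have "idx T P dvd p ^ rdeg P" by simp
  then obtain i where i: "i \<le> rdeg P" "idx T P = p ^ i" using divides_primepow_nat[OF p_prime] by blast
  have "T \<noteq> A" using ng by (auto simp: T_def generates_def)
  then have "idx A T \<noteq> 1" using idx_eq_1_iff[OF A_closed T(1) TA] by auto
  then have "i \<noteq> rdeg P" using tower i p_gt_1 by auto
  moreover have "idx T P \<noteq> 1" using idx_eq_1_iff[OF T(1) I(8) T(2)] T(3) maxidD(3)[OF P] by auto
  then have "i \<noteq> 0" using i by auto
  moreover have "x ^ idx T P - x \<in> P"
  proof (rule fermat_quotient)
    show "b \<in> P" if "a \<in> T" "b \<in> T" "a * b \<in> P" "a \<notin> P" for a b
      using maxid_prime[OF P] that TA by blast
    show "0 < idx T P" using i p_gt_1 by simp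
    have "x - ipoly (Polynomial.monom 1 1) x \<in> P" using I(2) by (simp add: ipoly_monom poly_monom)
    then show "x \<in> T" using x unfolding T_def by blast
  qed (use T I(6,8) maxidD(3)[OF P] TA in auto)
  ultimately show ?thesis using that[of i] i by auto
qed

lemma exists_min_poly:
  assumes P: "maxid P" and x: "x \<in> A"
  obtains g :: "int poly" where "lead_coeff g = 1" "degree g \<le> rdeg P" "ipoly g x \<in> P"
proof -
  have "idx A P < p ^ Suc (rdeg P)" using idx_maxid[OF P] p_gt_1 by simp
  then show ?thesis using exists_monic_degree_less[OF maxidD(1,2)[OF P] x] that by (metis less_Suc_eq_le)
qed

text \<open>With \<open>n + 1\<close> the order of \<open>A / Q\<close>, the nonzero class of
  \<open>ipoly h y\<close> has \<open>n\<close>-th power 1. So \<open>h ^ n - 1\<close> vanishes at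
  \<open>y\<close> modulo \<open>Q\<close>, while it is -1 at \<open>x\<close> modulo
  \<open>P\<close>.\<close>

lemma separated_sym:
  assumes P: "maxid P" and Q: "maxid Q" and xy: "x \<in> A" "y \<in> A" and s: "separated P x Q y"
  shows "separated Q y P x"
proof -
  note IP = is_idealD[OF maxidD(1)[OF P]] and IQ = is_idealD[OF maxidD(1)[OF Q]]
  obtain h where h: "ipoly h x \<in> P" "ipoly h y \<notin> Q" using s by (auto simp: separated_def)
  define n where "n = p ^ rdeg Q - 1"
  have "1 < p ^ rdeg Q" using nrm_gen_gt_1[OF Q] idx_maxid(2)[OF Q] by simp
  then have n: "p ^ rdeg Q = Suc n" "n > 0" by (auto simp: n_def)
  let ?u = "ipoly h y"
  have "?u ^ Suc n - ?u \<in> Q" using fermat_maxid[OF Q ipoly_in[OF xy(2)]] n by simp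
  moreover have "?u ^ Suc n - ?u = ?u * (?u ^ n - 1)" by (simp add: algebra_simps)
  ultimately have "?u ^ n - 1 \<in> Q"
    using maxid_prime[OF Q ipoly_in[OF xy(2)] diff_in[OF power_in[OF ipoly_in[OF xy(2)]] one_in]] h(2) by simp
  then have "ipoly (h ^ n - 1) y \<in> Q" by (simp add: ipoly_diff ipoly_power ipoly_1)
  moreover have "ipoly (h ^ n - 1) x \<notin> P"
  proof
    assume "ipoly (h ^ n - 1) x \<in> P"
    then have "ipoly h x ^ n - 1 \<in> P" by (simp add: ipoly_diff ipoly_power ipoly_1)
    moreover have "ipoly h x ^ n = ipoly h x * ipoly h x ^ (n - 1)" using n(2) by (cases n) auto
    then have "ipoly h x ^ n \<in> P" using IP(7) h(1) power_in[OF ipoly_in[OF xy(1)]] by simp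
    ultimately have "ipoly h x ^ n - (ipoly h x ^ n - 1) \<in> P" using IP(4) by blast
    then show False using maxidD(3)[OF P] by simp
  qed
  ultimately show ?thesis by (auto simp: separated_def)
qed

text \<open>The integers below \<open>p\<close> are pairwise incongruent modulo \<open>P\<close>,
  their differences being units, and there are only \<open>p\<close> classes.\<close>

lemma rdeg_1_residue:
  assumes P: "maxid P" "rdeg P = 1" and a: "a \<in> A"
  obtains k where "k < p" "a - of_nat k \<in> P"
proof -
  note I = is_idealD[OF maxidD(1)[OF P(1)]]
  have idx: "idx A P = p" using idx_maxid[OF P(1)] P(2) by simp
  have uniq: "i = j" if "i < p" "j < p" "of_nat i - of_nat j \<in> P" for i j :: nat
  proof (rule ccontr)
    assume "i \<noteq> j"
    then have "\<not> int p dvd int i - int j" using that(1,2) by (intro int_diff_not_dvd)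
    then have "inverse (of_int (int i - int j)) \<in> A" by (rule int_unit)
    then have "inverse (of_int (int i - int j)) * (of_nat i - of_nat j) \<in> P" using I(6) that(3) by blast
    moreover have "(of_nat i - of_nat j :: 'a) \<noteq> 0" using \<open>i \<noteq> j\<close> by simp
    ultimately show False using maxidD(3)[OF P(1)] by simp
  qed
  have "\<exists>k<p. a - of_nat k \<in> P"
  proof (rule ccontr)
    assume no: "\<not> ?thesis"
    let ?R = "of_nat ` {..<p} :: 'a set"
    have aR: "a \<notin> ?R" using no I(2) by force
    have "card (insert a ?R) \<le> idx A P"
    proof (rule idx_inj_le(2)[OF I(8)])
      show "0 < idx A P" using idx p_gt_1 by simp
      show "insert a ?R \<subseteq> A" using a of_nat_in by auto
      fix r r' assume r: "r \<in> insert a ?R" "r' \<in> insert a ?R" "r - r' \<in> P"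
      have "r' - r \<in> P" using I(5)[OF r(3)] by simp
      then show "r = r'" using r no uniq by auto
    qed
    moreover have "card (insert a ?R) = Suc p" using aR by (simp add: card_image inj_on_def)
    ultimately show False using idx by simp
  qed
  then show ?thesis using that by blast
qed

text \<open>A greedy choice. In the residue field of the next ideal \<open>Q\<close> the new
  generator must avoid the roots of the polynomials \<open>g P\<close> already attached to
  \<open>S\<close> and of \<open>X ^ (p ^ i) - X\<close> for \<open>i < rdeg Q\<close>. All are
  factors of \<open>G\<close>, whose degree is below the order of the field.\<close>

lemma choose_generators:
  assumes num: "p \<ge> 3" "d \<le> 7"
  assumes "finite S" "S \<subseteq> {P \<in> spec. rdeg P \<ge> 2}"
  shows "\<exists>\<gamma>. (\<forall>P\<in>S. \<gamma> P \<in> A \<and> generates P (\<gamma> P)) \<and>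
    (\<forall>P\<in>S. \<forall>Q\<in>S. P \<noteq> Q \<longrightarrow> separated P (\<gamma> P) Q (\<gamma> Q))"
  using assms(3,4)
proof (induction S)
  case (insert Q S)
  have Q: "maxid Q" "rdeg Q \<ge> 2" and S: "\<And>P. P \<in> S \<Longrightarrow> maxid P"
    using insert.prems by (auto simp: spec_iff)
  obtain \<gamma> where \<gamma>: "\<And>P. P \<in> S \<Longrightarrow> \<gamma> P \<in> A" "\<And>P. P \<in> S \<Longrightarrow> generates P (\<gamma> P)"
    "\<And>P Q. P \<in> S \<Longrightarrow> Q \<in> S \<Longrightarrow> P \<noteq> Q \<Longrightarrow> separated P (\<gamma> P) Q (\<gamma> Q)"
    using insert by (metis insert_subset)
  have "\<exists>g::int poly. lead_coeff g = 1 \<and> degree g \<le> rdeg P \<and> ipoly g (\<gamma> P) \<in> P" if "P \<in> S" for P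
    using exists_min_poly[OF S[OF that] \<gamma>(1)[OF that]] by metis
  then obtain g :: "'a set \<Rightarrow> int poly" where g: "\<And>P. P \<in> S \<Longrightarrow> lead_coeff (g P) = 1"
    "\<And>P. P \<in> S \<Longrightarrow> degree (g P) \<le> rdeg P" "\<And>P. P \<in> S \<Longrightarrow> ipoly (g P) (\<gamma> P) \<in> P" by metis
  define E :: "nat \<Rightarrow> int poly" where "E i = Polynomial.monom 1 (p ^ i) - Polynomial.monom 1 1" for i
  have E: "degree (E i) = p ^ i" "lead_coeff (E i) = 1" if "i \<ge> 1" for i
  proof -
    have gt: "1 < p ^ i" using one_less_power[OF p_gt_1, of i] that by linarith
    have c: "Polynomial.coeff (E i) k = (if k = p ^ i then 1 else 0) - (if k = 1 then 1 else 0)" for k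
      unfolding E_def coeff_diff coeff_monom by auto
    have ne: "p ^ i \<noteq> 1" using gt by linarith
    have c1: "Polynomial.coeff (E i) (p ^ i) = 1"
      unfolding c if_P[OF refl] if_not_P[OF ne] by simp
    show 1: "degree (E i) = p ^ i"
    proof (rule antisym)
      show "degree (E i) \<le> p ^ i" 
      proof (rule degree_le, intro allI impI)
        fix k assume "p ^ i < k"
        then have "k \<noteq> p ^ i" "k \<noteq> 1" using gt by linarith+
        then show "Polynomial.coeff (E i) k = 0" unfolding c by simp
      qed
      show "p ^ i \<le> degree (E i)" by (rule le_degree) (use c1 in simp)
    qed
    show "lead_coeff (E i) = 1" unfolding 1 by (rule c1)
  qed
  define G where "G = prod g S * prod E {1..<rdeg Q}"
  have "lead_coeff G = 1" by (simp add: G_def lead_coeff_mult lead_coeff_prod g(1) E(2))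
  moreover have "degree G < idx A Q"
  proof -
    have "degree G \<le> degree (prod g S) + degree (prod E {1..<rdeg Q})"
      unfolding G_def by (rule degree_mult_le)
    also have "degree (prod g S) \<le> (\<Sum>P\<in>S. degree (g P))"
      using degree_prod_sum_le[OF insert.hyps(1), of g] by (simp add: o_def)
    also have "\<dots> \<le> (\<Sum>P\<in>S. rdeg P)" by (intro sum_mono g(2))
    also have "degree (prod E {1..<rdeg Q}) \<le> (\<Sum>i\<in>{1..<rdeg Q}. degree (E i))"
      using degree_prod_sum_le[of "{1..<rdeg Q}" E] by (simp add: o_def)
    also have "\<dots> = (\<Sum>i\<in>{1..<rdeg Q}. p ^ i)" by (intro sum.cong) (auto simp: E(1))
    finally have 1: "degree G \<le> (\<Sum>P\<in>S. rdeg P) + (\<Sum>i\<in>{1..<rdeg Q}. p ^ i)" by simp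
    \<comment> \<open>All residue degrees together amount to at most \<open>d\<close>, so the
      polynomials attached to \<open>S\<close> have total degree at most
      \<open>d - rdeg Q\<close>.\<close>
    have "rdeg Q + (\<Sum>P\<in>S. rdeg P) = (\<Sum>P\<in>insert Q S. rdeg P)" using insert.hyps by simp
    also have "\<dots> \<le> (\<Sum>P\<in>spec. rdeg P)" using insert.prems finite_spec by (intro sum_mono2) auto
    also have "\<dots> \<le> d" by (rule sum_rdeg_le)
    finally have "rdeg Q + (\<Sum>P\<in>S. rdeg P) \<le> d" .
    then show ?thesis using 1 geometric_bound[OF num(1) Q(2) _ num(2)] idx_maxid[OF Q(1)] by auto
  qed
  ultimately obtain x where x: "x \<in> A" "ipoly G x \<notin> Q" using exists_nonroot[OF Q(1)] by blast
  have factor: "ipoly (g P) x \<notin> Q" if "P \<in> S" for P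
  proof
    assume "ipoly (g P) x \<in> Q"
    moreover have "g P dvd G" unfolding G_def using that insert.hyps by (intro dvd_mult2 dvd_prodI)
    then obtain k where "G = g P * k" by (auto simp: dvd_def)
    ultimately have "ipoly G x \<in> Q" using is_idealD(7)[OF maxidD(1)[OF Q(1)]] ipoly_in[OF x(1)] by (simp add: ipoly_mult)
    then show False using x by simp
  qed
  have factor2: "x ^ (p ^ i) - x \<notin> Q" if "1 \<le> i" "i < rdeg Q" for i
  proof
    assume "x ^ (p ^ i) - x \<in> Q"
    then have "ipoly (E i) x \<in> Q" by (simp add: E_def ipoly_diff ipoly_monom poly_monom)
    moreover have "E i dvd G" unfolding G_def using that by (intro dvd_mult dvd_prodI) auto
    then obtain k where "G = E i * k" by (auto simp: dvd_def)
    ultimately have "ipoly G x \<in> Q" using is_idealD(7)[OF maxidD(1)[OF Q(1)]] ipoly_in[OF x(1)] by (simp add: ipoly_mult)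
    then show False using x by simp
  qed
  have gen: "generates Q x" using fermat_nongenerator[OF Q(1) x(1)] factor2 by metis
  have sep: "separated P (\<gamma> P) Q x" if "P \<in> S" for P
    using g(3)[OF that] factor[OF that] by (auto simp: separated_def)
  have sep': "separated Q x P (\<gamma> P)" if "P \<in> S" for P
    by (rule separated_sym[OF S[OF that] Q(1) \<gamma>(1)[OF that] x(1) sep[OF that]])
  show ?case
    by (rule exI[of _ "\<gamma>(Q := x)"]) (use \<gamma> x gen sep sep' insert.hyps in auto)
qed simp

text \<open>Ideals of degree one receive distinct integers below \<open>p\<close>, for which
  \<open>few\<close> is needed; the greedy choice covers the others. Across the two kinds separation
  is automatic: an element congruent to an integer cannot generate a larger residue field.\<close>

lemma generates_separated_all:
  assumes num: "p \<ge> 3" "d \<le> 7" and few: "card {P \<in> spec. rdeg P = 1} \<le> p"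
  obtains \<gamma> where "\<And>P. maxid P \<Longrightarrow> \<gamma> P \<in> A" "\<And>P. maxid P \<Longrightarrow> generates P (\<gamma> P)"
    "\<And>P Q. maxid P \<Longrightarrow> maxid Q \<Longrightarrow> P \<noteq> Q \<Longrightarrow> separated P (\<gamma> P) Q (\<gamma> Q)"
proof -
  let ?S1 = "{P \<in> spec. rdeg P = 1}" and ?S2 = "{P \<in> spec. rdeg P \<ge> 2}"
  have fin: "finite ?S1" "finite ?S2" using finite_spec by auto
  define S2 where "S2 = ?S2"
  have "\<exists>\<gamma>. (\<forall>P\<in>S2. \<gamma> P \<in> A \<and> generates P (\<gamma> P)) \<and>
    (\<forall>P\<in>S2. \<forall>Q\<in>S2. P \<noteq> Q \<longrightarrow> separated P (\<gamma> P) Q (\<gamma> Q))"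
    using choose_generators[OF num, of S2] fin(2) by (simp add: S2_def)
  then obtain \<gamma>2 where \<gamma>2': "(\<forall>P\<in>S2. \<gamma>2 P \<in> A \<and> generates P (\<gamma>2 P)) \<and>
    (\<forall>P\<in>S2. \<forall>Q\<in>S2. P \<noteq> Q \<longrightarrow> separated P (\<gamma>2 P) Q (\<gamma>2 Q))" ..
  then have \<gamma>2: "\<And>P. P \<in> ?S2 \<Longrightarrow> \<gamma>2 P \<in> A" "\<And>P. P \<in> ?S2 \<Longrightarrow> generates P (\<gamma>2 P)"
    "\<And>P Q. P \<in> ?S2 \<Longrightarrow> Q \<in> ?S2 \<Longrightarrow> P \<noteq> Q \<Longrightarrow> separated P (\<gamma>2 P) Q (\<gamma>2 Q)"
    unfolding S2_def by blast+
  have "\<exists>f. f ` ?S1 \<subseteq> {..<p} \<and> inj_on f ?S1"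
    by (rule card_le_inj) (simp_all only: fin few card_lessThan finite_lessThan)
  then obtain \<iota> where "\<iota> ` ?S1 \<subseteq> {..<p} \<and> inj_on \<iota> ?S1" ..
  then have \<iota>: "inj_on \<iota> ?S1" "\<iota> ` ?S1 \<subseteq> {..<p}" by (simp_all only:)
  define \<gamma> where "\<gamma> P = (if rdeg P = 1 then of_nat (\<iota> P) else \<gamma>2 P)" for P
  have dich: "P \<in> ?S1 \<and> rdeg P = 1 \<or> P \<in> ?S2 \<and> rdeg P \<noteq> 1" if "maxid P" for P
    using idx_maxid(3)[OF that] that by (auto simp: spec_iff)
  have A: "\<gamma> P \<in> A" if "maxid P" for P
    using dich[OF that] \<gamma>2(1) of_nat_in by (auto simp: \<gamma>_def)
  have gen: "generates P (\<gamma> P)" if P: "maxid P" for P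
  proof (cases "rdeg P = 1")
    case True
    show ?thesis unfolding generates_def
    proof
      fix a assume "a \<in> A"
      then obtain k where "a - of_nat k \<in> P" using rdeg_1_residue[OF P True] by blast
      then show "\<exists>h. a - ipoly h (\<gamma> P) \<in> P" by (intro exI[of _ "[:int k:]"]) (simp add: ipoly_pCons ipoly_0)
    qed
  next
    case False
    then show ?thesis using dich[OF P] \<gamma>2(2) by (simp add: \<gamma>_def)
  qed
  have sep1: "separated P (\<gamma> P) Q (\<gamma> Q)" if PQ: "maxid P" "maxid Q" "P \<noteq> Q" and 1: "rdeg P = 1" for P Q
  proof -
    define h :: "int poly" where "h = [:- int (\<iota> P), 1:]"
    have h: "ipoly h x = x - of_nat (\<iota> P)" for x by (simp add: h_def ipoly_pCons ipoly_0)
    have "ipoly h (\<gamma> P) \<in> P" using 1 is_idealD(2)[OF maxidD(1)[OF PQ(1)]] by (simp add: h \<gamma>_def)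
    moreover have "\<gamma> Q - of_nat (\<iota> P) \<notin> Q"
    proof
      note I = is_idealD[OF maxidD(1)[OF PQ(2)]]
      assume \<gamma>Q: "\<gamma> Q - of_nat (\<iota> P) \<in> Q"
      show False
      proof (cases "rdeg Q = 1")
        case True
        have "\<iota> P < p" "\<iota> Q < p" "\<iota> P \<noteq> \<iota> Q"
          using \<iota> dich[OF PQ(1)] dich[OF PQ(2)] True 1 PQ(3) by (auto simp: inj_on_def)
        then have "\<not> int p dvd int (\<iota> Q) - int (\<iota> P)" by (intro int_diff_not_dvd) auto
        then have "inverse (of_int (int (\<iota> Q) - int (\<iota> P))) \<in> A" by (rule int_unit)
        then have "inverse (of_int (int (\<iota> Q) - int (\<iota> P))) * (of_nat (\<iota> Q) - of_nat (\<iota> P)) \<in> Q"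
          using I(6) \<gamma>Q True by (auto simp: \<gamma>_def)
        moreover have "(of_nat (\<iota> Q) - of_nat (\<iota> P) :: 'a) \<noteq> 0" using \<open>\<iota> P \<noteq> \<iota> Q\<close> by simp
        ultimately show False using maxidD(3)[OF PQ(2)] by simp
      next
        case False
        let ?g = "[:- int (\<iota> P), 1:]"
        have "{a \<in> A. \<exists>h. a - ipoly h (\<gamma> Q) \<in> Q} = A"
          using gen[OF PQ(2)] by (auto simp: generates_def)
        moreover have "ipoly ?g (\<gamma> Q) \<in> Q" using \<gamma>Q by (simp add: ipoly_pCons ipoly_0)
        ultimately have "idx A Q \<le> p ^ 1"
          using idx_adjoin_le[OF maxidD(1,2)[OF PQ(2)] A[OF PQ(2)], of ?g] by simp
        then have "rdeg Q \<le> 1" using idx_maxid(1)[OF PQ(2)] p_gt_1 by (metis power_le_imp_le_exp)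
        then show False using False idx_maxid(3)[OF PQ(2)] by simp
      qed
    qed
    ultimately show ?thesis unfolding separated_def h[symmetric] by blast
  qed
  have sep: "separated P (\<gamma> P) Q (\<gamma> Q)" if PQ: "maxid P" "maxid Q" "P \<noteq> Q" for P Q
  proof (cases "rdeg P = 1 \<or> rdeg Q = 1")
    case True
    then show ?thesis using sep1[OF PQ] sep1[OF PQ(2,1)] PQ(3) separated_sym[OF PQ(2,1) A[OF PQ(2)] A[OF PQ(1)]] by auto
  next
    case False
    then have "P \<in> ?S2" "Q \<in> ?S2" using dich[OF PQ(1)] dich[OF PQ(2)] by auto
    from \<gamma>2(3)[OF this PQ(3)] show ?thesis using False by (simp add: \<gamma>_def)
  qed
  show ?thesis using that[OF A gen sep] by blast
qed

end

section \<open>Hensel's criterion\<close>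

context semilocal
begin

lemma generates_cong:
  assumes P: "maxid P" and x: "x \<in> A" "y \<in> A" "x - y \<in> P" and g: "generates P y"
  shows "generates P x"
  unfolding generates_def
proof
  note I = is_idealD[OF maxidD(1)[OF P]]
  fix a assume "a \<in> A"
  then obtain h where h: "a - ipoly h y \<in> P" using g by (auto simp: generates_def)
  have "(a - ipoly h y) - (ipoly h x - ipoly h y) \<in> P"
    using I(4)[OF h ipoly_cong[OF maxidD(1)[OF P] x, of h]] .
  then show "\<exists>h. a - ipoly h x \<in> P" by auto
qed

lemma ipoly_mem_cong:
  assumes P: "maxid P" and x: "x \<in> A" "y \<in> A" "x - y \<in> P"
  shows "ipoly h x \<in> P \<longleftrightarrow> ipoly h y \<in> P"
proof -
  note I = is_idealD[OF maxidD(1)[OF P]]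
  have d: "ipoly h x - ipoly h y \<in> P" by (rule ipoly_cong[OF maxidD(1)[OF P] x])
  show ?thesis
  proof
    assume "ipoly h x \<in> P"
    then have "ipoly h x - (ipoly h x - ipoly h y) \<in> P" using d by (rule I(4))
    then show "ipoly h y \<in> P" by simp
  next
    assume "ipoly h y \<in> P"
    with d have "ipoly h x - ipoly h y + ipoly h y \<in> P" by (rule I(3))
    then show "ipoly h x \<in> P" by simp
  qed
qed

text \<open>The Chinese remainder theorem turns residue generators with pairwise different minimal
  polynomials into one generator modulo the Jacobson radical.\<close>

lemma exists_generator_mod_radical:
  assumes num: "p \<ge> 3" "d \<le> 7" and few: "card {P \<in> spec. rdeg P = 1} \<le> p"
  obtains \<eta> where "\<eta> \<in> A" "\<And>a. a \<in> A \<Longrightarrow> \<exists>h. \<forall>P. maxid P \<longrightarrow> a - ipoly h \<eta> \<in> P"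
proof -
  obtain \<gamma> where \<gamma>: "\<And>P. maxid P \<Longrightarrow> \<gamma> P \<in> A" "\<And>P. maxid P \<Longrightarrow> generates P (\<gamma> P)"
    "\<And>P Q. maxid P \<Longrightarrow> maxid Q \<Longrightarrow> P \<noteq> Q \<Longrightarrow> separated P (\<gamma> P) Q (\<gamma> Q)"
    using generates_separated_all[OF assms] by blast
  obtain \<eta> where \<eta>: "\<eta> \<in> A" "\<And>P. maxid P \<Longrightarrow> \<eta> - \<gamma> P \<in> P" using crt[of \<gamma>, OF \<gamma>(1)] by blast
  have gen: "generates P \<eta>" if "maxid P" for P
    using generates_cong[OF that \<eta>(1) \<gamma>(1)[OF that] \<eta>(2)[OF that] \<gamma>(2)[OF that]] .
  have cong: "ipoly h \<eta> \<in> P \<longleftrightarrow> ipoly h (\<gamma> P) \<in> P" if "maxid P" for P h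
    using ipoly_mem_cong[OF that \<eta>(1) \<gamma>(1)[OF that] \<eta>(2)[OF that]] .
  \<comment> \<open>Separating elements must now be polynomials in \<eta>. The inverse of
    \<open>ipoly h \<eta>\<close> modulo \<open>P\<close> can be replaced by one, since \<eta>
    generates \<open>A / P\<close>.\<close>
  have pair: "\<exists>c. ipoly c \<eta> \<in> Q \<and> 1 - ipoly c \<eta> \<in> P" if PQ: "maxid P" "maxid Q" "P \<noteq> Q" for P Q
  proof -
    note IP = is_idealD[OF maxidD(1)[OF PQ(1)]] and IQ = is_idealD[OF maxidD(1)[OF PQ(2)]]
    have "separated Q (\<gamma> Q) P (\<gamma> P)" using \<gamma>(3) PQ by blast
    then obtain h where h: "ipoly h \<eta> \<in> Q" "ipoly h \<eta> \<notin> P"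
      using cong PQ by (auto simp: separated_def)
    obtain y where y: "y \<in> A" "1 - ipoly h \<eta> * y \<in> P"
      using maxidD(4)[OF PQ(1) ipoly_in[OF \<eta>(1)] h(2)] by blast
    obtain k where k: "y - ipoly k \<eta> \<in> P" using gen[OF PQ(1)] y(1) by (auto simp: generates_def)
    have "1 - ipoly (h * k) \<eta> = (1 - ipoly h \<eta> * y) + ipoly h \<eta> * (y - ipoly k \<eta>)"
      by (simp add: ipoly_mult algebra_simps)
    moreover have "ipoly h \<eta> * (y - ipoly k \<eta>) \<in> P" using IP(6) k ipoly_in[OF \<eta>(1)] by blast
    ultimately have "1 - ipoly (h * k) \<eta> \<in> P" using IP(3) y(2) by metis
    moreover have "ipoly (h * k) \<eta> \<in> Q" using IQ(7) h(1) ipoly_in[OF \<eta>(1)] by (simp add: ipoly_mult)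
    ultimately show ?thesis by blast
  qed
  have "\<exists>e. 1 - ipoly e \<eta> \<in> P \<and> (\<forall>Q. maxid Q \<and> Q \<noteq> P \<longrightarrow> ipoly e \<eta> \<in> Q)" if P: "maxid P" for P
  proof -
    have "\<exists>c. maxid Q \<and> Q \<noteq> P \<longrightarrow> ipoly c \<eta> \<in> Q \<and> 1 - ipoly c \<eta> \<in> P" for Q
      using pair[OF P, of Q] by blast
    then obtain c where c: "\<And>Q. maxid Q \<Longrightarrow> Q \<noteq> P \<Longrightarrow> ipoly (c Q) \<eta> \<in> Q \<and> 1 - ipoly (c Q) \<eta> \<in> P" by metis
    define S where "S = spec - {P}"
    have fin: "finite S" using finite_spec by (simp add: S_def)
    have S: "maxid Q \<and> Q \<noteq> P" if "Q \<in> S" for Q using that by (auto simp: S_def spec_iff)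
    have "1 - ipoly (prod c U) \<eta> \<in> P" if "finite U" "U \<subseteq> S" for U
      using that
    proof (induction U)
      case empty
      then show ?case using is_idealD(2)[OF maxidD(1)[OF P]] by (simp add: ipoly_1)
    next
      case (insert Q U)
      then show ?case
        using maxid_one_minus_mult[OF P ipoly_in[OF \<eta>(1)] ipoly_in[OF \<eta>(1)], of "c Q" "prod c U"] c[of Q] S[of Q]
        by (simp add: ipoly_mult)
    qed
    then have "1 - ipoly (prod c S) \<eta> \<in> P" using fin by blast
    moreover have "ipoly (prod c S) \<eta> \<in> Q" if Q: "maxid Q" "Q \<noteq> P" for Q
    proof -
      have "prod c S = c Q * prod c (S - {Q})"
        by (rule prod.remove[OF fin]) (use Q in \<open>simp add: S_def spec_iff\<close>)
      then show ?thesis using is_idealD(7)[OF maxidD(1)[OF Q(1)]] c[OF Q] ipoly_in[OF \<eta>(1)] by (simp add: ipoly_mult)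
    qed
    ultimately show ?thesis by blast
  qed
  then obtain e where e: "\<And>P. maxid P \<Longrightarrow> 1 - ipoly (e P) \<eta> \<in> P"
    "\<And>P Q. maxid P \<Longrightarrow> maxid Q \<Longrightarrow> Q \<noteq> P \<Longrightarrow> ipoly (e P) \<eta> \<in> Q" by metis
  have "\<exists>h. \<forall>P. maxid P \<longrightarrow> a - ipoly h \<eta> \<in> P" if a: "a \<in> A" for a
  proof -
    have "\<exists>k. maxid P \<longrightarrow> a - ipoly k \<eta> \<in> P" for P
      using gen[of P] a by (auto simp: generates_def)
    then obtain k where k: "\<And>P. maxid P \<Longrightarrow> a - ipoly (k P) \<eta> \<in> P" by metis
    define h where "h = (\<Sum>P\<in>spec. k P * e P)"
    have "a - ipoly h \<eta> \<in> P" if P: "maxid P" for P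
    proof -
      note I = is_idealD[OF maxidD(1)[OF P]]
      have "h = k P * e P + (\<Sum>Q\<in>spec - {P}. k Q * e Q)"
        unfolding h_def by (rule sum.remove) (use P finite_spec spec_iff in auto)
      then have eq: "a - ipoly h \<eta> = (a - ipoly (k P) \<eta>) + ipoly (k P) \<eta> * (1 - ipoly (e P) \<eta>)
        - (\<Sum>Q\<in>spec - {P}. ipoly (k Q) \<eta> * ipoly (e Q) \<eta>)"
        by (simp add: ipoly_add ipoly_mult ipoly_sum algebra_simps)
      have "ipoly (k Q) \<eta> * ipoly (e Q) \<eta> \<in> P" if "Q \<in> spec - {P}" for Q
        using that I(6)[OF ipoly_in[OF \<eta>(1)] e(2)[of Q P]] P by (auto simp: spec_iff)
      then have "(\<Sum>Q\<in>spec - {P}. ipoly (k Q) \<eta> * ipoly (e Q) \<eta>) \<in> P" by (rule I(9))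
      moreover have "(a - ipoly (k P) \<eta>) + ipoly (k P) \<eta> * (1 - ipoly (e P) \<eta>) \<in> P"
        using I(3)[OF k[OF P] I(6)[OF ipoly_in[OF \<eta>(1)] e(1)[OF P]]] .
      ultimately show ?thesis unfolding eq by (intro I(4))
    qed
    then show ?thesis by blast
  qed
  then show ?thesis using that \<eta>(1) by blast
qed

text \<open>The binomial formula to first order. At \<open>n = 0\<close> the truncated exponent
  \<open>n - 1\<close> is harmless, its term having the factor 0.\<close>

lemma power_add_expand:
  assumes "a \<in> A" "b \<in> A"
  shows "\<exists>c\<in>A. (a + b) ^ n = a ^ n + of_nat n * a ^ (n - 1) * b + b * b * c"
proof (induction n)
  case 0
  then show ?case using zero_in by force
next
  case (Suc n)
  then obtain c where c: "c \<in> A" "(a + b) ^ n = a ^ n + of_nat n * a ^ (n - 1) * b + b * b * c" by blast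
  have e: "of_nat n * a ^ (n - 1) * a = of_nat n * a ^ n" by (cases n) (simp_all add: mult_ac)
  have "(a + b) ^ Suc n = (a + b) * (a ^ n + of_nat n * a ^ (n - 1) * b + b * b * c)" by (simp add: c(2))
  also have "\<dots> = a ^ Suc n + (a ^ n + of_nat n * a ^ (n - 1) * a) * b
      + b * b * (of_nat n * a ^ (n - 1) + (a + b) * c)" by (simp add: algebra_simps)
  also have "\<dots> = a ^ Suc n + of_nat (Suc n) * a ^ (Suc n - 1) * b + b * b * (of_nat n * a ^ (n - 1) + (a + b) * c)"
    unfolding e by (simp add: algebra_simps)
  finally show ?case using c(1) assms by (meson add_in mult_in of_nat_in power_in)
qed

text \<open>The linear term carries the factors \<open>n\<close>, a multiple of \<open>p\<close>,
  and \<open>b\<close>, both in \<open>P\<close>. So \<open>p\<close>-divisible powers do not feel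
  changes by \<open>P\<close> modulo \<open>P ^ 2\<close>, which is
  \<open>princ (gen P * gen P)\<close>.\<close>

lemma power_add_cong:
  assumes P: "maxid P" and a: "a \<in> A" and b: "b \<in> P" and n: "p dvd n"
  shows "(a + b) ^ n - a ^ n \<in> princ (gen P * gen P)"
proof -
  note I = is_idealD[OF maxidD(1)[OF P]]
  have G: "is_ideal (princ (gen P * gen P))" using princ_ideal gen(4)[OF P] mult_in by blast
  note IG = is_idealD[OF G]
  obtain y where y: "y \<in> A" "b = gen P * y" using b gen(2)[OF P] by (metis princE)
  obtain z where z: "z \<in> A" "\<pi> = gen P * z" using maxidD(2)[OF P] gen(2)[OF P] by (metis princE)
  obtain k where k: "n = p * k" using n by (auto simp: dvd_def)
  obtain c where c: "c \<in> A" "(a + b) ^ n = a ^ n + of_nat n * a ^ (n - 1) * b + b * b * c"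
    using power_add_expand[OF a, of b n] I(1)[OF b] by blast
  have "(a + b) ^ n - a ^ n = (gen P * gen P) * (z * y * of_nat k * a ^ (n - 1) + y * y * c)"
    unfolding c(2) by (simp add: k z(2) y(2) algebra_simps)
  moreover have "z * y * of_nat k * a ^ (n - 1) + y * y * c \<in> A"
    using z(1) y(1) a c(1) by (meson add_in mult_in of_nat_in power_in)
  ultimately show ?thesis by (simp only: princI)
qed

text \<open>\<open>q = p ^ M\<close> with \<open>M\<close> the product of all residue degrees, so
  that the Frobenius of every residue field divides into \<open>M\<close> evenly.\<close>

lemma exists_uniform_exponent:
  obtains q where "p dvd q" "q > 1" "\<And>a P. a \<in> A \<Longrightarrow> maxid P \<Longrightarrow> a ^ q - a \<in> P"
proof -
  define M where "M = (\<Prod>P\<in>spec. rdeg P)"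
  have M: "M > 0" unfolding M_def using idx_maxid(3) by (intro prod_pos) (auto simp: spec_iff)
  have "a ^ (p ^ M) - a \<in> P" if a: "a \<in> A" and P: "maxid P" for a P
  proof -
    note I = is_idealD[OF maxidD(1)[OF P]]
    have it: "a ^ ((p ^ rdeg P) ^ k) - a \<in> P" for k
    proof (induction k)
      case (Suc k)
      let ?b = "a ^ ((p ^ rdeg P) ^ k)"
      have "?b ^ (p ^ rdeg P) - ?b \<in> P" by (rule fermat_maxid[OF P power_in[OF a]])
      then have "(?b ^ (p ^ rdeg P) - ?b) + (?b - a) \<in> P" using Suc.IH by (rule I(3))
      then show ?case by (simp add: power_mult[symmetric] mult.commute)
    qed (use I(2) in simp)
    have "rdeg P dvd M" unfolding M_def using P finite_spec by (intro dvd_prodI) (auto simp: spec_iff)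
    then obtain k where "M = rdeg P * k" by (auto simp: dvd_def)
    then show ?thesis using it[of k] by (simp add: power_mult)
  qed
  moreover have "p dvd p ^ M" using M by (simp add: dvd_power)
  moreover have "1 < p ^ M" using one_less_power[OF p_gt_1 M] .
  ultimately show ?thesis using that by blast
qed

text \<open>The derivative of \<open>X ^ q - X\<close> is \<open>-1\<close> modulo \<open>p\<close>, so \<open>\<eta>\<close> can be moved inside its class modulo the radical
  until \<open>\<eta> ^ q - \<eta>\<close> generates the radical; then \<open>A = \<int>[\<eta>] + (\<eta> ^ q - \<eta>) A\<close> is iterated.\<close>

theorem exists_generator_mod_pi:
  assumes num: "p \<ge> 3" "d \<le> 7" and few: "card {P \<in> spec. rdeg P = 1} \<le> p"
  obtains \<eta> where "\<eta> \<in> A" "\<And>a. a \<in> A \<Longrightarrow> \<exists>h. a - ipoly h \<eta> \<in> princ \<pi>"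
proof -
  obtain \<eta>0 where \<eta>0: "\<eta>0 \<in> A" "\<And>a. a \<in> A \<Longrightarrow> \<exists>h. \<forall>P. maxid P \<longrightarrow> a - ipoly h \<eta>0 \<in> P"
    using exists_generator_mod_radical[OF assms] by metis
  obtain q where q: "p dvd q" "q > 1" "\<And>a P. a \<in> A \<Longrightarrow> maxid P \<Longrightarrow> a ^ q - a \<in> P"
    using exists_uniform_exponent by metis
  define \<omega> where "\<omega> = (\<Prod>P\<in>spec. gen P)"
  have \<omega>A: "\<omega> \<in> A" unfolding \<omega>_def by (rule prod_in) (simp add: spec_iff gen)
  have \<omega>0: "\<omega> \<noteq> 0" unfolding \<omega>_def using finite_spec gen(1) by (simp add: spec_iff)
  have \<omega>P: "\<exists>u\<in>A. u \<notin> P \<and> \<omega> = gen P * u" if P: "maxid P" for P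
  proof (intro bexI conjI)
    show "\<omega> = gen P * (\<Prod>Q\<in>spec - {P}. gen Q)"
      unfolding \<omega>_def by (rule prod.remove) (use P finite_spec spec_iff in auto)
    show "(\<Prod>Q\<in>spec - {P}. gen Q) \<in> A" by (rule prod_in) (simp add: spec_iff gen)
    have "finite S \<Longrightarrow> S \<subseteq> spec - {P} \<Longrightarrow> (\<Prod>Q\<in>S. gen Q) \<notin> P" for S
    proof (induction S rule: finite_induct)
      case empty
      then show ?case using maxidD(3)[OF P] by simp
    next
      case (insert Q S)
      then have Q: "maxid Q" "P \<noteq> Q" by (auto simp: spec_iff)
      have "(\<Prod>Q\<in>S. gen Q) \<in> A" using insert.prems by (intro prod_in gen(4)) (auto simp: spec_iff)
      then show ?case using insert maxid_prime[OF P gen(4)[OF Q(1)]] gen_notin[OF P Q] by auto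
    qed
    then show "(\<Prod>Q\<in>spec - {P}. gen Q) \<notin> P" using finite_spec by blast
  qed
  let ?w0 = "\<eta>0 ^ q - \<eta>0"
  \<comment> \<open>The shift is switched on exactly where \<open>?w0\<close> vanishes doubly: there
    \<open>\<omega> * x\<close> has order one, elsewhere it lies in \<open>P ^ 2\<close>.\<close>
  obtain x where x: "x \<in> A" "\<And>P. maxid P \<Longrightarrow> x - (if ?w0 \<in> princ (gen P * gen P) then 1 else 0) \<in> P"
    using crt[of "\<lambda>P. if ?w0 \<in> princ (gen P * gen P) then 1 else 0"] zero_in one_in by metis
  define \<eta> where "\<eta> = \<eta>0 + \<omega> * x"
  define w where "w = \<eta> ^ q - \<eta>"
  have \<eta>A: "\<eta> \<in> A" unfolding \<eta>_def using \<eta>0(1) \<omega>A x(1) by (intro add_in mult_in)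
  have wA: "w \<in> A" unfolding w_def using \<eta>A by (intro diff_in power_in)
  have \<omega>xP: "\<omega> * x \<in> P" if P: "maxid P" for P
  proof -
    obtain u where u: "u \<in> A" "\<omega> = gen P * u" using \<omega>P[OF P] by blast
    then have "\<omega> * x = gen P * (u * x)" by (simp add: mult.assoc)
    moreover have "gen P * (u * x) \<in> P"
      using gen(3)[OF P] u(1) x(1) is_idealD(7)[OF maxidD(1)[OF P]] mult_in by blast
    ultimately show ?thesis by (simp only:)
  qed
  \<comment> \<open>Modulo \<open>P ^ 2\<close>, \<open>w\<close> equals
    \<open>?w0 - \<omega> * x\<close>, and exactly one of these two terms is not in
    \<open>P ^ 2\<close>.\<close>
  have w2: "w \<notin> princ (gen P * gen P)" if P: "maxid P" for P
  proof
    assume w: "w \<in> princ (gen P * gen P)"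
    note I = is_idealD[OF maxidD(1)[OF P]]
    have G: "is_ideal (princ (gen P * gen P))" using princ_ideal gen(4)[OF P] mult_in by blast
    note IG = is_idealD[OF G]
    obtain u where u: "u \<in> A" "u \<notin> P" "\<omega> = gen P * u" using \<omega>P[OF P] by blast
    have "\<eta> ^ q - \<eta>0 ^ q \<in> princ (gen P * gen P)"
      unfolding \<eta>_def by (rule power_add_cong[OF P \<eta>0(1) \<omega>xP[OF P] q(1)])
    then have "(\<eta> ^ q - \<eta>0 ^ q) - w \<in> princ (gen P * gen P)" using w by (rule IG(4))
    moreover have "(\<eta> ^ q - \<eta>0 ^ q) - w = \<omega> * x - ?w0" by (simp add: w_def \<eta>_def)
    ultimately have d: "\<omega> * x - ?w0 \<in> princ (gen P * gen P)" by simp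
    show False
    proof (cases "?w0 \<in> princ (gen P * gen P)")
      case True
      have "\<omega> * x - ?w0 + ?w0 \<in> princ (gen P * gen P)" using d True by (rule IG(3))
      then have "gen P * (u * x) \<in> princ (gen P * gen P)" by (simp add: u(3) mult.assoc)
      then obtain t where t: "t \<in> A" "gen P * (u * x) = gen P * gen P * t" by (rule princE)
      then have "u * x = gen P * t" using gen(1)[OF P] by simp
      then have "u * x \<in> P" using gen(3)[OF P] t(1) I(7) by simp
      then have "x \<in> P" using maxid_prime[OF P u(1) x(1)] u(2) by blast
      moreover have "x - 1 \<in> P" using x(2)[OF P] True by simp
      ultimately have "x - (x - 1) \<in> P" by (rule I(4))
      then show False using maxidD(3)[OF P] by simp
    next
      case False
      then have "x \<in> P" using x(2)[OF P] by simp
      then obtain t where t: "t \<in> A" "x = gen P * t" using gen(2)[OF P] by (metis princE)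
      have "\<omega> * x = gen P * gen P * (u * t)" by (simp add: u(3) t(2) mult_ac)
      then have "\<omega> * x \<in> princ (gen P * gen P)" using princI mult_in u(1) t(1) by metis
      then have "\<omega> * x - (\<omega> * x - ?w0) \<in> princ (gen P * gen P)" using d by (rule IG(4))
      then show False using False by simp
    qed
  qed
  have wP: "w \<in> P" if P: "maxid P" for P unfolding w_def by (rule q(3)[OF \<eta>A P])
  have valw: "w \<noteq> 0 \<and> val P w = 1" if P: "maxid P" for P
  proof -
    have w0: "w \<noteq> 0" using w2[OF P] is_idealD(2)[OF princ_ideal[OF mult_in[OF gen(4)[OF P] gen(4)[OF P]]]] by auto
    have "val P w > 0" using val_pos[OF P wP[OF P] w0] .
    moreover have "\<not> 2 \<le> val P w" using w2[OF P] val_ge_iff[OF P wA w0, of 2] by (simp add: power2_eq_square)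
    ultimately show ?thesis using w0 by simp
  qed
  have gen: "\<exists>h b. b \<in> A \<and> a = ipoly h \<eta> + w * b" if a: "a \<in> A" for a
  proof -
    obtain h where h: "\<And>P. maxid P \<Longrightarrow> a - ipoly h \<eta>0 \<in> P" using \<eta>0(2)[OF a] by blast
    have all: "a - ipoly h \<eta> \<in> P" if P: "maxid P" for P
    proof -
      note I = is_idealD[OF maxidD(1)[OF P]]
      have "\<eta> - \<eta>0 \<in> P" using \<omega>xP[OF P] by (simp add: \<eta>_def)
      then have "ipoly h \<eta> - ipoly h \<eta>0 \<in> P" by (rule ipoly_cong[OF maxidD(1)[OF P] \<eta>A \<eta>0(1)])
      then have "(a - ipoly h \<eta>0) - (ipoly h \<eta> - ipoly h \<eta>0) \<in> P" by (rule I(4)[OF h[OF P]])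
      then show ?thesis by simp
    qed
    have "\<exists>b\<in>A. a - ipoly h \<eta> = w * b"
    proof (cases "\<exists>P. maxid P")
      case True
      then have "w \<noteq> 0" using valw by blast
      have "a - ipoly h \<eta> \<in> princ w"
      proof (rule val_dvd[OF diff_in[OF a ipoly_in[OF \<eta>A]] wA \<open>w \<noteq> 0\<close>])
        fix P assume P: "maxid P"
        show "a - ipoly h \<eta> = 0 \<or> val P w \<le> val P (a - ipoly h \<eta>)"
        proof (cases "a - ipoly h \<eta> = 0")
          case False
          then have "0 < val P (a - ipoly h \<eta>)" by (rule val_pos[OF P all[OF P]])
          then have "val P w \<le> val P (a - ipoly h \<eta>)" using valw[OF P] by linarith
          then show ?thesis ..
        qed simp
      qed
      then show ?thesis by (auto elim: princE)
    next
      case False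
      \<comment> \<open>Without maximal ideals \<pi> would be a unit, which \<open>p_nonunit\<close>
        excludes.\<close>
      have "1 \<in> princ \<pi>"
        by (rule ideal_eq_A[OF princ_ideal[OF of_nat_in] self_in_princ pi_nonzero]) (use False in blast)
      then show ?thesis using p_nonunit pi_nonzero princ_iff[of \<pi> 1] by (simp add: inverse_eq_divide)
    qed
    then obtain b where b: "b \<in> A" "a - ipoly h \<eta> = w * b" by blast
    have "a = ipoly h \<eta> + w * b" unfolding b(2)[symmetric] by simp
    then show ?thesis using b(1) by blast
  qed
  have w_ipoly: "w = ipoly (Polynomial.monom 1 q - Polynomial.monom 1 1) \<eta>"
    by (simp add: w_def ipoly_diff ipoly_monom poly_monom)
  have iter: "\<exists>h b. b \<in> A \<and> a = ipoly h \<eta> + w ^ n * b" if a: "a \<in> A" for a n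
  proof (induction n)
    case 0
    then show ?case using a by (intro exI[of _ 0] exI[of _ a]) (simp add: ipoly_0)
  next
    case (Suc n)
    then obtain h b where hb: "b \<in> A" "a = ipoly h \<eta> + w ^ n * b" by blast
    obtain k c where kc: "c \<in> A" "b = ipoly k \<eta> + w * c" using gen[OF hb(1)] by blast
    let ?W = "Polynomial.monom 1 q - Polynomial.monom 1 1"
    have "a = (ipoly h \<eta> + w ^ n * ipoly k \<eta>) + w ^ Suc n * c" unfolding hb(2) kc(2) by (simp add: algebra_simps)
    also have "ipoly h \<eta> + w ^ n * ipoly k \<eta> = ipoly (h + ?W ^ n * k) \<eta>"
      by (simp only: ipoly_add ipoly_mult ipoly_power w_ipoly)
    finally show ?case using kc(1) by blast
  qed
  \<comment> \<open>\<open>w\<close> has valuation 1 everywhere and \<pi> at most \<open>d\<close>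
    by the fundamental identity, so \<open>d\<close> rounds of the iteration reach
    \<open>princ \<pi>\<close>.\<close>
  have "w ^ d \<in> princ \<pi>"
  proof (rule val_dvd[OF power_in[OF wA] of_nat_in pi_nonzero])
    fix P assume P: "maxid P"
    have "val P \<pi> \<le> rdeg P * val P \<pi>" using idx_maxid(3)[OF P] by simp
    also have "\<dots> \<le> (\<Sum>P\<in>spec. rdeg P * val P \<pi>)"
      using P finite_spec by (intro member_le_sum) (auto simp: spec_iff)
    finally have "val P \<pi> \<le> d" using sum_val_pi by simp
    then show "w ^ d = 0 \<or> val P \<pi> \<le> val P (w ^ d)"
      using val_power[OF P wA] valw[OF P] by simp
  qed
  have "\<exists>h. a - ipoly h \<eta> \<in> princ \<pi>" if a: "a \<in> A" for a
  proof -
    obtain h b where hb: "b \<in> A" "a = ipoly h \<eta> + w ^ d * b" using iter[OF a, of d] by blast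
    then have "a - ipoly h \<eta> \<in> princ \<pi>"
      using is_idealD(7)[OF princ_ideal[OF of_nat_in, of p] hb(1) \<open>w ^ d \<in> princ \<pi>\<close>] by simp
    then show ?thesis by blast
  qed
  then show ?thesis using that \<eta>A by blast
qed

text \<open>A nontrivial relation could be made monic of degree below \<open>d\<close>; then the
  powers of \<eta> would yield fewer than the \<open>p ^ d\<close> classes modulo \<pi>.\<close>

lemma generator_independent:
  assumes \<eta>: "\<eta> \<in> A" "\<And>a. a \<in> A \<Longrightarrow> \<exists>h. a - ipoly h \<eta> \<in> princ \<pi>"
    and h: "degree h < d" "ipoly h \<eta> \<in> princ \<pi>"
  shows "int p dvd Polynomial.coeff h i"
proof (rule ccontr)
  assume nd: "\<not> int p dvd Polynomial.coeff h i"
  note I = princ_ideal[OF of_nat_in, of p] self_in_princ[of \<pi>]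
  obtain g :: "int poly" where g: "lead_coeff g = 1" "degree g \<le> degree h" "ipoly g \<eta> \<in> princ \<pi>"
    using exists_monic[OF I \<eta>(1) h(2) nd] by blast
  have "{a \<in> A. \<exists>h. a - ipoly h \<eta> \<in> princ \<pi>} = A" using \<eta>(2) by blast
  then have "p ^ d \<le> p ^ degree g"
    using idx_adjoin_le[OF I \<eta>(1) g(1,3)] nrm_pi by (simp add: nrm_def)
  then show False using h(1) g(2) p_gt_1 by simp
qed

end

section \<open>Primes of degree one in trinomial extensions\<close>

lemma dvd_eliminate:
  fixes w a :: int
  assumes "d dvd x1 * w + y1 * a" "d dvd x2 * w + y2 * a"
  shows "d dvd (x2 * y1 - x1 * y2) * a"
proof -
  have "d dvd x2 * (x1 * w + y1 * a) - x1 * (x2 * w + y2 * a)" using assms by (intro dvd_diff dvd_mult)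
  then show ?thesis by (simp add: algebra_simps)
qed

lemma dvd_reduce:
  fixes x y a w d :: int
  shows "d dvd x * w + y * a \<longleftrightarrow> d dvd (x mod d) * w + (y mod d) * a"
proof -
  have "x * w + y * a = (d * (x div d) + x mod d) * w + (d * (y div d) + y mod d) * a" by simp
  also have "\<dots> = d * ((x div d) * w + (y div d) * a) + ((x mod d) * w + (y mod d) * a)"
    by (simp only: algebra_simps)
  finally show ?thesis by (simp only: dvd_add_right_iff[OF dvd_triv_left])
qed

text \<open>Differences of values cancel \<open>b\<close> and leave linear conditions on
  \<open>a\<close> modulo 9. At 1, 4, 7 they demand residues 7 and 1 for \<open>a\<close>; at 2, 5,
  8 they demand 4 and 1.\<close>

lemma trinomial_27:
  fixes a b :: int
  defines "G \<equiv> \<lambda>m. m ^ 7 + a * m ^ 5 + b"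
  shows "\<not> 27 dvd G 1 \<or> \<not> 27 dvd G 4 \<or> \<not> 27 dvd G 7"
    and "\<not> 27 dvd G 2 \<or> \<not> 27 dvd G 5 \<or> \<not> 27 dvd G 8"
proof -
  have diff: "27 dvd (n ^ 7 - m ^ 7) + (n ^ 5 - m ^ 5) * a" if "27 dvd G m" "27 dvd G n" for m n
    using dvd_diff[OF that(2,1)] by (simp add: G_def algebra_simps)
  show "\<not> 27 dvd G 1 \<or> \<not> 27 dvd G 4 \<or> \<not> 27 dvd G 7"
  proof (rule ccontr)
    assume "\<not> ?thesis"
    then have h: "27 dvd G 1" "27 dvd G 4" "27 dvd G 7" by blast+
    have d1: "27 dvd 16383 + 1023 * a" using diff[OF h(1) h(2)] by simp
    have e1: "27 dvd 21 + 24 * a" using d1 dvd_reduce[of 27 16383 1 1023 a] by simp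
    have d2: "27 dvd 823542 + 16806 * a" using diff[OF h(1) h(3)] by simp
    have e2: "27 dvd 15 + 12 * a" using d2 dvd_reduce[of 27 823542 1 16806 a] by simp
    have f1: "9 dvd 7 + 8 * a" using e1 by presburger
    have f2: "9 dvd 5 + 4 * a" using e2 by presburger
    show False using f1 f2 by presburger
  qed
  show "\<not> 27 dvd G 2 \<or> \<not> 27 dvd G 5 \<or> \<not> 27 dvd G 8"
  proof (rule ccontr)
    assume "\<not> ?thesis"
    then have h: "27 dvd G 2" "27 dvd G 5" "27 dvd G 8" by blast+
    have d1: "27 dvd 77997 + 3093 * a" using diff[OF h(1) h(2)] by simp
    have e1: "27 dvd 21 + 15 * a" using d1 dvd_reduce[of 27 77997 1 3093 a] by simp
    have d2: "27 dvd 2097024 + 32736 * a" using diff[OF h(1) h(3)] by simp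
    have e2: "27 dvd 15 + 12 * a" using d2 dvd_reduce[of 27 2097024 1 32736 a] by simp
    have f1: "9 dvd 7 + 5 * a" using e1 by presburger
    have f2: "9 dvd 5 + 4 * a" using e2 by presburger
    show False using f1 f2 by presburger
  qed
qed

text \<open>Fifth powers of numbers congruent modulo 5 agree modulo 25, so \<open>a\<close> drops
  out of the difference, whereas the seventh powers here differ modulo 25.\<close>

lemma trinomial_25:
  fixes a b :: int
  defines "G \<equiv> \<lambda>m. m ^ 7 + a * m ^ 5 + b"
  shows "\<not> 25 dvd G 1 \<or> \<not> 25 dvd G 6" "\<not> 25 dvd G 2 \<or> \<not> 25 dvd G 7"
    "\<not> 25 dvd G 3 \<or> \<not> 25 dvd G 8" "\<not> 25 dvd G 4 \<or> \<not> 25 dvd G 9"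
proof -
  have diff: "25 dvd (n ^ 7 - m ^ 7) + (n ^ 5 - m ^ 5) * a" if "25 dvd G m" "25 dvd G n" for m n
    using dvd_diff[OF that(2,1)] by (simp add: G_def algebra_simps)
  show "\<not> 25 dvd G 1 \<or> \<not> 25 dvd G 6"
  proof (rule ccontr)
    assume "\<not> ?thesis"
    then have h: "25 dvd G 1" "25 dvd G 6" by blast+
    have d1: "25 dvd 279935 + 7775 * a" using diff[OF h(1) h(2)] by simp
    have e1: "25 dvd 10 + 0 * a" using d1 dvd_reduce[of 25 279935 1 7775 a] by simp
    show False using e1 by presburger
  qed
  show "\<not> 25 dvd G 2 \<or> \<not> 25 dvd G 7"
  proof (rule ccontr)
    assume "\<not> ?thesis"
    then have h: "25 dvd G 2" "25 dvd G 7" by blast+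
    have d1: "25 dvd 823415 + 16775 * a" using diff[OF h(1) h(2)] by simp
    have e1: "25 dvd 15 + 0 * a" using d1 dvd_reduce[of 25 823415 1 16775 a] by simp
    show False using e1 by presburger
  qed
  show "\<not> 25 dvd G 3 \<or> \<not> 25 dvd G 8"
  proof (rule ccontr)
    assume "\<not> ?thesis"
    then have h: "25 dvd G 3" "25 dvd G 8" by blast+
    have d1: "25 dvd 2094965 + 32525 * a" using diff[OF h(1) h(2)] by simp
    have e1: "25 dvd 15 + 0 * a" using d1 dvd_reduce[of 25 2094965 1 32525 a] by simp
    show False using e1 by presburger
  qed
  show "\<not> 25 dvd G 4 \<or> \<not> 25 dvd G 9"
  proof (rule ccontr)
    assume "\<not> ?thesis"
    then have h: "25 dvd G 4" "25 dvd G 9" by blast+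
    have d1: "25 dvd 4766585 + 58025 * a" using diff[OF h(1) h(2)] by simp
    have e1: "25 dvd 10 + 0 * a" using d1 dvd_reduce[of 25 4766585 1 58025 a] by simp
    show False using e1 by presburger
  qed
qed

text \<open>Between the two lifts the change of the \<open>w\<close>-term is divisible by 9, while
  \<open>n ^ 5 - m ^ 5\<close> is divisible by 3 only once, so 3 would divide
  \<open>a\<close>.\<close>

lemma trinomial_9:
  fixes a b w :: int
  defines "H \<equiv> \<lambda>m. 3 * w * m ^ 7 + a * m ^ 5 + b"
  assumes "\<not> 3 dvd a"
  shows "\<not> 9 dvd H 1 \<or> \<not> 9 dvd H 4" "\<not> 9 dvd H 2 \<or> \<not> 9 dvd H 5"
proof -
  have diff: "9 dvd 3 * (n ^ 7 - m ^ 7) * w + (n ^ 5 - m ^ 5) * a" if "9 dvd H m" "9 dvd H n" for m n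
    using dvd_diff[OF that(2,1)] by (simp add: H_def algebra_simps)
  show "\<not> 9 dvd H 1 \<or> \<not> 9 dvd H 4"
  proof (rule ccontr)
    assume "\<not> ?thesis"
    then have h: "9 dvd H 1" "9 dvd H 4" by blast+
    have d1: "9 dvd 49149 * w + 1023 * a" using diff[OF h(1) h(2)] by simp
    have e1: "9 dvd 6 * a" using d1 dvd_reduce[of 9 49149 w 1023 a] by simp
    show False using e1 assms(2) by presburger
  qed
  show "\<not> 9 dvd H 2 \<or> \<not> 9 dvd H 5"
  proof (rule ccontr)
    assume "\<not> ?thesis"
    then have h: "9 dvd H 2" "9 dvd H 5" by blast+
    have d1: "9 dvd 233991 * w + 3093 * a" using diff[OF h(1) h(2)] by simp
    have e1: "9 dvd 6 * a" using d1 dvd_reduce[of 9 233991 w 3093 a] by simp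
    show False using e1 assms(2) by presburger
  qed
qed

text \<open>The condition from two lifts can be solved for \<open>w\<close>, hence three lifts.
  After division by 25 their differences are two linear relations between \<open>w\<close> and
  \<open>a\<close> modulo 25; eliminating \<open>w\<close> leaves a multiple of \<open>a\<close>
  whose coefficient contains 5 only once.\<close>

lemma trinomial_625:
  fixes a b w :: int
  defines "H \<equiv> \<lambda>m. 5 * w * m ^ 7 + a * m ^ 5 + b"
  assumes a: "\<not> 5 dvd a"
  shows "\<not> 625 dvd H 1 \<or> \<not> 625 dvd H 6 \<or> \<not> 625 dvd H 11"
    "\<not> 625 dvd H 2 \<or> \<not> 625 dvd H 7 \<or> \<not> 625 dvd H 12"
    "\<not> 625 dvd H 3 \<or> \<not> 625 dvd H 8 \<or> \<not> 625 dvd H 13"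
    "\<not> 625 dvd H 4 \<or> \<not> 625 dvd H 9 \<or> \<not> 625 dvd H 14"
proof -
  have diff: "25 dvd x * w + y * a"
    if "625 dvd H m" "625 dvd H n" "5 * (n ^ 7 - m ^ 7) = 25 * x" "n ^ 5 - m ^ 5 = 25 * y" for m n x y
  proof -
    have "H n - H m = (5 * (n ^ 7 - m ^ 7)) * w + (n ^ 5 - m ^ 5) * a" by (simp add: H_def algebra_simps)
    also have "\<dots> = 25 * (x * w + y * a)" unfolding that(3,4) by (simp add: algebra_simps)
    finally have "H n - H m = 25 * (x * w + y * a)" .
    then have "625 dvd 25 * (x * w + y * a)" using dvd_diff[OF that(2,1)] by simp
    then have "25 * 25 dvd 25 * (x * w + y * a)" by simp
    then show ?thesis unfolding dvd_mult_cancel_left by simp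
  qed
  have elim: False if "625 dvd H m" "625 dvd H n" "625 dvd H k"
    "5 * (n ^ 7 - m ^ 7) = 25 * x1" "n ^ 5 - m ^ 5 = 25 * y1"
    "5 * (k ^ 7 - m ^ 7) = 25 * x2" "k ^ 5 - m ^ 5 = 25 * y2"
    "(x2 * y1 - x1 * y2) mod 25 \<in> {5,10,15,20}" for m n k x1 y1 x2 y2
  proof -
    have "25 dvd (x2 * y1 - x1 * y2) * a"
      by (rule dvd_eliminate[OF diff[OF that(1,2,4,5)] diff[OF that(1,3,6,7)]])
    then have "25 dvd ((x2 * y1 - x1 * y2) mod 25) * a" by (simp only: dvd_eq_mod_eq_0 mod_mult_left_eq)
    moreover have "(x2 * y1 - x1 * y2) mod 25 = 5 \<or> (x2 * y1 - x1 * y2) mod 25 = 10 \<or>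
        (x2 * y1 - x1 * y2) mod 25 = 15 \<or> (x2 * y1 - x1 * y2) mod 25 = 20"
      using that(8) by blast
    ultimately have "25 dvd 5 * a \<or> 25 dvd 10 * a \<or> 25 dvd 15 * a \<or> 25 dvd 20 * a" by auto
    then show False using a by (elim disjE) presburger+
  qed
  \<comment> \<open>Here and below the large numbers are \<open>(n ^ 7 - m ^ 7) / 5\<close> and
    \<open>(n ^ 5 - m ^ 5) / 25\<close>, followed by the same with \<open>k\<close> for
    \<open>n\<close>.\<close>
  show "\<not> 625 dvd H 1 \<or> \<not> 625 dvd H 6 \<or> \<not> 625 dvd H 11"
    using elim[of 1 6 11 55987 311 3897434 6442, simplified] by blast
  show "\<not> 625 dvd H 2 \<or> \<not> 625 dvd H 7 \<or> \<not> 625 dvd H 12"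
    using elim[of 2 7 12 164683 671 7166336 9952, simplified] by blast
  show "\<not> 625 dvd H 3 \<or> \<not> 625 dvd H 8 \<or> \<not> 625 dvd H 13"
    using elim[of 3 8 13 418993 1301 12549266 14842, simplified] by blast
  show "\<not> 625 dvd H 4 \<or> \<not> 625 dvd H 9 \<or> \<not> 625 dvd H 14"
    using elim[of 4 9 14 953317 2321 21079424 21472, simplified] by blast
qed

text \<open>Both exponents are odd and 2 is -1 modulo 3, so the two values add up to
  \<open>2 * b\<close> modulo 3.\<close>

lemma trinomial_3:
  fixes a b w :: int
  assumes "\<not> 3 dvd b"
  shows "\<not> 3 dvd (w * 1 ^ 7 + a * 1 ^ 5 + b) \<or> \<not> 3 dvd (w * 2 ^ 7 + a * 2 ^ 5 + b)"
proof (rule ccontr)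
  assume "\<not> ?thesis"
  then have "3 dvd (w * 1 ^ 7 + a * 1 ^ 5 + b)" "3 dvd (w * 2 ^ 7 + a * 2 ^ 5 + b)" by blast+
  then have "3 dvd (w * 1 ^ 7 + a * 1 ^ 5 + b) + (w * 2 ^ 7 + a * 2 ^ 5 + b)" by (rule dvd_add)
  also have "(w * 1 ^ 7 + a * 1 ^ 5 + b) + (w * 2 ^ 7 + a * 2 ^ 5 + b) = 3 * (43 * w + 11 * a) + 2 * b" by simp
  finally have "3 dvd 2 * b" by (simp only: dvd_add_right_iff[OF dvd_triv_left])
  then show False using assms by presburger
qed

text \<open>Modulo 5 the \<open>x ^ 7\<close> term of the rescaled trinomial is gone and what
  remains is linear in \<open>m ^ 5\<close>, so at most one residue class can be a root.\<close>

lemma trinomial_5: fixes a b :: int assumes a: "\<not> 5 dvd a" and m: "\<not> 5 dvd n ^ 5 - m ^ 5"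
  shows "\<not> (5 dvd a * m ^ 5 + b \<and> 5 dvd a * n ^ 5 + b)"
proof
  assume h: "5 dvd a * m ^ 5 + b \<and> 5 dvd a * n ^ 5 + b"
  have "5 dvd (a * n ^ 5 + b) - (a * m ^ 5 + b)" using h by (intro dvd_diff) auto
  then have "5 dvd a * (n ^ 5 - m ^ 5)" by (simp add: algebra_simps)
  then show False using a m prime_dvd_mult_iff[of "5::int" a] by simp
qed
context semilocal
begin

abbreviation vp :: "int \<Rightarrow> nat" where "vp \<equiv> multiplicity (int p)"

lemma vp_times_power: "x \<noteq> 0 \<Longrightarrow> vp (int p ^ n * x) = n + vp x"
proof -
  assume "x \<noteq> 0"
  have pe: "prime_elem (int p)" using p_prime by (simp add: prime_imp_prime_elem)
  have "vp (int p ^ n * x) = vp (int p ^ n) + vp x"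
    using pe \<open>x \<noteq> 0\<close> p_gt_1 by (intro prime_elem_multiplicity_mult_distrib) auto
  also have "vp (int p ^ n) = n" using pe by (simp add: prime_elem_def multiplicity_same_power)
  finally show ?thesis .
qed

lemma vp_less: "x \<noteq> 0 \<Longrightarrow> \<not> int p ^ n dvd x \<Longrightarrow> vp x < n"
  using power_dvd_iff_le_multiplicity[of x "int p" n] p_gt_1 by (simp add: not_le)

lemma vp_decomp:
  assumes "x \<noteq> 0"
  obtains y where "x = int p ^ vp x * y" "\<not> int p dvd y" "y \<noteq> 0"
proof -
  have np: "\<not> is_unit (int p)" using p_gt_1 by simp
  obtain y where "x = int p ^ vp x * y" "\<not> int p dvd y" using multiplicity_decompose'[OF assms np] by metis
  then show ?thesis using that assms by (metis mult_zero_right)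
qed

lemma sum_rdeg_val_pi_subset:
  assumes "S \<subseteq> spec"
  shows "card {P \<in> S. rdeg P = 1} \<le> (\<Sum>P\<in>S. rdeg P * val P \<pi>)"
proof -
  have fin: "finite S" using assms finite_spec finite_subset by blast
  have "card {P \<in> S. rdeg P = 1} = (\<Sum>P\<in>{P \<in> S. rdeg P = 1}. 1)" by simp
  also have "\<dots> \<le> (\<Sum>P\<in>{P \<in> S. rdeg P = 1}. rdeg P * val P \<pi>)"
    using assms val_pi_pos by (intro sum_mono) (auto simp: spec_iff Suc_leI)
  also have "\<dots> \<le> (\<Sum>P\<in>S. rdeg P * val P \<pi>)" using fin by (intro sum_mono2) auto
  finally show ?thesis .
qed

text \<open>A single ideal whose ramification index is a multiple of \<open>n\<close> already
  exhausts the whole sum.\<close>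

lemma ramified_card_le_1:
  assumes S: "S \<subseteq> spec" and n: "n > 0" and sum: "(\<Sum>P\<in>S. rdeg P * val P \<pi>) \<le> n"
    and dvd: "\<And>P. P \<in> S \<Longrightarrow> n dvd val P \<pi>"
  shows "card S \<le> 1"
proof -
  have fin: "finite S" using S finite_spec finite_subset by blast
  have "card S * n = (\<Sum>P\<in>S. n)" by simp
  also have "\<dots> \<le> (\<Sum>P\<in>S. rdeg P * val P \<pi>)"
  proof (rule sum_mono)
    fix P assume P: "P \<in> S"
    then have "maxid P" using S by (auto simp: spec_iff)
    then have "n \<le> val P \<pi>" "1 \<le> rdeg P" using dvd[OF P] val_pi_pos idx_maxid(3) by (auto intro: dvd_imp_le simp: Suc_leI)
    then show "n \<le> rdeg P * val P \<pi>" using mult_le_mono[of 1 "rdeg P" n "val P \<pi>"] by simp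
  qed
  finally have "card S * n \<le> 1 * n" unfolding mult_1 using sum by (rule le_trans)
  then show ?thesis using n unfolding mult_le_cancel2 by blast
qed

section \<open>Valuations of a root \<theta>, known through the norms of
  \<open>\<theta> - m\<close>\<close>

context
  fixes \<theta> :: 'a and a b :: int
  assumes \<theta>A: "\<theta> \<in> A" and \<theta>_root: "\<theta> ^ 7 + of_int a * \<theta> ^ 5 + of_int b = 0"
    and a0: "a \<noteq> 0" and b0: "b \<noteq> 0" and d7: "d = 7"
    and F0: "\<And>m::int. m ^ 7 + a * m ^ 5 + b \<noteq> 0"
    and nrm_F: "\<And>m::int. nrm (\<theta> - of_int m) = p ^ vp (m ^ 7 + a * m ^ 5 + b)"
begin

lemma \<theta>_minus_in: "\<theta> - of_int m \<in> A" by (intro diff_in \<theta>A of_int_in)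

lemma \<theta>_minus_nonzero: "\<theta> - of_int m \<noteq> 0"
proof
  assume "\<theta> - of_int m = 0"
  then have "\<theta> = of_int m" by simp
  then have "of_int (m ^ 7 + a * m ^ 5 + b) = (0::'a)" using \<theta>_root by simp
  then show False using F0 by (simp only: of_int_eq_0_iff)
qed

lemma \<theta>_nonzero: "\<theta> \<noteq> 0" using \<theta>_minus_nonzero[of 0] by simp

lemma sum_val_\<theta>_minus:
  "(\<Sum>P\<in>spec. rdeg P * val P (\<theta> - of_int m)) = vp (m ^ 7 + a * m ^ 5 + b)"
  by (rule sum_val_eq[OF \<theta>_minus_in \<theta>_minus_nonzero nrm_F])

lemma sum_val_\<theta>: "(\<Sum>P\<in>spec. rdeg P * val P \<theta>) = vp b"
  using sum_val_\<theta>_minus[of 0] by simp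

text \<open>The ultrametric inequality for \<open>\<theta> ^ 7 + a * \<theta> ^ 5 = - b\<close>: if
  the two terms have different valuations the smaller one is that of \<open>b\<close>, otherwise it
  is only a lower bound. These are the slopes of the Newton polygon, scaled by the ramification
  index.\<close>

lemma val_\<theta>_cases:
  assumes P: "maxid P"
  shows "2 * val P \<theta> < val P \<pi> * vp a \<and> 7 * val P \<theta> = val P \<pi> * vp b \<or>
         2 * val P \<theta> > val P \<pi> * vp a \<and> val P \<pi> * vp a + 5 * val P \<theta> = val P \<pi> * vp b \<or>
         2 * val P \<theta> = val P \<pi> * vp a \<and> 7 * val P \<theta> \<le> val P \<pi> * vp b"
proof -
  let ?x = "\<theta> ^ 7" and ?y = "of_int a * \<theta> ^ 5"
  have xA: "?x \<in> A" "?x \<noteq> 0" using power_in[OF \<theta>A] \<theta>_nonzero by auto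
  have yA: "?y \<in> A" "?y \<noteq> 0" using mult_in[OF of_int_in power_in[OF \<theta>A]] \<theta>_nonzero a0 by auto
  have vx: "val P ?x = 7 * val P \<theta>" by (rule val_power[OF P \<theta>A \<theta>_nonzero])
  have vy: "val P ?y = val P \<pi> * vp a + 5 * val P \<theta>"
    using val_mult[OF P of_int_in _ power_in[OF \<theta>A], of a 5] val_power[OF P \<theta>A \<theta>_nonzero]
      val_of_int[OF P a0] \<theta>_nonzero a0 by simp
  have e: "?x + ?y = - of_int b" using \<theta>_root by (simp add: eq_neg_iff_add_eq_0)
  have vb: "val P (- of_int b) = val P \<pi> * vp b"
    using val_uminus[OF P of_int_in, of b] val_of_int[OF P b0] b0 by simp
  consider "2 * val P \<theta> < val P \<pi> * vp a" | "2 * val P \<theta> > val P \<pi> * vp a" | "2 * val P \<theta> = val P \<pi> * vp a"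
    by linarith
  then show ?thesis
  proof cases
    case 1
    then have "val P (?x + ?y) = val P ?x" using vx vy by (intro val_add_eq(2)[OF P xA yA(1)]) simp
    then show ?thesis using 1 vx vb unfolding e by simp
  next
    case 2
    then have "val P (?y + ?x) = val P ?y" using vx vy by (intro val_add_eq(2)[OF P yA xA(1)]) simp
    then show ?thesis using 2 vy vb e by (simp add: add.commute)
  next
    case 3
    have "7 * val P \<theta> \<le> val P (?x + ?y)"
      by (rule val_add_ge[OF P xA yA]) (use 3 vx vy e b0 in simp_all)
    then show ?thesis using 3 vb unfolding e by simp
  qed
qed

text \<open>The congruence of \<open>\<theta> / p ^ k\<close> with \<open>m\<close> at
  \<open>P\<close>, multiplied through by \<open>p ^ k\<close>, whose valuation is
  \<open>val P \<pi> * k\<close>.\<close>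

definition near :: "nat \<Rightarrow> 'a set \<Rightarrow> int \<Rightarrow> bool" where
  "near k P m \<longleftrightarrow> val P \<pi> * k + 1 \<le> val P (\<theta> - of_int (int p ^ k * m))"

lemma val_p_power_mult:
  assumes P: "maxid P" and c: "c \<noteq> 0"
  shows "val P (of_int (int p ^ k * c)) = val P \<pi> * (k + vp c)"
proof -
  have "int p ^ k * c \<noteq> 0" using c p_gt_1 by simp
  from val_of_int[OF P this] show ?thesis unfolding vp_times_power[OF c] .
qed

text \<open>\<theta> and \<open>p ^ k\<close> have equal valuation, with unit parts \<open>u\<close>
  and \<open>w\<close> at \<open>P\<close>. The quotient of these units reduces to an integer below
  \<open>p\<close>, the residue field having \<open>p\<close> elements.\<close>

lemma near_residue:
  assumes P: "maxid P" "rdeg P = 1" and v: "val P \<theta> = val P \<pi> * k"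
  obtains m where "m < p" "near k P (int m)"
proof -
  note I = is_idealD[OF maxidD(1)[OF P(1)]]
  obtain u where u: "u \<in> A" "u \<notin> P" "\<theta> = gen P ^ val P \<theta> * u"
    using val_decomp[OF P(1) \<theta>A \<theta>_nonzero] by blast
  have pk: "\<pi> ^ k \<in> A" "\<pi> ^ k \<noteq> 0" using power_in[OF of_nat_in] pi_nonzero by auto
  obtain w where w: "w \<in> A" "w \<notin> P" "\<pi> ^ k = gen P ^ val P (\<pi> ^ k) * w"
    using val_decomp[OF P(1) pk] by blast
  have vk: "val P (\<pi> ^ k) = val P \<theta>" using val_power[OF P(1) of_nat_in pi_nonzero] v by simp
  obtain y where y: "y \<in> A" "1 - w * y \<in> P" using maxidD(4)[OF P(1) w(1,2)] by blast
  obtain m where m: "m < p" "u * y - of_nat m \<in> P"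
    using rdeg_1_residue[OF P mult_in[OF u(1) y(1)]] by blast
  have "u - of_nat m * w = u * (1 - w * y) + w * (u * y - of_nat m)" by (simp add: algebra_simps)
  moreover have "u * (1 - w * y) \<in> P" "w * (u * y - of_nat m) \<in> P" using I(6) u(1) w(1) y(2) m(2) by blast+
  ultimately have "u - of_nat m * w \<in> P" using I(3) by metis
  then obtain z where z: "z \<in> A" "u - of_nat m * w = gen P * z" using gen(2)[OF P(1)] by (metis princE)
  have "\<theta> - of_int (int p ^ k * int m) = gen P ^ val P \<theta> * u - (gen P ^ val P \<theta> * w) * of_nat m"
    using u(3) w(3) vk by simp
  also have "\<dots> = gen P ^ val P \<theta> * (u - of_nat m * w)" by (simp add: algebra_simps)
  also have "\<dots> = gen P ^ (val P \<theta> + 1) * z" by (simp add: z(2))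
  finally have "\<theta> - of_int (int p ^ k * int m) \<in> princ (gen P ^ (val P \<theta> + 1))"
    using princI[OF z(1)] by (simp only:)
  then have "near k P (int m)"
    unfolding near_def v[symmetric] val_ge_iff[OF P(1) \<theta>_minus_in \<theta>_minus_nonzero] .
  then show ?thesis using that m(1) by blast
qed

text \<open>The change of \<open>p ^ k * m\<close> has valuation at least
  \<open>val P \<pi> * (k + 1)\<close>. This is what makes the choice of a lift free.\<close>

lemma near_shift:
  assumes P: "maxid P" and n: "near k P m"
  shows "near k P (m + int p * c)"
proof (cases "c = 0")
  case False
  let ?x = "\<theta> - of_int (int p ^ k * m)" and ?z = "of_int (int p ^ Suc k * (- c)) :: 'a"
  have e: "?x + ?z = \<theta> - of_int (int p ^ k * (m + int p * c))" by (simp add: algebra_simps)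
  have "val P ?z = val P \<pi> * (Suc k + vp (- c))" by (rule val_p_power_mult[OF P]) (use False in simp)
  moreover have "val P \<pi> > 0" by (rule val_pi_pos[OF P])
  ultimately have "val P \<pi> * k + 1 \<le> val P ?z" by (simp add: algebra_simps)
  then have "val P \<pi> * k + 1 \<le> val P (?x + ?z)"
    using n False p_gt_1 \<theta>_minus_nonzero unfolding near_def
    by (intro val_add_ge[OF P \<theta>_minus_in \<theta>_minus_nonzero of_int_in]) (simp_all only: e, simp_all)
  then show ?thesis unfolding near_def e .
qed (use n in simp)

text \<open>Each ideal is near some residue below \<open>p\<close>, and nearness depends on the
  residue only, so every class may be counted at its most convenient lift.\<close>

lemma card_le_sum_near:
  assumes S: "S \<subseteq> {P \<in> spec. rdeg P = 1}" and v: "\<And>P. P \<in> S \<Longrightarrow> val P \<theta> = val P \<pi> * k"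
    and bd: "\<And>r. r < p \<Longrightarrow> \<exists>c. card {P \<in> S. near k P (int r + int p * c)} \<le> g r"
  shows "card S \<le> (\<Sum>r<p. g r)"
proof -
  have fin: "finite S" by (rule finite_subset[OF S]) (simp add: finite_spec)
  have "S \<subseteq> (\<Union>r<p. {P \<in> S. near k P (int r)})"
  proof
    fix P assume P: "P \<in> S"
    then have "maxid P" "rdeg P = 1" using S by (auto simp: spec_iff)
    then obtain m where "m < p" "near k P (int m)" using near_residue v[OF P] by blast
    then show "P \<in> (\<Union>r<p. {P \<in> S. near k P (int r)})" using P by blast
  qed
  then have "card S \<le> card (\<Union>r<p. {P \<in> S. near k P (int r)})"
    by (intro card_mono finite_UN_I) (use fin in auto)
  also have "\<dots> \<le> (\<Sum>r<p. card {P \<in> S. near k P (int r)})" by (rule card_UN_le) simp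
  also have "\<dots> \<le> (\<Sum>r<p. g r)"
  proof (rule sum_mono)
    fix r assume "r \<in> {..<p}"
    then obtain c where c: "card {P \<in> S. near k P (int r + int p * c)} \<le> g r" using bd by auto
    have "{P \<in> S. near k P (int r)} \<subseteq> {P \<in> S. near k P (int r + int p * c)}"
      using near_shift S by (auto simp: spec_iff)
    then have "card {P \<in> S. near k P (int r)} \<le> card {P \<in> S. near k P (int r + int p * c)}"
      by (intro card_mono) (use fin in auto)
    then show "card {P \<in> S. near k P (int r)} \<le> g r" using c by simp
  qed
  finally show ?thesis .
qed

text \<open>The weighted sum of the valuations of \<open>\<theta> - p ^ k * m\<close> is known
  exactly. What exceeds the guaranteed \<open>lower\<close> part is a budget from which every near
  ideal of degree one takes at least 1.\<close>

lemma card_near_le: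
  assumes S: "S \<subseteq> {P \<in> spec. rdeg P = 1}"
    and low: "\<And>P. P \<in> spec \<Longrightarrow> lower P \<le> val P (\<theta> - of_int (int p ^ k * m))"
    and near: "\<And>P. P \<in> S \<Longrightarrow> near k P m \<Longrightarrow> lower P + 1 \<le> val P (\<theta> - of_int (int p ^ k * m))"
  shows "(\<Sum>P\<in>spec. rdeg P * lower P) + card {P \<in> S. near k P m}
    \<le> vp ((int p ^ k * m) ^ 7 + a * (int p ^ k * m) ^ 5 + b)"
proof -
  let ?N = "{P \<in> S. near k P m}"
  have "(\<Sum>P\<in>spec. rdeg P * lower P) + card ?N
      = (\<Sum>P\<in>spec. rdeg P * lower P + (if P \<in> ?N then 1 else 0))"
  proof -
    have "(\<Sum>P\<in>spec. if P \<in> ?N then 1 else (0::nat)) = card (spec \<inter> ?N)"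
      using finite_spec by (simp add: sum.If_cases)
    moreover have "spec \<inter> ?N = ?N" using S by auto
    ultimately show ?thesis by (simp only: sum.distrib)
  qed
  also have "\<dots> \<le> (\<Sum>P\<in>spec. rdeg P * val P (\<theta> - of_int (int p ^ k * m)))"
  proof (rule sum_mono)
    fix P assume P: "P \<in> spec"
    show "rdeg P * lower P + (if P \<in> ?N then 1 else 0) \<le> rdeg P * val P (\<theta> - of_int (int p ^ k * m))"
    proof (cases "P \<in> ?N")
      case True
      then have "rdeg P = 1" using S by auto
      then show ?thesis using True near[of P] by auto
    next
      case False
      show ?thesis unfolding if_not_P[OF False] add_0_right by (rule mult_le_mono2[OF low[OF P]])
    qed
  qed
  also have "\<dots> = vp ((int p ^ k * m) ^ 7 + a * (int p ^ k * m) ^ 5 + b)" by (rule sum_val_\<theta>_minus)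
  finally show ?thesis .
qed

lemma val_\<theta>_minus_ge:
  assumes P: "maxid P" and v: "val P \<theta> \<ge> val P \<pi> * k"
  shows "val P \<pi> * k \<le> val P (\<theta> - of_int (int p ^ k * m))"
proof (cases "m = 0")
  case False
  let ?z = "of_int (int p ^ k * (- m)) :: 'a"
  have e: "\<theta> + ?z = \<theta> - of_int (int p ^ k * m)" by simp
  have "val P ?z = val P \<pi> * (k + vp (- m))" by (rule val_p_power_mult[OF P]) (use False in simp)
  then have z: "val P \<pi> * k \<le> val P ?z" by simp
  have "?z \<noteq> 0" using False p_gt_1 by simp
  moreover have "\<theta> + ?z \<noteq> 0" unfolding e by (rule \<theta>_minus_nonzero)
  ultimately have "val P \<pi> * k \<le> val P (\<theta> + ?z)"
    by (intro val_add_ge[OF P \<theta>A \<theta>_nonzero of_int_in _ _ v z])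
  then show ?thesis unfolding e .
qed (use v in simp)

text \<open>The hypothesis \<open>slope\<close> places the point of \<open>a\<close> on or above the
  segment from the constant to the leading term of the Newton polygon, so all ideals share one
  slope.\<close>

lemma few_case_single_slope:
  assumes p: "p = 3 \<or> p = 5" and slope: "2 * vp b \<le> 7 * vp a"
  shows "card {P \<in> spec. rdeg P = 1} \<le> p"
proof -
  let ?D = "{P \<in> spec. rdeg P = 1}"
  have v7: "7 * val P \<theta> = val P \<pi> * vp b" if P: "P \<in> spec" for P
  proof -
    have "2 * (val P \<pi> * vp b) \<le> 7 * (val P \<pi> * vp a)"
      using mult_le_mono2[OF slope, of "val P \<pi>"] by (simp only: mult.left_commute)
    moreover have mP: "maxid P" using P by (simp add: spec_iff)
    ultimately show ?thesis using val_\<theta>_cases[OF mP] by (elim disjE conjE) linarith+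
  qed
  show ?thesis
  proof (cases "7 dvd vp b")
    case False
    have "7 dvd val P \<pi>" if "P \<in> spec" for P
    proof -
      have "7 dvd val P \<pi> * vp b" unfolding v7[OF that, symmetric] by simp
      moreover have "Factorial_Ring.prime (7::nat)" by simp
      ultimately show ?thesis using False by (meson prime_dvd_mult_iff)
    qed
    then have "card spec \<le> 1" using sum_val_pi d7 by (intro ramified_card_le_1[of _ 7]) auto
    moreover have "card ?D \<le> card spec" by (rule card_mono[OF finite_spec]) auto
    ultimately show ?thesis using p by linarith
  next
    case True
    then obtain k where k: "vp b = 7 * k" by (auto simp: dvd_def)
    then have ka: "2 * k \<le> vp a" using slope by simp
    have v: "val P \<theta> = val P \<pi> * k" if "P \<in> spec" for P using v7[OF that] k by simp
    obtain b' where b': "b = int p ^ (7 * k) * b'" "\<not> int p dvd b'" using vp_decomp[OF b0] k by metis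
    have "int p ^ (2 * k) dvd a" using ka multiplicity_dvd'[of "2 * k" "int p" a] by simp
    then obtain a' where a': "a = int p ^ (2 * k) * a'" by (auto simp: dvd_def)
    \<comment> \<open>Rescaling by \<open>p ^ k\<close> gives another monic trinomial, now with
      constant term prime to \<open>p\<close>, so the residue 0 cannot occur.\<close>
    define G where "G m = m ^ 7 + a' * m ^ 5 + b'" for m
    have FG: "(int p ^ k * m) ^ 7 + a * (int p ^ k * m) ^ 5 + b = int p ^ (7 * k) * G m" for m
      unfolding a' b'(1) G_def by (simp add: power_mult_distrib power_mult[symmetric] power_add[symmetric] algebra_simps)
    have G0: "G m \<noteq> 0" for m using F0[of "int p ^ k * m"] FG[of m] by auto
    have count: "card {P \<in> ?D. near k P m} \<le> vp (G m)" for m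
    proof -
      have "(\<Sum>P\<in>spec. rdeg P * (val P \<pi> * k)) + card {P \<in> ?D. near k P m}
          \<le> vp ((int p ^ k * m) ^ 7 + a * (int p ^ k * m) ^ 5 + b)"
      proof (rule card_near_le)
        show "val P \<pi> * k \<le> val P (\<theta> - of_int (int p ^ k * m))" if "P \<in> spec" for P
          using val_\<theta>_minus_ge[of P k m] v[OF that] that by (simp add: spec_iff)
      qed (auto simp: near_def)
      moreover have "(\<Sum>P\<in>spec. rdeg P * (val P \<pi> * k)) = 7 * k"
        using sum_val_pi d7 by (simp add: sum_distrib_right[symmetric] mult.assoc[symmetric])
      ultimately show ?thesis unfolding FG vp_times_power[OF G0] by simp
    qed
    have less: "card {P \<in> ?D. near k P m} < n" if "\<not> int p ^ n dvd G m" for m n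
      using count[of m] vp_less[OF G0 that] by simp
    have main: "card ?D \<le> (\<Sum>r<p. g r)"
      if res: "\<And>r. r < p \<Longrightarrow> \<exists>c. \<not> int p ^ Suc (g r) dvd G (int r + int p * c)" for g
    proof (rule card_le_sum_near)
      fix r assume "r < p"
      then obtain c where "\<not> int p ^ Suc (g r) dvd G (int r + int p * c)" using res by blast
      then show "\<exists>c. card {P \<in> ?D. near k P (int r + int p * c)} \<le> g r"
        using less unfolding less_Suc_eq_le[symmetric] by blast
    qed (use v in auto)
    show ?thesis
    proof (cases "p = 3")
      case True
      have b3: "\<not> 3 dvd b'" using b'(2) True by simp
      have r0: "\<not> 3 dvd G 0" using b3 by (simp add: G_def)
      have r12: "\<not> 3 dvd G 1 \<or> \<not> 3 dvd G 2" using trinomial_3[OF b3, of 1 a'] by (simp add: G_def)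
      have r1: "\<not> 27 dvd G 1 \<or> \<not> 27 dvd G 4 \<or> \<not> 27 dvd G 7"
        and r2: "\<not> 27 dvd G 2 \<or> \<not> 27 dvd G 5 \<or> \<not> 27 dvd G 8"
        unfolding G_def by (rule trinomial_27)+
      \<comment> \<open>A lift not divisible by 27 leaves a budget of 2, and at most one of the
        residues 1 and 2 is a root modulo 3.\<close>
      define g where "g r = (if r = 0 then 0 else if r = (1::nat) then if 3 dvd G 1 then 2 else 0
        else if 3 dvd G 2 then 2 else (0::nat))" for r
      have "card ?D \<le> (\<Sum>r<p. g r)"
      proof (rule main)
        fix r assume "r < p"
        then consider "r = 0" | "r = 1" | "r = 2" using True by linarith
        then show "\<exists>c. \<not> int p ^ Suc (g r) dvd G (int r + int p * c)"
        proof cases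
          case 1
          then show ?thesis using r0 True by (intro exI[of _ 0]) (simp add: g_def)
        next
          case 2
          have "\<exists>c\<in>{0,1,2}. \<not> int p ^ Suc (g 1) dvd G (int 1 + int p * c)"
            using r1 True by (auto simp: g_def)
          then show ?thesis unfolding 2 by blast
        next
          case 3
          have "\<exists>c\<in>{0,1,2}. \<not> int p ^ Suc (g 2) dvd G (int 2 + int p * c)"
            using r2 True by (auto simp: g_def)
          then show ?thesis unfolding 3 by blast
        qed
      qed
      also have "\<dots> \<le> 2" using True r12 by (auto simp: g_def eval_nat_numeral)
      finally show ?thesis using True by simp
    next
      case False
      then have p5: "p = 5" using p by simp
      have b5: "\<not> 5 dvd b'" using b'(2) p5 by simp
      have r0: "\<not> 5 dvd G 0" using b5 by (simp add: G_def)
      have r: "\<not> 25 dvd G 1 \<or> \<not> 25 dvd G 6" "\<not> 25 dvd G 2 \<or> \<not> 25 dvd G 7"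
        "\<not> 25 dvd G 3 \<or> \<not> 25 dvd G 8" "\<not> 25 dvd G 4 \<or> \<not> 25 dvd G 9"
        unfolding G_def by (rule trinomial_25)+
      \<comment> \<open>Each of the four nonzero residues has a lift not divisible by 25, hence a
        budget of 1.\<close>
      have "card ?D \<le> (\<Sum>r<p. if r = 0 then 0 else 1)"
      proof (rule main)
        fix s assume "s < p"
        then consider "s = 0" | "s = 1" | "s = 2" | "s = 3" | "s = 4" using p5 by linarith
        then have "\<exists>c\<in>{0,1}. \<not> int p ^ Suc (if s = 0 then 0 else 1) dvd G (int s + int p * c)"
          using r0 r p5 by cases auto
        then show "\<exists>c. \<not> int p ^ Suc (if s = 0 then 0 else 1) dvd G (int s + int p * c)" by blast
      qed
      also have "\<dots> \<le> 4" using p5 by (simp add: eval_nat_numeral)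
      finally show ?thesis using p5 by simp
    qed
  qed
qed

text \<open>The Newton polygon has a vertex at \<open>a\<close>. On \<open>S2\<close> the terms
  \<open>\<theta> ^ 7\<close> and \<open>a * \<theta> ^ 5\<close> have equal valuation; on
  \<open>S5\<close> the term \<open>a * \<theta> ^ 5\<close> is balanced by \<open>b\<close>. The
  two bounds obtained add up to exactly \<open>p\<close>.\<close>

lemma few_case_two_slopes:
  assumes p: "p = 3 \<or> p = 5" and slope: "2 * vp b > 7 * vp a"
  shows "card {P \<in> spec. rdeg P = 1} \<le> p"
proof -
  let ?D = "{P \<in> spec. rdeg P = 1}"
  define S2 where "S2 = {P \<in> spec. 2 * val P \<theta> = val P \<pi> * vp a}"
  define S5 where "S5 = {P \<in> spec. 2 * val P \<theta> > val P \<pi> * vp a}"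
  have dich: "2 * val P \<theta> = val P \<pi> * vp a \<or>
      2 * val P \<theta> > val P \<pi> * vp a \<and> val P \<pi> * vp a + 5 * val P \<theta> = val P \<pi> * vp b" if P: "P \<in> spec" for P
  proof -
    have mP: "maxid P" using P by (simp add: spec_iff)
    have "7 * (val P \<pi> * vp a) < 2 * (val P \<pi> * vp b)"
      using mult_less_mono2[OF slope val_pi_pos[OF mP]] by (simp only: mult.left_commute)
    with val_\<theta>_cases[OF mP] show ?thesis by (elim disjE conjE) linarith+
  qed
  have split: "spec = S2 \<union> S5" "S2 \<inter> S5 = {}" using dich by (auto simp: S2_def S5_def)
  have fin: "finite S2" "finite S5" using finite_spec by (auto simp: S2_def S5_def)
  have v5: "val P \<pi> * vp a + 5 * val P \<theta> = val P \<pi> * vp b" if "P \<in> S5" for P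
    using dich[of P] that by (auto simp: S5_def)
  define E2 where "E2 = (\<Sum>P\<in>S2. rdeg P * val P \<pi>)"
  define E5 where "E5 = (\<Sum>P\<in>S5. rdeg P * val P \<pi>)"
  have E: "E2 + E5 = 7"
    using sum_val_pi d7 sum.union_disjoint[OF fin split(2), of "\<lambda>P. rdeg P * val P \<pi>"] split(1)
    by (simp add: E2_def E5_def)
  define T2 where "T2 = (\<Sum>P\<in>S2. rdeg P * val P \<theta>)"
  define T5 where "T5 = (\<Sum>P\<in>S5. rdeg P * val P \<theta>)"
  have T: "T2 + T5 = vp b"
    using sum_val_\<theta> sum.union_disjoint[OF fin split(2), of "\<lambda>P. rdeg P * val P \<theta>"] split(1)
    by (simp add: T2_def T5_def)
  have "2 * T2 = (\<Sum>P\<in>S2. rdeg P * (2 * val P \<theta>))" by (simp add: T2_def sum_distrib_left mult_ac)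
  also have "\<dots> = (\<Sum>P\<in>S2. rdeg P * (val P \<pi> * vp a))" by (rule sum.cong) (auto simp: S2_def)
  also have "\<dots> = E2 * vp a" unfolding E2_def sum_distrib_right by (rule sum.cong) (simp_all add: mult_ac)
  finally have T2: "2 * T2 = E2 * vp a" .
  have "E5 * vp a + 5 * T5 = (\<Sum>P\<in>S5. rdeg P * (val P \<pi> * vp a + 5 * val P \<theta>))"
    unfolding E5_def T5_def sum_distrib_left sum_distrib_right sum.distrib[symmetric]
    by (rule sum.cong) (simp_all add: algebra_simps)
  also have "\<dots> = (\<Sum>P\<in>S5. rdeg P * (val P \<pi> * vp b))" using v5 by (intro sum.cong) auto
  also have "\<dots> = E5 * vp b" unfolding E5_def sum_distrib_right by (rule sum.cong) (simp_all add: mult_ac)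
  finally have T5: "E5 * vp a + 5 * T5 = E5 * vp b" .
  \<comment> \<open>The relations for the two parts and the total \<open>vp b\<close> combine to
    \<open>(E5 - 5) * (2 * vp b - 7 * vp a) = 0\<close>, whose second factor is positive by
    \<open>slope\<close>.\<close>
  have E5: "E5 = 5"
  proof -
    have "int E2 + int E5 = 7" using E by linarith
    then have e2: "int E2 = 7 - int E5" by simp
    have "2 * int T2 = int E2 * int (vp a)" using T2 by (metis of_nat_mult of_nat_numeral)
    then have 1: "2 * int T2 = 7 * int (vp a) - int E5 * int (vp a)" unfolding e2 by (simp add: left_diff_distrib)
    have 2: "int E5 * int (vp a) + 5 * int T5 = int E5 * int (vp b)"
      using T5 by (metis of_nat_add of_nat_mult of_nat_numeral)
    have 3: "int T2 + int T5 = int (vp b)" using T by linarith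
    have "(int E5 - 5) * (2 * int (vp b) - 7 * int (vp a))
        = 2 * (int E5 * int (vp b)) - 7 * (int E5 * int (vp a)) - 10 * int (vp b) + 35 * int (vp a)"
      by (simp add: algebra_simps)
    then have "(int E5 - 5) * (2 * int (vp b) - 7 * int (vp a)) = 0" using 1 2 3 by linarith
    then show ?thesis using slope by simp
  qed
  then have E2: "E2 = 2" using E by simp
  have D: "card ?D \<le> card {P \<in> S2. rdeg P = 1} + card {P \<in> S5. rdeg P = 1}"
  proof -
    have "?D = {P \<in> S2. rdeg P = 1} \<union> {P \<in> S5. rdeg P = 1}" using split(1) by auto
    then show ?thesis by (simp only: card_Un_le)
  qed
  have D2: "card {P \<in> S2. rdeg P = 1} \<le> 2"
    using sum_rdeg_val_pi_subset[of S2] E2 unfolding E2_def S2_def by simp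
  have D5: "card {P \<in> S5. rdeg P = 1} \<le> (if p = 3 then 1 else 3)"
  proof (cases "5 dvd vp b - vp a")
    case False
    have "5 dvd val P \<pi>" if P: "P \<in> S5" for P
    proof -
      have "val P \<pi> * (vp b - vp a) = 5 * val P \<theta>" using v5[OF P] by (simp add: diff_mult_distrib2)
      then have "5 dvd val P \<pi> * (vp b - vp a)" by simp
      moreover have "Factorial_Ring.prime (5::nat)" by simp
      ultimately show ?thesis using False by (meson prime_dvd_mult_iff)
    qed
    then have "card S5 \<le> 1" using E5 split(1) by (intro ramified_card_le_1[of _ 5]) (auto simp: E5_def)
    moreover have "card {P \<in> S5. rdeg P = 1} \<le> card S5" by (rule card_mono[OF fin(2)]) auto
    ultimately have "card {P \<in> S5. rdeg P = 1} \<le> 1" by linarith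
    then show ?thesis by (rule le_trans) simp
  next
    case True
    then obtain k where k: "vp b - vp a = 5 * k" by (auto simp: dvd_def)
    then have ba: "vp b = vp a + 5 * k" using slope by simp
    then have k2: "2 * k > vp a" using slope by simp
    \<comment> \<open>The subtraction is exact because \<open>2 * k > vp a\<close>. Setting one
      factor \<open>p\<close> aside shows that \<open>H\<close> reduces to
      \<open>a' * m ^ 5 + b'\<close> modulo \<open>p\<close>.\<close>
    define j where "j = 2 * k - vp a - 1"
    have j: "2 * k = vp a + Suc j" using k2 by (simp add: j_def)
    have v: "val P \<theta> = val P \<pi> * k" if "P \<in> S5" for P
      using v5[OF that] ba by (simp add: distrib_left)
    obtain b' where b': "b = int p ^ vp b * b'" "\<not> int p dvd b'" using vp_decomp[OF b0] by metis
    obtain a' where a': "a = int p ^ vp a * a'" "\<not> int p dvd a'" using vp_decomp[OF a0] by metis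
    define w where "w = int p ^ j"
    define H where "H m = int p * w * m ^ 7 + a' * m ^ 5 + b'" for m
    have FH: "(int p ^ k * m) ^ 7 + a * (int p ^ k * m) ^ 5 + b = int p ^ vp b * H m" for m
    proof -
      have "(int p ^ k) ^ 7 = int p ^ (5 * k + 2 * k)" by (simp add: power_mult[symmetric]) (simp add: mult.commute)
      also have "\<dots> = int p ^ vp b * (int p * w)" unfolding j ba w_def by (simp add: power_add)
      finally have 1: "(int p ^ k) ^ 7 = int p ^ vp b * (int p * w)" .
      have "a * (int p ^ k) ^ 5 = (int p ^ vp a * a') * (int p ^ k) ^ 5" using a'(1) by simp
      also have "\<dots> = int p ^ vp b * a'" unfolding ba by (simp add: power_add power_mult[symmetric] mult.commute)
      finally have 2: "a * (int p ^ k) ^ 5 = int p ^ vp b * a'" .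
      have "(int p ^ k * m) ^ 7 + a * (int p ^ k * m) ^ 5 + b
          = (int p ^ k) ^ 7 * m ^ 7 + (a * (int p ^ k) ^ 5) * m ^ 5 + int p ^ vp b * b'"
        using b'(1) by (simp add: power_mult_distrib)
      then show ?thesis unfolding 1 2 H_def by (simp add: algebra_simps)
    qed
    have H0: "H m \<noteq> 0" for m using F0[of "int p ^ k * m"] FH[of m] by auto
    let ?D5 = "{P \<in> S5. rdeg P = 1}"
    have D5D: "?D5 \<subseteq> ?D" using split(1) by auto
    have count: "card {P \<in> ?D5. near k P m} \<le> vp (H m)" for m
    proof -
      \<comment> \<open>On \<open>S2\<close> the root has smaller valuation than
        \<open>p ^ k * m\<close>, so subtracting the latter changes nothing. Thus
        \<open>val P \<theta>\<close> is a lower bound everywhere, and these bounds sum to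
        \<open>vp b\<close>.\<close>
      have low: "val P \<theta> \<le> val P (\<theta> - of_int (int p ^ k * m))" if P: "P \<in> spec" for P
      proof (cases "P \<in> S5")
        case True
        then show ?thesis using val_\<theta>_minus_ge[of P k m] v[OF True] P by (simp add: spec_iff)
      next
        case False
        then have "P \<in> S2" using P split(1) by blast
        then have P2: "2 * val P \<theta> = val P \<pi> * vp a" and mP: "maxid P" by (simp_all add: S2_def spec_iff)
        show ?thesis
        proof (cases "m = 0")
          case m: False
          let ?z = "of_int (int p ^ k * (- m)) :: 'a"
          have e: "\<theta> + ?z = \<theta> - of_int (int p ^ k * m)" by simp
          have "val P ?z = val P \<pi> * (k + vp (- m))" by (rule val_p_power_mult[OF mP]) (use m in simp)
          then have "val P ?z = val P \<pi> * k + val P \<pi> * vp (- m)" by (simp only: distrib_left)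
          moreover have "val P \<pi> * vp a < 2 * (val P \<pi> * k)"
            using mult_less_mono2[OF k2 val_pi_pos[OF mP]] by (simp only: mult.left_commute)
          ultimately have "val P \<theta> < val P ?z" using P2 by linarith
          then have "val P (\<theta> + ?z) = val P \<theta>" by (intro val_add_eq(2)[OF mP \<theta>A \<theta>_nonzero of_int_in]) simp
          then show ?thesis unfolding e by simp
        qed simp
      qed
      have "(\<Sum>P\<in>spec. rdeg P * val P \<theta>) + card {P \<in> ?D5. near k P m}
          \<le> vp ((int p ^ k * m) ^ 7 + a * (int p ^ k * m) ^ 5 + b)"
        by (rule card_near_le[OF D5D low]) (use v in \<open>auto simp: near_def\<close>)
      then show ?thesis unfolding FH vp_times_power[OF H0] sum_val_\<theta> by simp
    qed
    have less: "card {P \<in> ?D5. near k P m} < n" if "\<not> int p ^ n dvd H m" for m n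
      using count[of m] vp_less[OF H0 that] by simp
    have main: "card ?D5 \<le> (\<Sum>r<p. g r)"
      if res: "\<And>r. r < p \<Longrightarrow> \<exists>c. \<not> int p ^ Suc (g r) dvd H (int r + int p * c)" for g
    proof (rule card_le_sum_near[OF D5D])
      fix r assume "r < p"
      then obtain c where "\<not> int p ^ Suc (g r) dvd H (int r + int p * c)" using res by blast
      then show "\<exists>c. card {P \<in> ?D5. near k P (int r + int p * c)} \<le> g r"
        using less unfolding less_Suc_eq_le[symmetric] by blast
    qed (use v in auto)
    show ?thesis
    proof (cases "p = 3")
      case True
      have b3: "\<not> 3 dvd b'" and a3: "\<not> 3 dvd a'" using a'(2) b'(2) True by simp_all
      have H: "H m = 3 * w * m ^ 7 + a' * m ^ 5 + b'" for m using True by (simp add: H_def)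
      have r0: "\<not> 3 dvd H 0" using b3 by (simp add: H)
      have r12: "\<not> 3 dvd H 1 \<or> \<not> 3 dvd H 2" unfolding H by (rule trinomial_3[OF b3])
      have r1: "\<not> 9 dvd H 1 \<or> \<not> 9 dvd H 4" and r2: "\<not> 9 dvd H 2 \<or> \<not> 9 dvd H 5"
        unfolding H by (rule trinomial_9[OF a3])+
      \<comment> \<open>A lift not divisible by 9 leaves a budget of 1, and the residues 1 and 2 are
        not both roots modulo 3.\<close>
      define g where "g r = (if r = 0 then 0 else if r = (1::nat) then if 3 dvd H 1 then 1 else 0
        else if 3 dvd H 2 then 1 else (0::nat))" for r
      have "card ?D5 \<le> (\<Sum>r<p. g r)"
      proof (rule main)
        fix r assume "r < p"
        then consider "r = 0" | "r = 1" | "r = 2" using True by linarith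
        then have "\<exists>c\<in>{0,1}. \<not> int p ^ Suc (g r) dvd H (int r + int p * c)"
          using r0 r1 r2 True by cases (auto simp: g_def)
        then show "\<exists>c. \<not> int p ^ Suc (g r) dvd H (int r + int p * c)" by blast
      qed
      also have "\<dots> \<le> 1" using True r12 by (auto simp: g_def eval_nat_numeral)
      finally show ?thesis using True by simp
    next
      case False
      then have p5: "p = 5" using p by simp
      have b5: "\<not> 5 dvd b'" and a5: "\<not> 5 dvd a'" using a'(2) b'(2) p5 by simp_all
      have H: "H m = 5 * w * m ^ 7 + a' * m ^ 5 + b'" for m using p5 by (simp add: H_def)
      have r0: "\<not> 5 dvd H 0" using b5 by (simp add: H)
      have r: "\<not> 625 dvd H 1 \<or> \<not> 625 dvd H 6 \<or> \<not> 625 dvd H 11"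
        "\<not> 625 dvd H 2 \<or> \<not> 625 dvd H 7 \<or> \<not> 625 dvd H 12"
        "\<not> 625 dvd H 3 \<or> \<not> 625 dvd H 8 \<or> \<not> 625 dvd H 13"
        "\<not> 625 dvd H 4 \<or> \<not> 625 dvd H 9 \<or> \<not> 625 dvd H 14"
        unfolding H by (rule trinomial_625[OF a5])+
      have cong: "5 dvd H m \<longleftrightarrow> 5 dvd a' * m ^ 5 + b'" for m
      proof -
        have "H m = 5 * (w * m ^ 7) + (a' * m ^ 5 + b')" by (simp add: H)
        then show ?thesis by (metis dvd_add_times_triv_left_iff mult.commute)
      qed
      have uniq: "\<not> (5 dvd H 1 \<and> 5 dvd H 2)" "\<not> (5 dvd H 1 \<and> 5 dvd H 3)" "\<not> (5 dvd H 1 \<and> 5 dvd H 4)"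
        "\<not> (5 dvd H 2 \<and> 5 dvd H 3)" "\<not> (5 dvd H 2 \<and> 5 dvd H 4)" "\<not> (5 dvd H 3 \<and> 5 dvd H 4)"
        unfolding cong by (rule trinomial_5[OF a5], simp)+
      \<comment> \<open>At most one residue is a root modulo 5, and a lift not divisible by 5^4
        leaves it a budget of 3.\<close>
      define g where "g r = (if r > 0 \<and> 5 dvd H (int r) then 3 else (0::nat))" for r :: nat
      have "card ?D5 \<le> (\<Sum>r<p. g r)"
      proof (rule main)
        fix s assume "s < p"
        then consider "s = 0" | "s = 1" | "s = 2" | "s = 3" | "s = 4" using p5 by linarith
        then have "\<exists>c\<in>{0,1,2}. \<not> int p ^ Suc (g s) dvd H (int s + int p * c)"
          using r0 r p5 by cases (auto simp: g_def)
        then show "\<exists>c. \<not> int p ^ Suc (g s) dvd H (int s + int p * c)" by blast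
      qed
      also have "\<dots> = g 0 + g 1 + g 2 + g 3 + g 4" using p5 by (simp add: eval_nat_numeral)
      also have "\<dots> \<le> 3" using uniq by (auto simp: g_def)
      finally show ?thesis using p5 by simp
    qed
  qed
  show ?thesis using D D2 D5 p by (auto split: if_splits)
qed

theorem few_primes_of_degree_one:
  assumes "odd p"
  shows "card {P \<in> spec. rdeg P = 1} \<le> p"
proof (cases "p \<ge> 7")
  case True
  have "card {P \<in> spec. rdeg P = 1} \<le> (\<Sum>P\<in>spec. rdeg P * val P \<pi>)" by (rule sum_rdeg_val_pi_subset) simp
  then show ?thesis using sum_val_pi d7 True by simp
next
  case False
  then have "p = 3 \<or> p = 5" using assms p_gt_1 by presburger
  then show ?thesis using few_case_single_slope few_case_two_slopes by linarith
qed

end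

end

section \<open>Algebraic integers\<close>

text \<open>The determinant trick: \<open>x\<close> is an eigenvalue of an integer matrix, whose
  characteristic polynomial is monic with integer coefficients.\<close>

lemma algebraic_int_eigenvalue:
  fixes v :: "nat \<Rightarrow> complex" and M :: "nat \<Rightarrow> nat \<Rightarrow> int"
  assumes eq: "\<And>i. i < n \<Longrightarrow> x * v i = (\<Sum>j<n. of_int (M i j) * v j)"
    and nz: "k < n" "v k \<noteq> 0"
  shows "algebraic_int x"
proof -
  define B where "B = mat n n (\<lambda>(i, j). M i j)"
  define B' :: "complex mat" where "B' = map_mat of_int B"
  have B: "B \<in> carrier_mat n n" by (simp add: B_def)
  have B': "B' \<in> carrier_mat n n" by (simp add: B'_def B)
  have "B' *\<^sub>v vec n v = x \<cdot>\<^sub>v vec n v"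
  proof (rule eq_vecI)
    fix i assume "i < dim_vec (x \<cdot>\<^sub>v vec n v)"
    then have i: "i < n" by simp
    have "(B' *\<^sub>v vec n v) $ i = (\<Sum>j<n. of_int (M i j) * v j)"
      using i by (simp add: B'_def B_def scalar_prod_def lessThan_atLeast0)
    then show "(B' *\<^sub>v vec n v) $ i = (x \<cdot>\<^sub>v vec n v) $ i" using i eq[OF i] by simp
  qed (simp add: B'_def B_def)
  moreover have "vec n v \<noteq> 0\<^sub>v n"
  proof
    assume "vec n v = 0\<^sub>v n"
    then have "vec n v $ k = 0\<^sub>v n $ k" by simp
    then show False using nz by simp
  qed
  ultimately have "eigenvector B' (vec n v) x" using B' by (simp add: eigenvector_def)
  then have "poly (char_poly B') x = 0"
    using eigenvalue_root_char_poly[OF B'] by (auto simp: eigenvalue_def)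
  moreover have "char_poly B' = map_poly of_int (char_poly B)"
    unfolding B'_def by (rule of_int_hom.char_poly_hom[OF B])
  moreover have "lead_coeff (char_poly B) = 1" using degree_monic_char_poly[OF B] by simp
  ultimately show ?thesis unfolding algebraic_int_altdef_ipoly by auto
qed

definition zspan :: "'i set \<Rightarrow> ('i \<Rightarrow> complex) \<Rightarrow> complex set" where
  "zspan I v = {z. \<exists>c::'i \<Rightarrow> int. z = (\<Sum>i\<in>I. of_int (c i) * v i)}"

lemma zspan_add: "x \<in> zspan I v \<Longrightarrow> y \<in> zspan I v \<Longrightarrow> x + y \<in> zspan I v"
proof -
  assume "x \<in> zspan I v" "y \<in> zspan I v"
  then obtain c d where "x = (\<Sum>i\<in>I. of_int (c i) * v i)" "y = (\<Sum>i\<in>I. of_int (d i) * v i)"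
    by (auto simp: zspan_def)
  then have "x + y = (\<Sum>i\<in>I. of_int (c i + d i) * v i)" by (simp add: sum.distrib distrib_right)
  then show ?thesis unfolding zspan_def mem_Collect_eq by (rule exI[where x = "\<lambda>i. c i + d i"])
qed

lemma zspan_scale: "x \<in> zspan I v \<Longrightarrow> of_int m * x \<in> zspan I v"
proof -
  assume "x \<in> zspan I v"
  then obtain c where "x = (\<Sum>i\<in>I. of_int (c i) * v i)" by (auto simp: zspan_def)
  then have "of_int m * x = (\<Sum>i\<in>I. of_int (m * c i) * v i)" by (simp add: sum_distrib_left mult.assoc)
  then show ?thesis unfolding zspan_def mem_Collect_eq by (rule exI[where x = "\<lambda>i. m * c i"])
qed

lemma zspan_0: "0 \<in> zspan I v"
  unfolding zspan_def by (auto intro!: exI[of _ "\<lambda>_. 0"])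

lemma zspan_sum: "(\<And>j. j \<in> J \<Longrightarrow> f j \<in> zspan I v) \<Longrightarrow> sum f J \<in> zspan I v"
  by (induction J rule: infinite_finite_induct) (auto intro: zspan_0 zspan_add)

lemma zspan_base: "finite I \<Longrightarrow> i \<in> I \<Longrightarrow> v i \<in> zspan I v"
  unfolding zspan_def by (auto intro!: exI[of _ "\<lambda>j. if j = i then 1 else 0"] simp: if_distrib if_distribR sum.delta cong: if_cong)

lemma algebraic_int_zspan:
  assumes fin: "finite I" and eq: "\<And>i. i \<in> I \<Longrightarrow> x * v i \<in> zspan I v" and k: "k \<in> I" "v k \<noteq> 0"
  shows "algebraic_int x"
proof -
  define n where "n = card I"
  obtain h where h: "bij_betw h {..<n} I"
    using ex_bij_betw_nat_finite[OF fin] by (auto simp: n_def atLeast0LessThan)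
  have "\<forall>i\<in>I. \<exists>c::_ \<Rightarrow> int. x * v i = (\<Sum>j\<in>I. of_int (c j) * v j)" using eq by (auto simp: zspan_def)
  then obtain c :: "_ \<Rightarrow> _ \<Rightarrow> int" where c: "\<And>i. i \<in> I \<Longrightarrow> x * v i = (\<Sum>j\<in>I. of_int (c i j) * v j)" by metis
  obtain l where l: "l < n" "h l = k" using h k(1) by (auto simp: bij_betw_def)
  show ?thesis
  proof (rule algebraic_int_eigenvalue[of n x "v \<circ> h" "\<lambda>i j. c (h i) (h j)" l])
    fix i assume "i < n"
    then have "h i \<in> I" using h by (auto simp: bij_betw_def)
    then have "x * v (h i) = (\<Sum>j\<in>I. of_int (c (h i) j) * v j)" by (rule c)
    also have "\<dots> = (\<Sum>j<n. of_int (c (h i) (h j)) * v (h j))"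
      by (rule sum.reindex_bij_betw[OF h, symmetric])
    finally show "x * (v \<circ> h) i = (\<Sum>j<n. of_int (c (h i) (h j)) * (v \<circ> h) j)" by simp
  qed (use l k in auto)
qed

lemma algebraic_int_power_relation:
  fixes x :: complex
  assumes "algebraic_int x"
  obtains n and c :: "nat \<Rightarrow> int" where "n > 0" "x ^ n = (\<Sum>i<n. of_int (c i) * x ^ i)"
proof -
  obtain h :: "int poly" where h: "poly (map_poly of_int h) x = 0" "lead_coeff h = 1"
    using assms unfolding algebraic_int_altdef_ipoly by blast
  define n where "n = degree h"
  have "(\<Sum>i\<le>n. of_int (Polynomial.coeff h i) * x ^ i) = 0"
    using h(1) by (simp add: poly_altdef n_def)
  moreover have "{..n} = insert n {..<n}" by auto
  ultimately have e: "x ^ n + (\<Sum>i<n. of_int (Polynomial.coeff h i) * x ^ i) = 0"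
    using h(2) by (simp add: n_def)
  then have "x ^ n = (\<Sum>i<n. of_int (- Polynomial.coeff h i) * x ^ i)"
    by (simp add: sum_negf eq_neg_iff_add_eq_0)
  moreover have "n > 0" using e by (cases n) auto
  ultimately show ?thesis by (intro that)
qed

text \<open>The monomials \<open>x ^ i * y ^ j\<close> with \<open>i < m\<close>,
  \<open>j < n\<close> span a module over the integers that is stable under both \<open>x\<close>
  and \<open>y\<close>; the monomial 1 provides the nonzero vector.\<close>

lemma algebraic_int_add_mult:
  fixes x y :: complex
  assumes "algebraic_int x" "algebraic_int y"
  shows "algebraic_int (x + y)" "algebraic_int (x * y)"
proof -
  obtain m c where m: "m > 0" "x ^ m = (\<Sum>i<m. of_int (c i) * x ^ i)"
    using algebraic_int_power_relation[OF assms(1)] by metis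
  obtain n d where n: "n > 0" "y ^ n = (\<Sum>i<n. of_int (d i) * y ^ i)"
    using algebraic_int_power_relation[OF assms(2)] by metis
  define I where "I = {..<m} \<times> {..<n}"
  define v where "v = (\<lambda>(i, j). x ^ i * y ^ j)"
  have fin: "finite I" by (simp add: I_def)
  have base: "x ^ i * y ^ j \<in> zspan I v" if "i < m" "j < n" for i j
    using zspan_base[OF fin, of "(i, j)" v] that by (simp add: I_def v_def)
  have X0: "x * (x ^ i * y ^ j) \<in> zspan I v" if "i < m" "j < n" for i j
  proof (cases "Suc i = m")
    case True
    have "x * (x ^ i * y ^ j) = x ^ m * y ^ j" using True by (simp add: mult.assoc[symmetric] flip: power_Suc)
    also have "\<dots> = (\<Sum>l<m. of_int (c l) * (x ^ l * y ^ j))" unfolding m(2) by (simp add: sum_distrib_right mult.assoc)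
    also have "\<dots> \<in> zspan I v" by (intro zspan_sum zspan_scale base) (use that in auto)
    finally show ?thesis .
  qed (use base[of "Suc i" j] that in \<open>simp add: mult.assoc\<close>)
  have Y0: "y * (x ^ i * y ^ j) \<in> zspan I v" if "i < m" "j < n" for i j
  proof (cases "Suc j = n")
    case True
    have "y * (x ^ i * y ^ j) = x ^ i * y ^ n" using True by (metis mult.left_commute power_Suc)
    also have "\<dots> = (\<Sum>l<n. of_int (d l) * (x ^ i * y ^ l))" unfolding n(2) by (simp add: sum_distrib_left mult.left_commute)
    also have "\<dots> \<in> zspan I v" by (intro zspan_sum zspan_scale base) (use that in auto)
    finally show ?thesis .
  next
    case False
    have "y * (x ^ i * y ^ j) = x ^ i * y ^ Suc j" by (simp add: mult.left_commute)
    moreover have "x ^ i * y ^ Suc j \<in> zspan I v" by (rule base) (use that False in auto)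
    ultimately show ?thesis by (simp only:)
  qed
  have V: "x * v i \<in> zspan I v" "y * v i \<in> zspan I v" if i: "i \<in> I" for i
  proof -
    obtain a b where ab: "i = (a, b)" "a < m" "b < n" using i unfolding I_def by blast
    have "v i = x ^ a * y ^ b" by (simp add: ab v_def)
    then show "x * v i \<in> zspan I v" "y * v i \<in> zspan I v"
      using X0[OF ab(2,3)] Y0[OF ab(2,3)] by (simp_all only:)
  qed
  have X: "x * z \<in> zspan I v" if z: "z \<in> zspan I v" for z
  proof -
    obtain e where "z = (\<Sum>i\<in>I. of_int (e i) * v i)" using z by (auto simp: zspan_def)
    then have "x * z = (\<Sum>i\<in>I. of_int (e i) * (x * v i))" by (simp add: sum_distrib_left mult.left_commute)
    also have "\<dots> \<in> zspan I v" by (intro zspan_sum zspan_scale V(1))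
    finally show ?thesis .
  qed
  have k: "(0, 0) \<in> I" "v (0, 0) \<noteq> 0" using m n by (auto simp: I_def v_def)
  show "algebraic_int (x + y)"
    by (rule algebraic_int_zspan[where I = I and v = v, OF fin _ k]) (simp add: distrib_right V zspan_add)
  show "algebraic_int (x * y)"
    by (rule algebraic_int_zspan[where I = I and v = v, OF fin _ k]) (simp add: mult.assoc V X)
qed

lemma algebraic_int_diff: "algebraic_int x \<Longrightarrow> algebraic_int y \<Longrightarrow> algebraic_int (x - y :: complex)"
  using algebraic_int_add_mult(1)[of x "- y"] by auto

lemma algebraic_int_power: "algebraic_int x \<Longrightarrow> algebraic_int (x ^ n :: complex)"
  by (induction n) (auto intro: algebraic_int_add_mult)

lemma algebraic_int_sum: "(\<And>i. i \<in> S \<Longrightarrow> algebraic_int (f i)) \<Longrightarrow> algebraic_int (sum f S :: complex)"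
  by (induction S rule: infinite_finite_induct) (auto intro: algebraic_int_add_mult)

section \<open>Minimal polynomials of algebraic integers and conjugates\<close>

abbreviation cpoly :: "int poly \<Rightarrow> complex \<Rightarrow> complex" where
  "cpoly h \<equiv> poly (map_poly of_int h)"

abbreviation qpoly :: "rat poly \<Rightarrow> complex \<Rightarrow> complex" where
  "qpoly h \<equiv> poly (map_poly of_rat h)"

lemma algebraic_int_cpoly: "algebraic_int x \<Longrightarrow> algebraic_int (cpoly h x)"
  unfolding poly_altdef by (intro algebraic_int_sum algebraic_int_add_mult algebraic_int_power) auto

lemma qpoly_of_int: "qpoly (map_poly of_int h) x = cpoly h x"
  by (simp add: poly_altdef)

lemma qpoly_simps:
  "qpoly (g + h) x = qpoly g x + qpoly h x" "qpoly (g - h) x = qpoly g x - qpoly h x"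
  "qpoly (g * h) x = qpoly g x * qpoly h x" "qpoly (Polynomial.smult c g) x = of_rat c * qpoly g x"
  "qpoly 0 x = 0" "qpoly 1 x = 1" "qpoly [:c:] x = of_rat c" "qpoly (pCons c g) x = of_rat c + x * qpoly g x"
  "qpoly (- g) x = - qpoly g x"
proof -
  interpret H: map_poly_comm_ring_hom "of_rat :: rat \<Rightarrow> complex" ..
  show "qpoly (g + h) x = qpoly g x + qpoly h x" "qpoly (g - h) x = qpoly g x - qpoly h x"
    "qpoly (g * h) x = qpoly g x * qpoly h x" "qpoly (- g) x = - qpoly g x"
    by (simp_all add: H.hom_add H.hom_minus H.hom_mult H.hom_uminus)
qed (simp_all add: hom_distribs)

lemma cpoly_simps:
  "cpoly (g + h) x = cpoly g x + cpoly h x" "cpoly (g - h) x = cpoly g x - cpoly h x"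
  "cpoly (g * h) x = cpoly g x * cpoly h x" "cpoly (Polynomial.smult c g) x = of_int c * cpoly g x"
  "cpoly 0 x = 0" "cpoly 1 x = 1" "cpoly [:c:] x = of_int c" "cpoly (pCons c g) x = of_int c + x * cpoly g x"
  "cpoly (- g) x = - cpoly g x"
  by (simp_all add: hom_distribs)

lemma qpoly_clear_denominators:
  fixes g :: "rat poly"
  obtains N :: int and h :: "int poly" where "N > 0" "Polynomial.smult (of_int N) g = map_poly of_int h"
proof -
  have "\<exists>N::int. \<exists>h::int poly. N > 0 \<and> Polynomial.smult (of_int N) g = map_poly of_int h"
  proof (induction g)
    case 0
    then show ?case by (intro exI[of _ 1] exI[of _ 0]) simp
  next
    case (pCons a g)
    then obtain N h where N: "N > 0" "Polynomial.smult (of_int N) g = map_poly of_int h" by blast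
    obtain u w where uw: "quotient_of a = (u, w)" by force
    then have w: "w > 0" "a = of_int u / of_int w" using quotient_of_denom_pos quotient_of_div by auto
    have "Polynomial.smult (of_int (N * w)) (pCons a g)
        = pCons (of_int (N * u)) (Polynomial.smult (of_int w) (Polynomial.smult (of_int N) g))"
      using w by (simp add: mult.commute)
    also have "\<dots> = map_poly of_int (pCons (N * u) (Polynomial.smult w h))"
      unfolding N(2) by (simp add: hom_distribs)
    finally show ?case using N(1) w(1) by (intro exI[of _ "N * w"]) auto
  qed
  then show ?thesis using that by blast
qed

text \<open>Serves for two generators of the same field: first for \<theta> with the given
  trinomial, later for \<eta> with its minimal polynomial.\<close>

locale monic_root =
  fixes f :: "int poly" and x :: complex
  assumes monic: "lead_coeff f = 1"
    and irred: "Factorial_Ring.irreducible (map_poly rat_of_int f)"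
    and root: "cpoly f x = 0"
begin

abbreviation fq :: "rat poly" where "fq \<equiv> map_poly of_int f"

definition n where "n = degree f"

lemma degree_fq: "degree fq = n" by (simp add: n_def)

lemma n_pos: "n > 0"
proof (rule ccontr)
  assume "\<not> n > 0"
  then have "degree f = 0" by (simp add: n_def)
  then have "f = [:lead_coeff f:]" by (metis degree_0_id)
  then show False using root monic by (metis cpoly_simps(7) of_int_1 one_neq_zero)
qed

lemma algebraic_int_x: "algebraic_int x"
  unfolding algebraic_int_altdef_ipoly using monic root by blast

lemma coprime_or_dvd:
  obtains "fq dvd g" | u v :: "rat poly" where "u * fq + v * g = 1"
proof (cases "fq dvd g")
  case False
  have "prime_elem fq" using irred by (rule irreducible_imp_prime_elem_gcd)
  then have "coprime fq g" using False by (rule prime_elem_imp_coprime)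
  then have "bezout_coefficients fq g = (fst (bezout_coefficients fq g), snd (bezout_coefficients fq g)) \<and> gcd fq g = 1" by simp
  then have "fst (bezout_coefficients fq g) * fq + snd (bezout_coefficients fq g) * g = 1"
    using bezout_coefficients_fst_snd[of fq g] by simp
  then show ?thesis by (rule that(2))
qed (use that in blast)

lemma qpoly_eq_0_iff: "qpoly g x = 0 \<longleftrightarrow> fq dvd g"
proof
  assume g: "qpoly g x = 0"
  show "fq dvd g"
  proof (rule coprime_or_dvd[of g])
    fix u v assume "u * fq + v * g = 1"
    then have "qpoly (u * fq + v * g) x = 1" by (simp add: qpoly_simps)
    then show ?thesis using g root by (simp add: qpoly_simps qpoly_of_int)
  qed
next
  assume "fq dvd g"
  then obtain k where "g = fq * k" by (auto simp: dvd_def)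
  then show "qpoly g x = 0" using root by (simp add: qpoly_simps qpoly_of_int)
qed

lemma qpoly_root_conjugate:
  assumes "qpoly g x = 0" "cpoly f y = 0"
  shows "qpoly g y = 0"
proof -
  obtain k where "g = fq * k" using assms(1) unfolding qpoly_eq_0_iff by (auto simp: dvd_def)
  then show ?thesis using assms(2) by (simp add: qpoly_simps qpoly_of_int)
qed

lemma qpoly_reduce:
  obtains h where "degree h < n" "qpoly h x = qpoly g x"
proof
  have "g = g div fq * fq + g mod fq" by (rule div_mult_mod_eq[symmetric])
  then have "qpoly g x = qpoly (g div fq) x * qpoly fq x + qpoly (g mod fq) x" by (metis qpoly_simps(1,3))
  then show "qpoly (g mod fq) x = qpoly g x" using root by (simp add: qpoly_of_int)
  show "degree (g mod fq) < n"
  proof (cases "g mod fq = 0")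
    case False
    have "fq \<noteq> 0" using degree_fq n_pos by auto
    then show ?thesis using degree_mod_less'[of fq g] False degree_fq by simp
  qed (use n_pos in simp)
qed

lemma qpoly_inj:
  assumes "degree g < n" "degree h < n" "qpoly g x = qpoly h x"
  shows "g = h"
proof -
  have "fq dvd g - h" using assms(3) unfolding qpoly_eq_0_iff[symmetric] by (simp add: qpoly_simps)
  moreover have "degree (g - h) < degree fq" using assms(1,2) degree_diff_less[of g n h] degree_fq by simp
  ultimately have "g - h = 0" using dvd_imp_degree_le[of fq "g - h"] by (metis not_le)
  then show ?thesis by simp
qed

text \<open>A monic \<open>h\<close> killing \<open>qpoly g x\<close> makes the composition of
  \<open>h\<close> with \<open>g\<close> vanish at \<open>x\<close>, hence at every conjugate of
  \<open>x\<close>.\<close>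

lemma algebraic_int_conjugate:
  assumes "algebraic_int (qpoly g x)" "cpoly f y = 0"
  shows "algebraic_int (qpoly g y)"
proof -
  obtain h :: "int poly" where h: "cpoly h (qpoly g x) = 0" "lead_coeff h = 1"
    using assms(1) unfolding algebraic_int_altdef_ipoly by blast
  have comp: "qpoly (pcompose (map_poly of_int h) g) z = cpoly h (qpoly g z)" for z
    by (simp add: of_rat_hom.map_poly_pcompose poly_pcompose qpoly_of_int[symmetric])
  have "cpoly h (qpoly g y) = 0"
    using qpoly_root_conjugate[of "pcompose (map_poly of_int h) g" y] assms(2) h(1) by (simp add: comp)
  then show ?thesis using h(2) unfolding algebraic_int_altdef_ipoly by blast
qed

end

section \<open>The conductor of a monic root\<close>

lemma of_rat_in_Ints: "complex_of_rat q \<in> \<int> \<Longrightarrow> q \<in> \<int>"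
proof -
  assume "complex_of_rat q \<in> \<int>"
  then obtain k where "complex_of_rat q = of_int k" by (auto elim: Ints_cases)
  then have "complex_of_rat q = of_rat (of_int k)" by simp
  then have "q = of_int k" by (simp only: of_rat_eq_iff)
  then show ?thesis by simp
qed

lemma rat_poly_integral_coeffs:
  fixes q :: "rat poly"
  assumes "\<And>i. algebraic_int (complex_of_rat (Polynomial.coeff q i))"
  obtains h where "q = map_poly of_int h"
proof -
  have "Polynomial.coeff q i \<in> \<int>" for i
    using rational_algebraic_int_is_int[OF assms[of i]] by (intro of_rat_in_Ints) simp
  then show ?thesis using that by (elim intpolyE)
qed

text \<open>By Horner's scheme the coefficients of the quotient by \<open>X - y\<close> are integer
  polynomial expressions in \<open>y\<close> and the coefficients of \<open>q\<close>.\<close>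

lemma algebraic_int_synthetic_div:
  fixes q :: "complex poly"
  assumes y: "algebraic_int y"
  shows "(\<And>i. algebraic_int (Polynomial.coeff q i)) \<Longrightarrow>
    algebraic_int (poly q y) \<and> (\<forall>i. algebraic_int (Polynomial.coeff (synthetic_div q y) i))"
proof (induction q)
  case (pCons a q)
  have "algebraic_int (Polynomial.coeff q i)" for i using pCons.prems[of "Suc i"] by simp
  then have IH: "algebraic_int (poly q y)" "\<And>i. algebraic_int (Polynomial.coeff (synthetic_div q y) i)"
    using pCons.IH by auto
  have "algebraic_int a" using pCons.prems[of 0] by simp
  then show ?case using IH y
    by (auto simp: coeff_pCons split: nat.splits intro: algebraic_int_add_mult)
qed simp

context monic_root
begin

abbreviation fc :: "complex poly" where "fc \<equiv> map_poly of_int f"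

lemma degree_fc: "degree fc = n" by (simp add: n_def)

text \<open>An irreducible polynomial in characteristic 0 is coprime to its derivative. Clearing
  denominators in the Bezout relation gives one integer, in the role of the discriminant, for all
  conjugates at once.\<close>

lemma derivative_bezout:
  obtains N :: int and u :: "int poly"
  where "N > 0" "\<And>y. cpoly f y = 0 \<Longrightarrow> cpoly u y * poly (pderiv fc) y = of_int N"
proof -
  have ne: "pderiv fq \<noteq> 0" using n_pos degree_fq by (simp add: pderiv_eq_0_iff)
  have "\<not> fq dvd pderiv fq"
  proof
    assume "fq dvd pderiv fq"
    then have "degree fq \<le> degree (pderiv fq)" using ne by (rule dvd_imp_degree_le)
    then show False using n_pos degree_fq by (simp add: degree_pderiv)
  qed
  then obtain u v where uv: "u * fq + v * pderiv fq = 1" using coprime_or_dvd[of "pderiv fq"] by metis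
  obtain N h where N: "N > 0" "Polynomial.smult (of_int N) v = map_poly of_int h"
    using qpoly_clear_denominators by metis
  have d: "qpoly (pderiv fq) y = poly (pderiv fc) y" for y
  proof -
    have "pderiv fq = map_poly of_int (pderiv f)" "pderiv fc = map_poly of_int (pderiv f)"
      by (simp_all add: of_int_hom.map_poly_pderiv)
    then show ?thesis by (simp add: qpoly_of_int)
  qed
  show ?thesis
  proof (rule that[OF N(1), of h])
    fix y assume y: "cpoly f y = 0"
    have "qpoly (u * fq + v * pderiv fq) y = 1" unfolding uv by (simp add: qpoly_simps)
    then have "qpoly v y * poly (pderiv fc) y = 1" using y by (simp add: qpoly_simps qpoly_of_int d)
    moreover have "cpoly h y = of_int N * qpoly v y"
      unfolding qpoly_of_int[symmetric] N(2)[symmetric] by (simp add: qpoly_simps)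
    ultimately show "cpoly h y * poly (pderiv fc) y = of_int N" by simp
  qed
qed

definition roots where "roots = {y. cpoly f y = 0}"

lemma fc_nonzero: "fc \<noteq> 0" using degree_fc n_pos by auto

lemma finite_roots: "finite roots"
  unfolding roots_def by (rule poly_roots_finite[OF fc_nonzero])

lemma card_roots: "card roots = n"
proof -
  obtain N u where N: "N > 0" "\<And>y. cpoly f y = 0 \<Longrightarrow> cpoly u y * poly (pderiv fc) y = of_int N"
    using derivative_bezout by metis
  have "rsquarefree fc" unfolding rsquarefree_roots
  proof (intro allI notI)
    fix y assume "poly fc y = 0 \<and> poly (pderiv fc) y = 0"
    then show False using N(2)[of y] N(1) by simp
  qed
  then have "Polynomial.smult (lead_coeff fc) (\<Prod>z\<in>roots. [:-z, 1:]) = fc"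
    unfolding roots_def by (rule complex_poly_decompose_rsquarefree)
  moreover have "lead_coeff fc = 1" using monic by simp
  ultimately have "degree fc = degree (\<Prod>z\<in>roots. [:-z, 1:])" by (metis smult_1_left)
  also have "\<dots> = card roots" by (subst degree_prod_sum_eq) auto
  finally show ?thesis using degree_fc by simp
qed

text \<open>Lagrange interpolation at the conjugates, with \<open>f'\<close> inverted up to the integer \<open>N\<close> by Bezout.\<close>

lemma conductor:
  obtains N :: int where "N > 0"
    "\<And>g. degree g < n \<Longrightarrow> algebraic_int (qpoly g x) \<Longrightarrow>
      \<exists>h. Polynomial.smult (of_int N) g = map_poly of_int h"
proof -
  obtain N u where N: "N > 0" "\<And>y. cpoly f y = 0 \<Longrightarrow> cpoly u y * poly (pderiv fc) y = of_int N"
    using derivative_bezout by metis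
  have alg_root: "algebraic_int y" if "y \<in> roots" for y
    using that monic unfolding roots_def algebraic_int_altdef_ipoly by blast
  define s where "s y = synthetic_div fc y" for y
  have s_eq: "fc = [:- y, 1:] * s y" if "y \<in> roots" for y
    using synthetic_div_correct'[of y fc] that by (simp add: s_def roots_def)
  have s_alg: "algebraic_int (Polynomial.coeff (s y) i)" if "y \<in> roots" for y i
    using algebraic_int_synthetic_div[OF alg_root[OF that], of fc] by (simp add: s_def)
  have s_deg: "degree (s y) < n" for y
    using n_pos degree_fc by (simp add: s_def degree_synthetic_div)
  have s_val: "poly (s y) z = (if z = y then poly (pderiv fc) y else 0)" if "y \<in> roots" "z \<in> roots" for y z
  proof (cases "z = y")
    case True
    have "pderiv fc = [:- y, 1:] * pderiv (s y) + s y * pderiv [:- y, 1:]"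
      unfolding pderiv_mult[symmetric] using s_eq[OF that(1)] by (rule arg_cong)
    then have "poly (pderiv fc) y = poly ([:- y, 1:] * pderiv (s y) + s y * pderiv [:- y, 1:]) y" by (rule arg_cong)
    also have "\<dots> = poly (s y) y" by (simp add: pderiv_pCons)
    finally have "poly (pderiv fc) y = poly (s y) y" .
    then show ?thesis using True by simp
  next
    case False
    have "0 = poly ([:- y, 1:] * s y) z" using s_eq[OF that(1)] that(2) by (simp add: roots_def)
    then show ?thesis using False by simp
  qed
  have "\<exists>h. Polynomial.smult (of_int N) g = map_poly of_int h"
    if deg: "degree g < n" and alg: "algebraic_int (qpoly g x)" for g
  proof -
    define c where "c y = cpoly u y * qpoly g y" for y
    have c_alg: "algebraic_int (c y)" if "y \<in> roots" for y
      unfolding c_def using algebraic_int_cpoly[OF alg_root[OF that]] algebraic_int_conjugate[OF alg] that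
      by (intro algebraic_int_add_mult) (auto simp: roots_def)
    \<comment> \<open>The quotient \<open>s y\<close> vanishes at the other conjugates and equals
      the derivative of \<open>f\<close> at \<open>y\<close>; the factor \<open>cpoly u y\<close> in
      \<open>c y\<close> turns that value into \<open>N\<close>.\<close>
    define L where "L = (\<Sum>y\<in>roots. Polynomial.smult (c y) (s y))"
    have L_deg: "degree L < n"
      unfolding L_def by (rule degree_sum_less[OF _ n_pos]) (use s_deg n_pos in \<open>auto intro: le_less_trans[OF degree_smult_le]\<close>)
    have L_val: "poly L z = of_int N * qpoly g z" if z: "z \<in> roots" for z
    proof -
      have "poly L z = (\<Sum>y\<in>roots. if z = y then c y * poly (pderiv fc) y else 0)"
        unfolding L_def poly_sum 
      proof (rule sum.cong)
        fix y assume "y \<in> roots"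
        from s_val[OF this z] show "poly (Polynomial.smult (c y) (s y)) z = (if z = y then c y * poly (pderiv fc) y else 0)"
          by simp
      qed simp
      also have "\<dots> = c z * poly (pderiv fc) z" using finite_roots z by simp
      also have "\<dots> = of_int N * qpoly g z" using N(2)[of z] z by (simp add: c_def roots_def mult_ac)
      finally show ?thesis .
    qed
    have "L = map_poly of_rat (Polynomial.smult (of_int N) g)"
    proof (rule poly_eqI_degree[of roots])
      show "poly L z = qpoly (Polynomial.smult (of_int N) g) z" if "z \<in> roots" for z
        using L_val[OF that] by (simp add: qpoly_simps)
      show "degree L < card roots" using L_deg card_roots by simp
      show "degree (map_poly complex_of_rat (Polynomial.smult (of_int N) g)) < card roots"
        using deg card_roots N(1) by simp
    qed
    then have "complex_of_rat (Polynomial.coeff (Polynomial.smult (of_int N) g) i) = Polynomial.coeff L i" for i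
      by (simp only: coeff_map_poly of_rat_0)
    moreover have "algebraic_int (Polynomial.coeff L i)" for i
      unfolding L_def coeff_sum using c_alg s_alg
      by (intro algebraic_int_sum) (auto intro: algebraic_int_add_mult)
    ultimately have "algebraic_int (complex_of_rat (Polynomial.coeff (Polynomial.smult (of_int N) g) i))" for i
      by (simp only:)
    then show ?thesis by (rule rat_poly_integral_coeffs) blast
  qed
  then show ?thesis using that N(1) by blast
qed

end

text \<open>The roots of the minimal polynomial are roots of a monic integer polynomial, hence
  algebraic integers. Its coefficients are polynomial expressions in these roots and rational, so
  they are integers.\<close>

lemma exists_monic_root:
  assumes y: "algebraic_int y"
  obtains f where "monic_root f y"
proof -
  obtain h :: "int poly" where h: "cpoly h y = 0" "lead_coeff h = 1"
    using y unfolding algebraic_int_altdef_ipoly by blast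
  define P where "P q \<longleftrightarrow> q \<noteq> 0 \<and> qpoly q y = 0" for q :: "rat poly"
  have "P (map_poly of_int h)" using h by (auto simp: P_def qpoly_of_int)
  then obtain q0 where q0: "P q0" "\<And>q. P q \<Longrightarrow> degree q0 \<le> degree q"
    using ex_has_least_nat[of P _ degree] by blast
  define q where "q = Polynomial.smult (inverse (lead_coeff q0)) q0"
  have lc: "lead_coeff q0 \<noteq> 0" using q0 by (simp add: P_def)
  have q: "q \<noteq> 0" "qpoly q y = 0" "lead_coeff q = 1" "degree q = degree q0"
    using q0(1) lc by (auto simp: q_def P_def qpoly_simps)
  have min: "r = 0" if "qpoly r y = 0" "degree r < degree q" for r
    using q0(2)[of r] that q(4) by (auto simp: P_def)
  have degq: "degree q > 0"
  proof (rule ccontr)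
    assume "\<not> degree q > 0"
    then have "q = [:lead_coeff q:]" by (metis degree_0_id gr0I)
    then show False using q(2,3) by (metis of_rat_1 one_neq_zero qpoly_simps(7))
  qed
  have irr: "Factorial_Ring.irreducible q"
  proof (rule Factorial_Ring.irreducibleI)
    show "q \<noteq> 0" by (rule q(1))
    show "\<not> q dvd 1" using degq by (simp add: is_unit_iff_degree q(1))
    fix a b assume ab: "q = a * b"
    have nz: "a \<noteq> 0" "b \<noteq> 0" using ab q(1) by auto
    have deg: "degree q = degree a + degree b" unfolding ab using nz by (rule degree_mult_eq)
    have "qpoly a y = 0 \<or> qpoly b y = 0" using q(2) unfolding ab by (simp add: qpoly_simps)
    then have "degree b = 0 \<or> degree a = 0" using min[of a] min[of b] nz deg by linarith
    then show "a dvd 1 \<or> b dvd 1" using nz by (auto simp: is_unit_iff_degree)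
  qed
  have dvd: "q dvd map_poly of_int h"
  proof -
    let ?h = "map_poly of_int h :: rat poly"
    have "?h = ?h div q * q + ?h mod q" by (rule div_mult_mod_eq[symmetric])
    then have "qpoly ?h y = qpoly (?h div q) y * qpoly q y + qpoly (?h mod q) y" by (metis qpoly_simps(1,3))
    then have "qpoly (?h mod q) y = 0" using h(1) q(2) by (simp add: qpoly_of_int)
    then have "?h mod q = 0"
      using min[of "?h mod q"] degree_mod_less'[OF q(1), of ?h] by blast
    then show ?thesis by (simp add: dvd_eq_mod_eq_0)
  qed
  let ?qc = "map_poly complex_of_rat q"
  have root_alg: "algebraic_int z" if "qpoly q z = 0" for z
  proof -
    obtain k where "map_poly of_int h = q * k" using dvd by (auto simp: dvd_def)
    then have "qpoly (map_poly of_int h) z = 0" using that by (simp add: qpoly_simps)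
    then show ?thesis using h(2) unfolding qpoly_of_int algebraic_int_altdef_ipoly by blast
  qed
  have "algebraic_int (Polynomial.coeff ?qc i)" for i
  proof -
    obtain A where A: "size A = degree ?qc" "?qc = Polynomial.smult (lead_coeff ?qc) (\<Prod>z\<in>#A. [:- z, 1:])"
      using alg_closed_imp_factorization[of ?qc] q(1) by auto
    have "lead_coeff ?qc = 1" using q(3) by simp
    then have A': "?qc = (\<Prod>z\<in>#A. [:- z, 1:])" using A(2) by (metis smult_1_left)
    have "algebraic_int z" if "z \<in># A" for z
    proof (rule root_alg)
      have "poly ?qc z = 0" unfolding A' poly_prod_mset using that by (auto simp: prod_mset_zero_iff image_iff intro!: bexI[of _ z])
      then show "qpoly q z = 0" .
    qed
    then have "\<forall>i. algebraic_int (Polynomial.coeff (\<Prod>z\<in>#A. [:- z, 1:]) i)"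
    proof (induction A)
      case (add z A)
      then have IH: "algebraic_int (Polynomial.coeff (\<Prod>z\<in>#A. [:- z, 1:]) i)" for i by auto
      have "algebraic_int z" using add.prems by auto
      then show ?case using IH by (auto simp: coeff_pCons split: nat.splits intro!: algebraic_int_add_mult algebraic_int_diff)
    qed (auto simp: coeff_1)
    then show ?thesis unfolding A' by blast
  qed
  then obtain f where f: "q = map_poly of_int f"
    using rat_poly_integral_coeffs[of q] by auto
  have "monic_root f y"
  proof
    show "lead_coeff f = 1" using q(3) unfolding f by simp
    show "Factorial_Ring.irreducible (map_poly rat_of_int f)" using irr unfolding f .
    show "cpoly f y = 0" using q(2) unfolding f qpoly_of_int .
  qed
  then show ?thesis by (rule that)
qed

section \<open>Generated subrings and subfields as values of polynomials\<close>

lemma complex_ring_simps: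
  "carrier complex_ring = UNIV" "x \<otimes>\<^bsub>complex_ring\<^esub> y = x * y" "\<one>\<^bsub>complex_ring\<^esub> = 1"
  "\<zero>\<^bsub>complex_ring\<^esub> = 0" "x \<oplus>\<^bsub>complex_ring\<^esub> y = x + y"
  by (simp_all add: ring_of_type_algebra_def)

lemma complex_ring_a_inv: "\<ominus>\<^bsub>complex_ring\<^esub> x = - x"
proof -
  interpret R: field complex_ring by (rule field_from_type_algebra)
  show ?thesis by (rule R.minus_equality) (simp_all add: complex_ring_simps)
qed

lemma complex_ring_m_inv: "x \<noteq> 0 \<Longrightarrow> inv\<^bsub>complex_ring\<^esub> x = inverse x"
proof -
  assume "x \<noteq> 0"
  interpret R: field complex_ring by (rule field_from_type_algebra)
  show ?thesis by (rule R.comm_inv_char) (simp_all add: complex_ring_simps \<open>x \<noteq> 0\<close>)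
qed

lemma int_adjoin_eq: "int_adjoin y = range (\<lambda>h. cpoly h y)"
proof (intro equalityI subsetI)
  fix z assume "z \<in> int_adjoin y"
  then have "z \<in> generate_ring complex_ring {y}" by (simp add: int_adjoin_def)
  then show "z \<in> range (\<lambda>h. cpoly h y)"
  proof induction
    case one
    have "\<one>\<^bsub>complex_ring\<^esub> = cpoly 1 y" by (simp only: complex_ring_simps cpoly_simps)
    then show ?case by (rule image_eqI) (rule UNIV_I)
  next
    case (incl h)
    then have "h = cpoly [:0, 1:] y" by simp
    then show ?case by (rule image_eqI) (rule UNIV_I)
  next
    case (a_inv h)
    then obtain g where "h = cpoly g y" by blast
    then have "\<ominus>\<^bsub>complex_ring\<^esub> h = cpoly (- g) y" by (simp only: complex_ring_a_inv cpoly_simps)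
    then show ?case by (rule image_eqI) (rule UNIV_I)
  next
    case (eng_add h1 h2)
    then obtain g1 g2 where "h1 = cpoly g1 y" "h2 = cpoly g2 y" by blast
    then have "h1 \<oplus>\<^bsub>complex_ring\<^esub> h2 = cpoly (g1 + g2) y" by (simp only: complex_ring_simps cpoly_simps)
    then show ?case by (rule image_eqI) (rule UNIV_I)
  next
    case (eng_mult h1 h2)
    then obtain g1 g2 where "h1 = cpoly g1 y" "h2 = cpoly g2 y" by blast
    then have "h1 \<otimes>\<^bsub>complex_ring\<^esub> h2 = cpoly (g1 * g2) y" by (simp only: complex_ring_simps cpoly_simps)
    then show ?case by (rule image_eqI) (rule UNIV_I)
  qed
next
  fix z assume "z \<in> range (\<lambda>h. cpoly h y)"
  then obtain h where z: "z = cpoly h y" by blast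
  let ?S = "generate_ring complex_ring {y}"
  have one: "1 \<in> ?S" using generate_ring.one[of complex_ring "{y}"] by (simp add: complex_ring_simps)
  have minus: "- a \<in> ?S" if "a \<in> ?S" for a using generate_ring.a_inv[OF that] by (simp add: complex_ring_a_inv)
  have add: "a + b \<in> ?S" if "a \<in> ?S" "b \<in> ?S" for a b
    using generate_ring.eng_add[OF that] by (simp add: complex_ring_simps)
  have mult: "a * b \<in> ?S" if "a \<in> ?S" "b \<in> ?S" for a b
    using generate_ring.eng_mult[OF that] by (simp add: complex_ring_simps)
  have zero: "0 \<in> ?S" using add[OF one minus[OF one]] by simp
  have nat: "of_nat k \<in> ?S" for k by (induction k) (auto intro: zero add one)
  have int: "of_int k \<in> ?S" for k by (cases k rule: int_cases2) (auto intro: nat minus)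
  have "cpoly h y \<in> ?S"
  proof (induction h)
    case (pCons a h)
    have "y \<in> ?S" by (rule generate_ring.incl) simp
    then show ?case using pCons int add mult unfolding cpoly_simps by blast
  qed (simp add: zero)
  then show "z \<in> int_adjoin y" by (simp add: z int_adjoin_def)
qed

context monic_root
begin

text \<open>Values of rational polynomials are already closed under inversion: a nonzero value is
  inverted by the Bezout relation with the irreducible \<open>fq\<close>.\<close>

lemma rat_adjoin_eq: "rat_adjoin x = range (\<lambda>g. qpoly g x)"
proof (intro equalityI subsetI)
  fix z assume "z \<in> rat_adjoin x"
  then have "z \<in> generate_field complex_ring {x}" by (simp add: rat_adjoin_def)
  then show "z \<in> range (\<lambda>g. qpoly g x)"
  proof induction
    case one
    have "\<one>\<^bsub>complex_ring\<^esub> = qpoly 1 x" by (simp only: complex_ring_simps qpoly_simps)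
    then show ?case by (rule image_eqI) (rule UNIV_I)
  next
    case (incl h)
    then have "h = qpoly [:0, 1:] x" by simp
    then show ?case by (rule image_eqI) (rule UNIV_I)
  next
    case (a_inv h)
    then obtain g where "h = qpoly g x" by blast
    then have "\<ominus>\<^bsub>complex_ring\<^esub> h = qpoly (- g) x" by (simp only: complex_ring_a_inv qpoly_simps)
    then show ?case by (rule image_eqI) (rule UNIV_I)
  next
    case (m_inv h)
    then obtain g where g: "h = qpoly g x" by blast
    have h0: "h \<noteq> 0" using m_inv by (simp add: complex_ring_simps)
    then have "\<not> fq dvd g" using g qpoly_eq_0_iff by blast
    then obtain u v where "u * fq + v * g = 1" using coprime_or_dvd[of g] by metis
    then have "qpoly (u * fq + v * g) x = 1" by (simp add: qpoly_simps)
    then have "qpoly v x * h = 1" using root g by (simp add: qpoly_simps qpoly_of_int)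
    then have "inverse h = qpoly v x" using h0 by (simp add: field_simps)
    then have "inv\<^bsub>complex_ring\<^esub> h = qpoly v x" using complex_ring_m_inv[OF h0] by (simp only:)
    then show ?case by (rule image_eqI) (rule UNIV_I)
  next
    case (eng_add h1 h2)
    then obtain g1 g2 where "h1 = qpoly g1 x" "h2 = qpoly g2 x" by blast
    then have "h1 \<oplus>\<^bsub>complex_ring\<^esub> h2 = qpoly (g1 + g2) x" by (simp only: complex_ring_simps qpoly_simps)
    then show ?case by (rule image_eqI) (rule UNIV_I)
  next
    case (eng_mult h1 h2)
    then obtain g1 g2 where "h1 = qpoly g1 x" "h2 = qpoly g2 x" by blast
    then have "h1 \<otimes>\<^bsub>complex_ring\<^esub> h2 = qpoly (g1 * g2) x" by (simp only: complex_ring_simps qpoly_simps)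
    then show ?case by (rule image_eqI) (rule UNIV_I)
  qed
next
  fix z assume "z \<in> range (\<lambda>g. qpoly g x)"
  then obtain g where z: "z = qpoly g x" by blast
  let ?S = "generate_field complex_ring {x}"
  have one: "1 \<in> ?S" using generate_field.one[of complex_ring "{x}"] by (simp add: complex_ring_simps)
  have minus: "- a \<in> ?S" if "a \<in> ?S" for a using generate_field.a_inv[OF that] by (simp add: complex_ring_a_inv)
  have add: "a + b \<in> ?S" if "a \<in> ?S" "b \<in> ?S" for a b
    using generate_field.eng_add[OF that] by (simp add: complex_ring_simps)
  have mult: "a * b \<in> ?S" if "a \<in> ?S" "b \<in> ?S" for a b
    using generate_field.eng_mult[OF that] by (simp add: complex_ring_simps)
  have inv: "inverse a \<in> ?S" if "a \<in> ?S" "a \<noteq> 0" for a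
    using generate_field.m_inv[OF that(1)] that(2) by (simp add: complex_ring_simps complex_ring_m_inv)
  have zero: "0 \<in> ?S" using add[OF one minus[OF one]] by simp
  have nat: "of_nat k \<in> ?S" for k by (induction k) (auto intro: zero add one)
  have int: "of_int k \<in> ?S" for k by (cases k rule: int_cases2) (auto intro: nat minus)
  have rat: "of_rat r \<in> ?S" for r
  proof (cases r)
    case (Fract a b)
    then have "(of_rat r :: complex) = of_int a * inverse (of_int b)" by (simp add: of_rat_rat divide_inverse)
    then show ?thesis using mult[OF int inv[OF int]] Fract by simp
  qed
  have "qpoly g x \<in> ?S"
  proof (induction g)
    case (pCons a g)
    have "x \<in> ?S" by (rule generate_field.incl) simp
    then show ?case using pCons rat add mult unfolding qpoly_simps by blast
  qed (simp add: zero)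
  then show "z \<in> rat_adjoin x" by (simp add: z rat_adjoin_def)
qed

end

section \<open>Localization at a prime\<close>

context monic_root
begin

lemma cpoly_reduce:
  obtains r where "degree r < n" "cpoly r x = cpoly h x"
proof -
  obtain q r where qr: "h = f * q + r" "r = 0 \<or> degree r < degree f" using monic_division[OF monic] by blast
  have "cpoly r x = cpoly h x" using root unfolding qr(1) cpoly_simps by simp
  moreover have "degree r < n" using qr(2) n_pos by (auto simp: n_def)
  ultimately show ?thesis using that by blast
qed

lemma cpoly_inj:
  assumes "degree g < n" "degree h < n" "cpoly g x = cpoly h x"
  shows "g = h"
proof -
  have "(map_poly of_int g :: rat poly) = map_poly of_int h"
    by (rule qpoly_inj) (use assms in \<open>simp_all add: qpoly_of_int\<close>)
  then show ?thesis by simp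
qed

lemma cpoly_dvd:
  assumes "cpoly h x = 0"
  obtains q where "h = f * q"
proof -
  obtain q r where qr: "h = f * q + r" "r = 0 \<or> degree r < degree f" using monic_division[OF monic] by blast
  have "cpoly r x = cpoly 0 x" using root assms unfolding qr(1) cpoly_simps by simp
  moreover have "degree r < n" using qr(2) n_pos by (auto simp: n_def)
  ultimately have "r = 0" using n_pos by (intro cpoly_inj) auto
  then have "h = f * q" using qr(1) by simp
  then show ?thesis by (rule that)
qed

lemma no_integer_root:
  assumes "n \<ge> 2"
  shows "poly f k \<noteq> 0"
proof
  assume "poly f k = 0"
  then have "poly fq (of_int k) = 0" by simp
  then have "[:- of_int k, 1:] dvd fq" by (simp only: poly_eq_0_iff_dvd)
  then obtain q where q: "fq = [:- of_int k, 1:] * q" by (rule dvdE)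
  then have q0: "q \<noteq> 0" using degree_fq n_pos by auto
  have "[:- of_int k, 1:] dvd (1 :: rat poly) \<or> q dvd 1"
    using Factorial_Ring.irreducibleD[OF irred q] .
  then have "degree q = 0" using q0 by (auto simp: is_unit_iff_degree)
  moreover have "degree fq = 1 + degree q" unfolding q using q0 by (subst degree_mult_eq) auto
  ultimately show False using assms degree_fq by simp
qed

text \<open>For \<open>D = {1}\<close> this is \<open>int_adjoin x\<close>, for the integers prime
  to \<open>p\<close> its localization at \<open>p\<close>; one index computation then serves
  both.\<close>

definition localized :: "int set \<Rightarrow> complex set" where
  "localized D = {z. \<exists>m\<in>D. \<exists>h. of_int m * z = cpoly h x}"

context
  fixes D :: "int set"
  assumes one_D: "1 \<in> D" and mult_D: "\<And>k m. k \<in> D \<Longrightarrow> m \<in> D \<Longrightarrow> k * m \<in> D" and zero_D: "0 \<notin> D"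
begin

lemma localizedE:
  assumes "z \<in> localized D"
  obtains m h where "m \<in> D" "degree h < n" "of_int m * z = cpoly h x"
proof -
  obtain m g where g: "m \<in> D" "of_int m * z = cpoly g x" using assms by (auto simp: localized_def)
  obtain h where "degree h < n" "cpoly h x = cpoly g x" using cpoly_reduce by blast
  then show ?thesis using that g by metis
qed

lemma cpoly_localized: "cpoly h x \<in> localized D"
  unfolding localized_def using one_D by (auto intro!: bexI[of _ 1])

lemma localized_diff:
  assumes "y \<in> localized D" "z \<in> localized D"
  shows "y - z \<in> localized D"
proof -
  obtain k g where g: "k \<in> D" "of_int k * y = cpoly g x" using assms(1) by (auto simp: localized_def)
  obtain m h where h: "m \<in> D" "of_int m * z = cpoly h x" using assms(2) by (auto simp: localized_def)
  have "of_int (k * m) * (y - z) = of_int m * (of_int k * y) - of_int k * (of_int m * z)" by (simp add: algebra_simps)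
  also have "\<dots> = cpoly (Polynomial.smult m g - Polynomial.smult k h) x" by (simp only: g h cpoly_simps)
  finally show ?thesis unfolding localized_def using mult_D[OF g(1) h(1)] by blast
qed

lemma localized_mult:
  assumes "y \<in> localized D" "z \<in> localized D"
  shows "y * z \<in> localized D"
proof -
  obtain k g where g: "k \<in> D" "of_int k * y = cpoly g x" using assms(1) by (auto simp: localized_def)
  obtain m h where h: "m \<in> D" "of_int m * z = cpoly h x" using assms(2) by (auto simp: localized_def)
  have "of_int (k * m) * (y * z) = (of_int k * y) * (of_int m * z)" by (simp add: algebra_simps)
  also have "\<dots> = cpoly (g * h) x" by (simp only: g h cpoly_simps)
  finally show ?thesis unfolding localized_def using mult_D[OF g(1) h(1)] by blast
qed

lemma localized_closed: "add_closed (localized D)"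
  using localized_diff cpoly_localized[of 0] by (simp add: add_closed_def)

lemma of_int_localized: "of_int m \<in> localized D"
  using cpoly_localized[of "[:m:]"] by (simp add: cpoly_simps)

lemma localized_scaled_closed: "add_closed ((*) c ` localized D)"
  by (rule add_closed_image[OF localized_closed]) (simp add: right_diff_distrib)

lemma localized_inverse_mod:
  assumes "m \<in> D" "coprime m k" "z \<in> localized D"
  obtains u where "z - of_int u * (of_int m * z) \<in> (*) (of_int k) ` localized D"
proof -
  obtain u where "[m * u = 1] (mod k)" using cong_solve_coprime_int assms(2) by blast
  then obtain w where w: "1 - m * u = k * w" by (metis cong_iff_dvd_diff cong_sym dvdE)
  have "z - of_int u * (of_int m * z) = of_int (1 - m * u) * z" by (simp add: algebra_simps)
  also have "\<dots> = of_int k * (of_int w * z)" unfolding w by (simp add: mult.assoc)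
  finally show ?thesis using localized_mult[OF of_int_localized assms(3)] that by (metis imageI)
qed

text \<open>The classes are represented by the values at \<open>x\<close> of polynomials of degree
  below \<open>n\<close> with coefficients in \<open>{..<k}\<close>; denominators from
  \<open>D\<close> are invertible modulo \<open>k\<close>.\<close>

lemma idx_localized_int:
  fixes k :: nat
  assumes k: "k > 0" and cop: "\<And>m. m \<in> D \<Longrightarrow> coprime m (int k)"
  shows "idx (localized D) ((*) (of_nat k) ` localized D) = k ^ n"
proof -
  let ?B = "localized D" and ?kB = "(*) (of_int (int k)) ` localized D"
  let ?F = "{..<n} \<rightarrow>\<^sub>E {..<k}"
  define P where "P c = (\<Sum>i<n. Polynomial.monom (int (c i)) i)" for c :: "nat \<Rightarrow> nat"
  have cP: "Polynomial.coeff (P c) i = (if i < n then int (c i) else 0)" for c i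
    by (simp add: P_def coeff_sum)
  have degP: "degree (P c) < n" for c
    unfolding P_def using n_pos by (intro degree_sum_less) (auto intro: le_less_trans[OF degree_monom_le])
  have uniq: "c = c'" if c: "c \<in> ?F" "c' \<in> ?F" and d: "cpoly (P c) x - cpoly (P c') x \<in> ?kB" for c c'
  proof -
    obtain z where z: "z \<in> ?B" "cpoly (P c) x - cpoly (P c') x = of_int (int k) * z" using d by blast
    obtain m h where h: "m \<in> D" "degree h < n" "of_int m * z = cpoly h x" using localizedE[OF z(1)] by blast
    have "of_int m * (cpoly (P c) x - cpoly (P c') x) = of_int (int k) * (of_int m * z)"
      unfolding z(2) by (simp only: mult.left_commute)
    then have "cpoly (Polynomial.smult m (P c - P c')) x = cpoly (Polynomial.smult (int k) h) x"
      by (simp only: cpoly_simps h(3))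
    moreover have "degree (Polynomial.smult m (P c - P c')) < n"
      using degP degree_diff_less[of "P c" n "P c'"] by (intro le_less_trans[OF degree_smult_le]) auto
    moreover have "degree (Polynomial.smult (int k) h) < n"
      using h(2) by (intro le_less_trans[OF degree_smult_le])
    ultimately have e: "Polynomial.smult m (P c - P c') = Polynomial.smult (int k) h" by (intro cpoly_inj)
    have "c i = c' i" if i: "i < n" for i
    proof (rule ccontr)
      assume ne: "c i \<noteq> c' i"
      have "Polynomial.coeff (Polynomial.smult m (P c - P c')) i = Polynomial.coeff (Polynomial.smult (int k) h) i"
        by (rule arg_cong[OF e])
      then have "m * (int (c i) - int (c' i)) = int k * Polynomial.coeff h i" using i by (simp add: cP)
      then have "int k dvd m * (int (c i) - int (c' i))" by simp
      then have "int k dvd int (c i) - int (c' i)"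
        using cop[OF h(1)] by (simp add: coprime_dvd_mult_right_iff coprime_commute)
      moreover have "c i < k" "c' i < k" using c i by auto
      ultimately show False using int_diff_not_dvd ne by blast
    qed
    then show "c = c'" using c by (intro PiE_ext[of c "{..<n}" "\<lambda>_. {..<k}" c']) auto
  qed
  have inj: "inj_on (\<lambda>c. cpoly (P c) x) ?F"
  proof (rule inj_onI)
    fix c c' assume c: "c \<in> ?F" "c' \<in> ?F" and eq: "cpoly (P c) x = cpoly (P c') x"
    have "0 \<in> ?kB" using add_closed_0[OF localized_scaled_closed] .
    then show "c = c'" using uniq[OF c] eq by simp
  qed
  have "idx ?B ?kB = card ((\<lambda>c. cpoly (P c) x) ` ?F)"
  proof (rule idx_eq_card_reps[OF localized_scaled_closed])
    show "(\<lambda>c. cpoly (P c) x) ` ?F \<subseteq> ?B" using cpoly_localized by blast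
    fix z assume z: "z \<in> ?B"
    obtain m h where h: "m \<in> D" "degree h < n" "of_int m * z = cpoly h x" using localizedE[OF z] by blast
    obtain u where u: "z - of_int u * (of_int m * z) \<in> ?kB" using localized_inverse_mod[OF h(1) cop[OF h(1)] z] by blast
    define c where "c = (\<lambda>i\<in>{..<n}. nat (Polynomial.coeff (Polynomial.smult u h) i mod int k))"
    have cF: "c \<in> ?F" using k by (auto simp: c_def nat_less_iff)
    have "int k dvd Polynomial.coeff (Polynomial.smult u h - P c) i" for i
    proof (cases "i < n")
      case True
      then have "Polynomial.coeff (P c) i = Polynomial.coeff (Polynomial.smult u h) i mod int k" using k by (simp add: cP c_def)
      then show ?thesis unfolding coeff_diff by (simp add: mod_eq_dvd_iff[symmetric])
    next
      case False
      then have "Polynomial.coeff h i = 0" using h(2) by (intro coeff_eq_0) simp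
      then show ?thesis using False by (simp add: cP)
    qed
    then have "[:int k:] dvd Polynomial.smult u h - P c" by (simp add: const_poly_dvd_iff)
    then obtain q where q: "Polynomial.smult u h - P c = [:int k:] * q" by (auto simp: dvd_def)
    have "of_int u * (of_int m * z) - cpoly (P c) x = cpoly (Polynomial.smult u h - P c) x"
      by (simp only: h(3) cpoly_simps)
    also have "\<dots> = of_int (int k) * cpoly q x" by (simp only: q cpoly_simps) simp
    finally have "of_int u * (of_int m * z) - cpoly (P c) x \<in> ?kB" using cpoly_localized[of q] by (metis imageI)
    then have "(z - of_int u * (of_int m * z)) + (of_int u * (of_int m * z) - cpoly (P c) x) \<in> ?kB"
      by (rule add_closed_add[OF localized_scaled_closed u])
    then have "z - cpoly (P c) x \<in> ?kB" by simp
    then show "\<exists>r\<in>(\<lambda>c. cpoly (P c) x) ` ?F. z - r \<in> ?kB" using cF by blast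
  qed (use uniq in blast)
  also have "\<dots> = card ?F" using inj by (rule card_image)
  also have "\<dots> = k ^ n" by (simp add: card_PiE)
  finally show ?thesis by simp
qed

end

lemma rat_adjoin_closed:
  assumes "y \<in> rat_adjoin x" "z \<in> rat_adjoin x"
  shows "y - z \<in> rat_adjoin x" "y * z \<in> rat_adjoin x"
proof -
  obtain g h where gh: "y = qpoly g x" "z = qpoly h x" using assms unfolding rat_adjoin_eq by blast
  have "y - z = qpoly (g - h) x" "y * z = qpoly (g * h) x" by (simp_all only: gh qpoly_simps)
  then show "y - z \<in> rat_adjoin x" "y * z \<in> rat_adjoin x" unfolding rat_adjoin_eq by blast+
qed

lemma rat_in_rat_adjoin: "of_rat r \<in> rat_adjoin x"
proof -
  have "of_rat r = qpoly [:r:] x" by (simp add: qpoly_simps)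
  then show ?thesis unfolding rat_adjoin_eq by blast
qed

lemma cpoly_in_rat_adjoin:
  assumes "y \<in> rat_adjoin x" shows "cpoly h y \<in> rat_adjoin x"
proof (induction h)
  case 0
  then show ?case using rat_in_rat_adjoin[of 0] by simp
next
  case (pCons a h)
  have "of_int a - (- (y * cpoly h y)) \<in> rat_adjoin x"
    using rat_adjoin_closed rat_in_rat_adjoin[of "of_int a"] rat_in_rat_adjoin[of 0] assms pCons.IH
    by (metis of_rat_0 of_rat_of_int_eq diff_0)
  then show ?case unfolding cpoly_simps by simp
qed

text \<open>\<open>Zp\<close> is \<open>\<int>\<^sub>(\<^sub>p\<^sub>)[x]\<close>, and \<open>Op\<close> is the localization at \<open>p\<close> of the ring of integers of \<open>\<rat>(x)\<close>.\<close>

context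
  fixes p :: nat
  assumes p_prime: "Factorial_Ring.prime p"
begin

abbreviation units_p :: "int set" where "units_p \<equiv> {m. \<not> int p dvd m}"

abbreviation Zp :: "complex set" where "Zp \<equiv> localized units_p"

definition Op :: "complex set" where
  "Op = {z \<in> rat_adjoin x. \<exists>m\<in>units_p. algebraic_int (of_int m * z)}"

lemma p_gt_1: "p > 1" using p_prime by (rule prime_gt_1_nat)

lemma units_p: "1 \<in> units_p" "\<And>k m. k \<in> units_p \<Longrightarrow> m \<in> units_p \<Longrightarrow> k * m \<in> units_p" "0 \<notin> units_p"
  using p_gt_1 p_prime by (auto simp: prime_dvd_mult_iff)

lemma units_p_coprime:
  assumes "m \<in> units_p" shows "coprime m (int p)"
proof -
  have "Factorial_Ring.prime (int p)" using p_prime by simp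
  then have "coprime (int p) m" using assms by (intro prime_imp_coprime) auto
  then show ?thesis by (simp only: coprime_commute)
qed

lemma Zp_closed: "add_closed Zp"
  by (rule localized_closed) (use units_p in auto)

lemma Zp_scaled_closed: "add_closed ((*) c ` Zp)"
  by (rule localized_scaled_closed) (use units_p in auto)

lemma Zp_mult: "y \<in> Zp \<Longrightarrow> z \<in> Zp \<Longrightarrow> y * z \<in> Zp"
  by (rule localized_mult) (use units_p in auto)

lemma cpoly_Zp: "cpoly h x \<in> Zp"
  by (rule cpoly_localized) (use units_p in auto)

lemma of_int_Zp: "of_int k \<in> Zp"
  by (rule of_int_localized) (use units_p in auto)

lemma idx_Zp_p: "idx Zp ((*) (of_nat p) ` Zp) = p ^ n"
  by (rule idx_localized_int) (use units_p units_p_coprime p_gt_1 in auto)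

lemma p_decomp:
  assumes "k \<noteq> 0"
  obtains u where "k = int p ^ multiplicity (int p) k * u" "u \<in> units_p"
proof -
  have "\<not> is_unit (int p)" using p_gt_1 by simp
  then show ?thesis using multiplicity_decompose'[OF assms] that by (metis mem_Collect_eq)
qed

lemma algebraic_int_in_Op: "y \<in> rat_adjoin x \<Longrightarrow> algebraic_int y \<Longrightarrow> y \<in> Op"
  unfolding Op_def using units_p(1) by (intro CollectI conjI bexI[of _ 1]) simp_all

lemma Op_closed:
  assumes "y \<in> Op" "z \<in> Op"
  shows "y - z \<in> Op" "y * z \<in> Op"
proof -
  obtain k where k: "y \<in> rat_adjoin x" "k \<in> units_p" "algebraic_int (of_int k * y)" using assms(1) by (auto simp: Op_def)
  obtain m where m: "z \<in> rat_adjoin x" "m \<in> units_p" "algebraic_int (of_int m * z)" using assms(2) by (auto simp: Op_def)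
  have "algebraic_int (of_int m * (of_int k * y) - of_int k * (of_int m * z))"
    by (intro algebraic_int_diff algebraic_int_add_mult k m) auto
  also have "of_int m * (of_int k * y) - of_int k * (of_int m * z) = of_int (k * m) * (y - z)" by (simp add: algebra_simps)
  finally show "y - z \<in> Op" unfolding Op_def using rat_adjoin_closed(1)[OF k(1) m(1)] units_p(2)[OF k(2) m(2)] by blast
  have "algebraic_int ((of_int k * y) * (of_int m * z))" by (intro algebraic_int_add_mult k m)
  also have "(of_int k * y) * (of_int m * z) = of_int (k * m) * (y * z)" by (simp add: algebra_simps)
  finally show "y * z \<in> Op" unfolding Op_def using rat_adjoin_closed(2)[OF k(1) m(1)] units_p(2)[OF k(2) m(2)] by blast
qed

lemma Op_add_closed: "add_closed Op"
proof -
  have "0 \<in> Op" using rat_in_rat_adjoin[of 0] by (intro algebraic_int_in_Op) auto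
  then show ?thesis using Op_closed(1) by (simp add: add_closed_def)
qed

lemma Zp_subset_Op: "Zp \<subseteq> Op"
proof
  fix z assume "z \<in> Zp"
  then obtain m h where m: "m \<in> units_p" "of_int m * z = cpoly h x" by (auto simp: localized_def)
  have m0: "m \<noteq> 0" using m(1) by auto
  have "z = qpoly (Polynomial.smult (inverse (of_int m)) (map_poly of_int h)) x"
    using m(2) m0 by (simp add: qpoly_simps(4) qpoly_of_int of_rat_inverse of_rat_divide field_simps)
  then have "z \<in> rat_adjoin x" unfolding rat_adjoin_eq by blast
  moreover have "algebraic_int (of_int m * z)" unfolding m(2) by (rule algebraic_int_cpoly[OF algebraic_int_x])
  ultimately show "z \<in> Op" using m(1) by (auto simp: Op_def)
qed

lemma idx_Zp_p_power: "idx Zp ((*) (of_nat p ^ j) ` Zp) = (p ^ n) ^ j"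
proof (induction j)
  case 0
  then show ?case using idx_eq_1_iff[OF Zp_closed Zp_closed] by simp
next
  case (Suc j)
  note C = Zp_closed Zp_scaled_closed
  have e: "(*) (of_nat p ^ Suc j) ` Zp = (*) (of_nat p) ` (*) (of_nat p ^ j) ` Zp" by (simp add: image_image mult.assoc)
  have sub: "(*) (of_nat p ^ j) ` Zp \<subseteq> Zp" for j
    using Zp_mult[OF of_int_Zp[of "int p ^ j"]] by auto
  have "idx Zp ((*) (of_nat p ^ Suc j) ` Zp)
      = idx Zp ((*) (of_nat p) ` Zp) * idx ((*) (of_nat p) ` Zp) ((*) (of_nat p ^ Suc j) ` Zp)"
  proof (rule idx_tower[OF C(1) C(2) C(2)])
    show "(*) (of_nat p ^ Suc j) ` Zp \<subseteq> (*) (of_nat p) ` Zp" unfolding e by (rule image_mono[OF sub])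
    show "(*) (of_nat p) ` Zp \<subseteq> Zp" using sub[of 1] by simp
  qed
  also have "idx ((*) (of_nat p) ` Zp) ((*) (of_nat p ^ Suc j) ` Zp) = idx Zp ((*) (of_nat p ^ j) ` Zp)"
    unfolding e using p_gt_1 by (intro idx_image[OF C(2)]) (auto simp: right_diff_distrib inj_def)
  also have "idx Zp ((*) (of_nat p) ` Zp) = p ^ n"
    by (rule idx_Zp_p)
  finally show ?case using Suc.IH by simp
qed

text \<open>The \<open>p\<close>-part of the conductor multiplies \<open>Op\<close> into
  \<open>Zp\<close>, the rest of it being a unit. So \<open>idx Op Zp\<close> divides the index of
  \<open>p ^ j * Zp\<close> in \<open>Zp\<close>, a power of \<open>p\<close>.\<close>

lemma idx_Op_Zp_pos: "idx Op Zp > 0"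
proof -
  note C = Zp_closed Zp_scaled_closed
  obtain N :: int where N: "N > 0" "\<And>g. degree g < n \<Longrightarrow> algebraic_int (qpoly g x) \<Longrightarrow>
      \<exists>h. Polynomial.smult (of_int N) g = map_poly of_int h" using conductor by metis
  define j where "j = multiplicity (int p) N"
  obtain u where u: "N = int p ^ j * u" "u \<in> units_p" using p_decomp[of N] N(1) unfolding j_def by blast
  let ?P = "of_nat p ^ j :: complex"
  have P0: "?P \<noteq> 0" using p_gt_1 by simp
  have sub: "(*) ?P ` Op \<subseteq> Zp"
  proof
    fix w assume "w \<in> (*) ?P ` Op"
    then obtain z where z: "z \<in> Op" "w = ?P * z" by blast
    then obtain m where m: "z \<in> rat_adjoin x" "m \<in> units_p" "algebraic_int (of_int m * z)" by (auto simp: Op_def)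
    have "of_int m * z \<in> rat_adjoin x" using rat_adjoin_closed(2)[OF rat_in_rat_adjoin m(1), of "of_int m"] by simp
    then obtain g0 where g0: "of_int m * z = qpoly g0 x" unfolding rat_adjoin_eq by blast
    obtain g where g: "degree g < n" "qpoly g x = qpoly g0 x" using qpoly_reduce by blast
    obtain h where h: "Polynomial.smult (of_int N) g = map_poly of_int h" using N(2)[OF g(1)] m(3) g0 g(2) by auto
    have "of_int (u * m) * w = of_int N * (of_int m * z)" unfolding z(2) u(1) by (simp add: mult_ac)
    also have "\<dots> = qpoly (Polynomial.smult (of_int N) g) x" unfolding g0 g(2)[symmetric] by (simp add: qpoly_simps(4))
    also have "\<dots> = cpoly h x" unfolding h by (rule qpoly_of_int)
    finally show "w \<in> Zp" unfolding localized_def using units_p(2)[OF u(2) m(2)] by blast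
  qed
  have "idx Zp ((*) ?P ` Zp) = idx Zp ((*) ?P ` Op) * idx ((*) ?P ` Op) ((*) ?P ` Zp)"
    by (rule idx_tower[OF C(1) _ C(2) image_mono[OF Zp_subset_Op] sub])
      (rule add_closed_image[OF Op_add_closed], simp add: right_diff_distrib)
  also have "idx ((*) ?P ` Op) ((*) ?P ` Zp) = idx Op Zp"
    using P0 by (intro idx_image[OF C(1)]) (auto simp: right_diff_distrib inj_def)
  finally have "(p ^ n) ^ j = idx Zp ((*) ?P ` Op) * idx Op Zp" using idx_Zp_p_power by simp
  then show ?thesis using p_gt_1 by (metis gr0I mult_0_right not_one_less_zero power_eq_0_iff)
qed

text \<open>\<open>Op\<close> has no explicit basis; this transfers norm computations to
  \<open>Zp\<close>, which has the basis of powers of \<open>x\<close>.\<close>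

lemma idx_Op_eq:
  assumes "c \<in> Zp" "c \<noteq> 0"
  shows "idx Op ((*) c ` Op) = idx Zp ((*) c ` Zp)"
proof (rule idx_endo_eq[OF Op_add_closed Zp_closed Zp_subset_Op])
  show "(*) c ` Op \<subseteq> Op" using Op_closed(2) assms Zp_subset_Op by blast
  show "(*) c ` Zp \<subseteq> Zp" using Zp_mult[OF assms(1)] by blast
qed (use assms idx_Op_Zp_pos in \<open>auto simp: right_diff_distrib inj_def\<close>)

text \<open>Sending \<open>x\<close> to \<open>k\<close> identifies the quotient of
  \<open>Zp\<close> by \<open>x - k\<close> with the integers localized at \<open>p\<close> modulo
  \<open>poly f k\<close>; the integers below \<open>p ^ v\<close> represent its classes.\<close>

lemma idx_Zp_linear:
  assumes fk: "poly f k \<noteq> 0"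
  shows "idx Zp ((*) (x - of_int k) ` Zp) = p ^ multiplicity (int p) (poly f k)"
proof -
  define v where "v = multiplicity (int p) (poly f k)"
  let ?a = "x - of_int k" and ?aB = "(*) (x - of_int k) ` Zp"
  obtain u where u: "poly f k = int p ^ v * u" "u \<in> units_p" using p_decomp[OF fk] unfolding v_def by blast
  have taylor: "cpoly h x - of_int (poly h k) = ?a * cpoly (synthetic_div h k) x" for h
  proof -
    have "h = [:- k, 1:] * synthetic_div h k + [:poly h k:]" by (rule synthetic_div_correct'[symmetric])
    then have "cpoly h x = cpoly ([:- k, 1:] * synthetic_div h k + [:poly h k:]) x" by (rule arg_cong)
    then show ?thesis by (simp only: cpoly_simps) simp
  qed
  have u0: "u \<noteq> 0" using u(2) by auto
  have 1: "- of_int (poly f k) = ?a * cpoly (synthetic_div f k) x" using taylor[of f] root by simp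
  have "of_int (poly f k) = - (- of_int (poly f k) :: complex)" by simp
  also have "\<dots> = ?a * (- cpoly (synthetic_div f k) x)" unfolding 1 by (simp only: mult_minus_right)
  finally have "of_int (poly f k) = ?a * (- cpoly (synthetic_div f k) x)" .
  then have "of_int (int p ^ v) = ?a * (- cpoly (synthetic_div f k) x / of_int u)"
    using u0 unfolding u(1) by (simp add: field_simps)
  moreover have w: "- cpoly (synthetic_div f k) x / of_int u \<in> Zp"
  proof -
    have "of_int u * (- cpoly (synthetic_div f k) x / of_int u) = cpoly (- synthetic_div f k) x"
      using u0 by (simp only: cpoly_simps) simp
    then show ?thesis unfolding localized_def using u(2) by blast
  qed
  ultimately have pv: "of_int (int p ^ v) * z \<in> ?aB" if "z \<in> Zp" for z
    using Zp_mult[OF w that] by (simp only: mult.assoc image_eqI)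
  have aB: "add_closed ?aB" by (rule Zp_scaled_closed)
  have cop: "coprime m (int p ^ v)" if "m \<in> units_p" for m
    using units_p_coprime[OF that] by simp
  have uniq: "r = r'" if r: "r < p ^ v" "r' < p ^ v" and d: "of_nat r - of_nat r' \<in> ?aB" for r r'
  proof (rule ccontr)
    assume ne: "r \<noteq> r'"
    obtain z where z: "z \<in> Zp" "of_nat r - of_nat r' = ?a * z" using d by blast
    obtain m h where h: "m \<in> units_p" "of_int m * z = cpoly h x" using z(1) by (auto simp: localized_def)
    define c where "c = m * (int r - int r')"
    have "of_int c = ?a * (of_int m * z)" unfolding c_def using z(2) by (simp add: mult.left_commute)
    then have "cpoly ([:- k, 1:] * h - [:c:]) x = 0" unfolding h(2) by (simp only: cpoly_simps) simp
    \<comment> \<open>Lifted from the value at \<open>x\<close> to an identity of polynomials, the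
      relation can be evaluated at \<open>k\<close>, where it says that \<open>poly f k\<close>
      divides \<open>c\<close>.\<close>
    then obtain q where q: "[:- k, 1:] * h - [:c:] = f * q" by (rule cpoly_dvd)
    have "poly ([:- k, 1:] * h - [:c:]) k = poly (f * q) k" by (simp only: q)
    then have "- c = poly f k * poly q k" by simp
    then have "int p ^ v dvd - c" unfolding u(1) by simp
    then have "int p ^ v dvd m * (int r - int r')" by (simp add: c_def)
    then have "int (p ^ v) dvd int r - int r'"
      using cop[OF h(1)] by (simp add: coprime_dvd_mult_right_iff coprime_commute)
    then show False using int_diff_not_dvd[OF r ne] by blast
  qed
  have "idx Zp ?aB = card (of_nat ` {..<p ^ v} :: complex set)"
  proof (rule idx_eq_card_reps[OF aB])
    show "of_nat ` {..<p ^ v} \<subseteq> Zp" using of_int_Zp[of "int _"] by auto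
    fix z assume z: "z \<in> Zp"
    then obtain m h where h: "m \<in> units_p" "of_int m * z = cpoly h x" by (auto simp: localized_def)
    obtain t where "[m * t = 1] (mod (int p ^ v))" using cong_solve_coprime_int cop[OF h(1)] by blast
    then obtain w where w: "1 - m * t = int p ^ v * w" by (metis cong_iff_dvd_diff cong_sym dvdE)
    define c where "c = t * poly h k"
    define r where "r = nat (c mod int (p ^ v))"
    have pv0: "p ^ v > 0" using p_gt_1 by simp
    have r: "r < p ^ v" using pv0 by (simp add: r_def nat_less_iff)
    have cr: "c = int p ^ v * (c div int p ^ v) + int r" using pv0 by (simp add: r_def)
    have "z - of_nat r = of_int (1 - m * t) * z + of_int t * (of_int m * z - of_int (poly h k)) + (of_int c - of_nat r)"
      by (simp add: c_def algebra_simps)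
    also have "of_int (1 - m * t) * z = of_int (int p ^ v) * (of_int w * z)" unfolding w by (simp add: mult.assoc)
    also have "of_int t * (of_int m * z - of_int (poly h k)) = ?a * (of_int t * cpoly (synthetic_div h k) x)"
      unfolding h(2) taylor by (simp only: mult.left_commute)
    also have "of_int c - of_nat r = (of_int (int p ^ v) * of_int (c div int p ^ v) :: complex)"
      by (subst cr) simp
    finally have "z - of_nat r = of_int (int p ^ v) * (of_int w * z) + ?a * (of_int t * cpoly (synthetic_div h k) x)
        + of_int (int p ^ v) * of_int (c div int p ^ v)" .
    moreover have "of_int (int p ^ v) * (of_int w * z) \<in> ?aB" by (intro pv Zp_mult of_int_Zp z)
    moreover have "?a * (of_int t * cpoly (synthetic_div h k) x) \<in> ?aB"
      by (intro imageI Zp_mult of_int_Zp cpoly_Zp)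
    moreover have "of_int (int p ^ v) * of_int (c div int p ^ v) \<in> ?aB" by (intro pv of_int_Zp)
    ultimately have "z - of_nat r \<in> ?aB" by (simp only: add_closed_add[OF aB])
    then show "\<exists>r\<in>of_nat ` {..<p ^ v}. z - r \<in> ?aB" using r by blast
  qed (use uniq in blast)
  also have "\<dots> = p ^ v" by (simp add: card_image inj_on_def)
  finally show ?thesis by (simp add: v_def)
qed

text \<open>Powers of the variable are cancelled from the relation until the constant term is
  nonzero; \<open>y\<close> then divides a nonzero integer.\<close>

lemma nonzero_constant_relation:
  fixes h :: "int poly"
  assumes "y \<noteq> 0"
  shows "h \<noteq> 0 \<Longrightarrow> cpoly h y = 0 \<Longrightarrow> \<exists>c g. c \<noteq> 0 \<and> of_int c = - (y * cpoly g y)"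
proof (induction h)
  case (pCons a h)
  show ?case
  proof (cases "a = 0")
    case True
    then have "cpoly h y = 0" using pCons.prems(2) assms by (simp add: cpoly_simps)
    moreover have "h \<noteq> 0" using True pCons.prems(1) by simp
    ultimately show ?thesis by (rule pCons.IH[rotated])
  next
    case False
    have "of_int a + y * cpoly h y = 0" using pCons.prems(2) by (simp only: cpoly_simps)
    then have "of_int a = - (y * cpoly h y)" by (simp only: eq_neg_iff_add_eq_0)
    then show ?thesis using False by blast
  qed
qed simp

lemma semilocal_Op: "semilocal Op p n"
proof
  show "1 \<in> Op" using rat_in_rat_adjoin[of 1] by (intro algebraic_int_in_Op) auto
  show "y - z \<in> Op" if "y \<in> Op" "z \<in> Op" for y z using Op_closed(1) that .
  show "y * z \<in> Op" if "y \<in> Op" "z \<in> Op" for y z using Op_closed(2) that .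
  show "Factorial_Ring.prime p" by (rule p_prime)
  show "inverse (of_int m) \<in> Op" if "\<not> int p dvd m" for m
  proof -
    have "m \<noteq> 0" using that by auto
    moreover have "inverse (of_int m) \<in> rat_adjoin x"
      using rat_in_rat_adjoin[of "inverse (of_int m)"] by (simp only: of_rat_inverse of_rat_of_int_eq)
    ultimately show ?thesis unfolding Op_def using that by (intro CollectI conjI bexI[of _ m]) simp_all
  qed
  show "inverse (of_nat p) \<notin> Op"
  proof
    assume "inverse (of_nat p) \<in> Op"
    then obtain m where m: "m \<in> units_p" "algebraic_int (of_int m * inverse (of_nat p) :: complex)" by (auto simp: Op_def)
    have "of_int m * inverse (of_nat p :: complex) \<in> \<rat>" by simp
    then obtain k where "of_int m * inverse (of_nat p :: complex) = of_int k"
      using rational_algebraic_int_is_int[OF m(2)] by (auto elim: Ints_cases)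
    then have "(of_int m :: complex) = of_int (int p * k)" using p_gt_1 by (simp add: field_simps)
    then have "m = int p * k" by (simp only: of_int_eq_iff)
    then show False using m(1) by simp
  qed
  show "idx Op ((*) (of_nat p) ` Op) = p ^ n"
    using idx_Op_eq[of "of_nat p"] idx_Zp_p of_int_Zp[of "int p"] p_gt_1 by simp
  show "z \<in> Op" if z: "of_nat p * z \<in> Op" and ij: "i < j" and d: "z ^ j - z ^ i \<in> Op" for z :: complex and i j :: nat
  proof -
    have "of_nat p * z \<in> rat_adjoin x" using z by (simp add: Op_def)
    then have "inverse (of_nat p) * (of_nat p * z) \<in> rat_adjoin x"
      using rat_adjoin_closed(2) rat_in_rat_adjoin[of "inverse (of_nat p)"] by (simp only: of_rat_inverse of_rat_of_nat_eq)
    then have zK: "z \<in> rat_adjoin x" using p_gt_1 by (simp add: mult.assoc[symmetric])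
    obtain m where m: "m \<in> units_p" "algebraic_int (of_int m * (z ^ j - z ^ i))" using d by (auto simp: Op_def)
    \<comment> \<open>Homogenizing \<open>X ^ j - X ^ i\<close> gives a monic polynomial with value
      \<open>m ^ j * (z ^ j - z ^ i)\<close> at \<open>m * z\<close>, an algebraic integer; hence
      \<open>m * z\<close> is one too.\<close>
    define P where "P = (Polynomial.monom 1 j - Polynomial.monom (of_int (m ^ (j - i))) i :: complex poly)"
    have cP: "Polynomial.coeff P l = (if l = j then 1 else 0) - (if l = i then of_int (m ^ (j - i)) else 0)" for l
      by (simp add: P_def)
    have degP: "degree P = j"
    proof (rule antisym)
      show "degree P \<le> j" by (rule degree_le) (use ij in \<open>auto simp: cP\<close>)
      show "j \<le> degree P" by (rule le_degree) (use ij in \<open>simp add: cP\<close>)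
    qed
    have "(of_int m :: complex) ^ j = of_int m ^ (j - i) * of_int m ^ i" using ij by (simp flip: power_add)
    then have "poly P (of_int m * z) = of_int (m ^ j) * (z ^ j - z ^ i)"
      by (simp add: P_def poly_monom power_mult_distrib algebra_simps)
    also have "\<dots> = of_int (m ^ (j - 1)) * (of_int m * (z ^ j - z ^ i))" using ij by (cases j) simp_all
    finally have e: "poly P (of_int m * z) = of_int (m ^ (j - 1)) * (of_int m * (z ^ j - z ^ i))" .
    have "algebraic_int (of_int (m ^ (j - 1)) * (of_int m * (z ^ j - z ^ i)))"
      by (intro algebraic_int_add_mult m algebraic_int_of_int)
    then have "algebraic_int (of_int m * z)"
      by (rule algebraic_int_root[OF _ e]) (use ij in \<open>auto simp: cP degP\<close>)
    then show ?thesis using zK m(1) by (auto simp: Op_def)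
  qed
  show "\<exists>l. of_nat p ^ l / z \<in> Op" if z: "z \<in> Op" "z \<noteq> 0" for z
  proof -
    obtain m where m: "z \<in> rat_adjoin x" "m \<in> units_p" "algebraic_int (of_int m * z)" using z(1) by (auto simp: Op_def)
    let ?w = "of_int m * z"
    have m0: "m \<noteq> 0" using m(2) by auto
    have w0: "?w \<noteq> 0" using m0 z(2) by simp
    have wK: "?w \<in> rat_adjoin x" using rat_adjoin_closed(2)[OF rat_in_rat_adjoin m(1), of "of_int m"] by simp
    obtain h :: "int poly" where h: "cpoly h ?w = 0" "lead_coeff h = 1"
      using m(3) unfolding algebraic_int_altdef_ipoly by blast
    have "h \<noteq> 0" using h(2) by auto
    \<comment> \<open>The nonzero integer \<open>c\<close> is a multiple of \<open>z\<close>; its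
      \<open>p\<close>-part is the desired power and the remaining factor \<open>u\<close> is a unit
      of \<open>Op\<close>.\<close>
    obtain c g where c: "c \<noteq> 0" "of_int c = - (?w * cpoly g ?w)"
      using nonzero_constant_relation[OF w0 \<open>h \<noteq> 0\<close> h(1)] by blast
    define l where "l = multiplicity (int p) c"
    obtain u where u: "c = int p ^ l * u" "u \<in> units_p" using p_decomp[OF c(1)] unfolding l_def by blast
    have u0: "u \<noteq> 0" using u(2) by auto
    have "of_int (int p ^ l) * of_int u = - (z * (of_int m * cpoly g ?w))" using c(2) unfolding u(1) by (simp add: mult_ac)
    then have "of_int u * (of_nat p ^ l / z) = - (of_int m * cpoly g ?w)" using z(2) by (simp add: field_simps)
    moreover have alg: "algebraic_int (- (of_int m * cpoly g ?w))"
      by (intro algebraic_int_minus algebraic_int_add_mult algebraic_int_cpoly m(3) algebraic_int_of_int)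
    ultimately have 1: "algebraic_int (of_int u * (of_nat p ^ l / z))" by simp
    have "- (of_int m * cpoly g ?w) = 0 - of_int m * cpoly g ?w" by simp
    moreover have "0 - of_int m * cpoly g ?w \<in> rat_adjoin x"
      using rat_adjoin_closed cpoly_in_rat_adjoin[OF wK] rat_in_rat_adjoin[of 0] rat_in_rat_adjoin[of "of_int m"]
      by (metis of_rat_0 of_rat_of_int_eq)
    ultimately have "inverse (of_int u) * (of_int u * (of_nat p ^ l / z)) \<in> rat_adjoin x"
      using rat_adjoin_closed(2)[OF rat_in_rat_adjoin, of "- (of_int m * cpoly g ?w)" "inverse (of_int u)"]
        \<open>of_int u * (of_nat p ^ l / z) = - (of_int m * cpoly g ?w)\<close>
      by (simp only: of_rat_inverse of_rat_of_int_eq)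
    moreover have "inverse (of_int u) * (of_int u * (of_nat p ^ l / z)) = of_nat p ^ l / z" using u0 by simp
    ultimately have "of_nat p ^ l / z \<in> rat_adjoin x" by (simp only:)
    then show ?thesis unfolding Op_def using 1 u(2) by blast
  qed
qed

end

end

section \<open>Indices of generators\<close>

context
begin

text \<open>Dimension counts over the rationals inside the complex numbers take the place of degrees
  of field extensions.\<close>

interpretation Q: vector_space "\<lambda>(q::rat) (z::complex). of_rat q * z"
  by standard (simp_all add: algebra_simps of_rat_add of_rat_mult)

lemma qpoly_in_span:
  assumes "degree h < n"
  shows "qpoly h z \<in> Q.span ((\<lambda>i. z ^ i) ` {..<n})"
proof -
  have "qpoly h z = (\<Sum>i\<le>degree h. of_rat (Polynomial.coeff h i) * z ^ i)"
    by (simp add: poly_altdef)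
  also have "\<dots> \<in> Q.span ((\<lambda>i. z ^ i) ` {..<n})"
    using assms by (intro Q.span_sum Q.span_scale Q.span_base) auto
  finally show ?thesis .
qed

lemma qpoly_sum_monom: "qpoly (\<Sum>i<(n::nat). Polynomial.monom (c i) i) y = (\<Sum>i<n. of_rat (c i) * y ^ i)"
  by (induction n) (simp_all add: qpoly_simps poly_monom)

lemma independent_powers:
  assumes n: "n > 0" and indep: "\<And>g :: rat poly. degree g < n \<Longrightarrow> qpoly g y = 0 \<Longrightarrow> g = 0"
  shows "inj_on (\<lambda>i. y ^ i) {..<n}" "Q.independent ((\<lambda>i. y ^ i) ` {..<n})"
proof -
  have zero: "c i = 0" if c: "(\<Sum>i<n. of_rat (c i) * y ^ i) = 0" "i < n" for c i
  proof -
    define g :: "rat poly" where "g = (\<Sum>i<n. Polynomial.monom (c i) i)"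
    have "degree g < n" unfolding g_def using n by (intro degree_sum_less) (auto intro: le_less_trans[OF degree_monom_le])
    moreover have "qpoly g y = 0" unfolding g_def qpoly_sum_monom by (rule c(1))
    ultimately have "g = 0" by (rule indep)
    then have "Polynomial.coeff g i = 0" by simp
    then show "c i = 0" using c(2) by (simp add: g_def coeff_sum)
  qed
  show inj: "inj_on (\<lambda>i. y ^ i) {..<n}"
  proof (rule inj_onI, rule ccontr)
    fix i j assume ij: "i \<in> {..<n}" "j \<in> {..<n}" "y ^ i = y ^ j" "i \<noteq> j"
    define c where "c l = (if l = i then 1 else 0) - (if l = j then 1 else (0::rat))" for l
    have "(\<Sum>l<n. of_rat (c l) * y ^ l) = (\<Sum>l<n. (if l = i then y ^ i else 0) - (if l = j then y ^ j else 0))"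
      by (rule sum.cong) (auto simp: c_def of_rat_diff)
    also have "\<dots> = 0" using ij by (simp add: sum_subtractf)
    finally have "c i = 0" by (rule zero) (use ij in simp)
    then show False using ij(4) by (simp add: c_def)
  qed
  let ?T = "(\<lambda>i. y ^ i) ` {..<n}"
  show "Q.independent ?T" unfolding Q.dependent_finite[OF finite_imageI[OF finite_lessThan]]
  proof (intro notI, elim exE conjE bexE)
    fix c v assume c: "v \<in> ?T" "c v \<noteq> 0" "(\<Sum>v\<in>?T. of_rat (c v) * v) = 0"
    have "(\<Sum>i<n. of_rat (c (y ^ i)) * y ^ i) = 0" using c(3) by (simp add: sum.reindex[OF inj])
    then have "c (y ^ i) = 0" if "i < n" for i using zero[of "\<lambda>i. c (y ^ i)"] that by blast
    then show False using c(1,2) by auto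
  qed
qed

lemma powers_in_span:
  assumes sub: "\<And>g :: rat poly. \<exists>h. degree h < n \<and> qpoly g y = qpoly h x"
  shows "(\<lambda>i. y ^ i) ` {..<k} \<subseteq> Q.span ((\<lambda>i. x ^ i) ` {..<n})"
proof
  fix z assume "z \<in> (\<lambda>i. y ^ i) ` {..<k}"
  then obtain i where z: "z = qpoly (Polynomial.monom 1 i) y" by (auto simp: poly_monom)
  obtain h where "degree h < n" "qpoly (Polynomial.monom 1 i) y = qpoly h x" using sub by blast
  then show "z \<in> Q.span ((\<lambda>i. x ^ i) ` {..<n})" unfolding z using qpoly_in_span by simp
qed

lemma independent_powers_le:
  assumes k: "k > 0" and indep: "\<And>g :: rat poly. degree g < k \<Longrightarrow> qpoly g y = 0 \<Longrightarrow> g = 0"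
    and sub: "\<And>g :: rat poly. \<exists>h. degree h < n \<and> qpoly g y = qpoly h x"
  shows "k \<le> n"
proof -
  have ind: "inj_on (\<lambda>i. y ^ i) {..<k}" "Q.independent ((\<lambda>i. y ^ i) ` {..<k})"
    by (rule independent_powers[OF k]; rule indep; assumption)+
  have "card ((\<lambda>i. y ^ i) ` {..<k}) \<le> card ((\<lambda>i. x ^ i) ` {..<n})"
    using Q.independent_span_bound[OF _ ind(2) powers_in_span[OF sub]] by blast
  also have "\<dots> \<le> n" using card_image_le[of "{..<n}" "\<lambda>i. x ^ i"] by simp
  finally show ?thesis using ind(1) by (simp add: card_image)
qed

text \<open>Both families have \<open>n\<close> members, so the independent powers of
  \<open>y\<close> cannot be extended inside the span of the powers of \<open>x\<close>. That span
  contains \<open>x\<close> itself, since \<open>n \<ge> 2\<close>.\<close>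

lemma independent_powers_generate:
  assumes n2: "n \<ge> 2" and indep: "\<And>g :: rat poly. degree g < n \<Longrightarrow> qpoly g y = 0 \<Longrightarrow> g = 0"
    and sub: "\<And>g :: rat poly. \<exists>h. degree h < n \<and> qpoly g y = qpoly h x"
  shows "\<exists>g. x = qpoly g y"
proof -
  let ?T = "(\<lambda>i. y ^ i) ` {..<n}" and ?S = "(\<lambda>i. x ^ i) ` {..<n}"
  have "n > 0" using n2 by simp
  have ind: "inj_on (\<lambda>i. y ^ i) {..<n}" "Q.independent ((\<lambda>i. y ^ i) ` {..<n})"
    by (rule independent_powers[OF \<open>n > 0\<close>]; rule indep; assumption)+
  have xT: "x \<in> ?T" if insT: "Q.independent (insert x ?T)"
  proof (rule ccontr)
    assume x: "x \<notin> ?T"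
    have "x ^ 1 \<in> ?S" using n2 by (intro imageI) simp
    then have "x \<in> Q.span ?S" by (simp add: Q.span_base)
    then have "insert x ?T \<subseteq> Q.span ?S" using powers_in_span[OF sub] by simp
    then have "card (insert x ?T) \<le> card ?S"
      using Q.independent_span_bound[OF _ insT] by blast
    moreover have "card ?S \<le> n" using card_image_le[of "{..<n}" "\<lambda>i. x ^ i"] by simp
    ultimately show False using x ind(1) by (simp add: card_image)
  qed
  have "x \<in> Q.span ?T"
  proof (rule ccontr)
    assume x: "x \<notin> Q.span ?T"
    then have "Q.independent (insert x ?T)" using ind(2) by (rule Q.independent_insertI)
    then have "x \<in> ?T" by (rule xT)
    then show False using x Q.span_base[of x ?T] by simp
  qed
  then obtain c where "x = (\<Sum>v\<in>?T. of_rat (c v) * v)" using Q.span_finite[of ?T] by auto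
  then have "x = (\<Sum>i<n. of_rat (c (y ^ i)) * y ^ i)" by (simp add: sum.reindex[OF ind(1)])
  then show ?thesis unfolding qpoly_sum_monom[symmetric] by blast
qed

end

lemma element_index_eq: "element_index K y = idx (ring_of_integers K) (int_adjoin y)"
proof -
  have "a_rcosets\<^bsub>complex_ring\<lparr>carrier := ring_of_integers K\<rparr>\<^esub> (int_adjoin y)
      = coset_of (int_adjoin y) ` ring_of_integers K"
  proof -
    have "(\<Union>h\<in>int_adjoin y. {h + a}) = coset_of (int_adjoin y) a" for a
      by (force simp: coset_of_def)
    then show ?thesis by (auto simp: A_RCOSETS_def' a_r_coset_def' ring_of_type_algebra_def)
  qed
  then show ?thesis by (simp add: element_index_def idx_def)
qed

text \<open>By \<open>indep\<close>, \<open>p * w \<in> S\<close> forces \<open>w \<in> S\<close>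
  for integral \<open>w\<close>. The conductor can thus be stripped of its \<open>p\<close>-part,
  leaving \<open>k\<close> prime to \<open>p\<close> with \<open>k * R\<close> inside
  \<open>S\<close>; since \<open>S\<close> contains \<open>k * R\<close> and this contains
  \<open>k * S\<close>, the index of \<open>S\<close> in \<open>R\<close> divides
  \<open>k ^ n\<close>.\<close>

lemma (in monic_root) not_dvd_element_index:
  assumes p: "Factorial_Ring.prime p"
    and indep: "\<And>h w i. degree h < n \<Longrightarrow> cpoly h x = of_nat p * w \<Longrightarrow> algebraic_int w \<Longrightarrow> w \<in> rat_adjoin x
      \<Longrightarrow> int p dvd Polynomial.coeff h i"
  shows "\<not> p dvd element_index (rat_adjoin x) x"
proof -
  define R where "R = ring_of_integers (rat_adjoin x)"
  define S where "S = localized {1}"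
  have S_eq: "S = int_adjoin x" by (auto simp: S_def localized_def int_adjoin_eq)
  have S_closed: "add_closed S" unfolding S_def by (rule localized_closed) auto
  have S_scaled: "add_closed ((*) c ` S)" for c unfolding S_def by (rule localized_scaled_closed) auto
  have R_closed: "add_closed R" unfolding add_closed_def R_def ring_of_integers_def
    using rat_adjoin_closed(1) rat_in_rat_adjoin[of 0] by (auto intro: algebraic_int_diff)
  have R_scaled: "add_closed ((*) c ` R)" for c
    by (rule add_closed_image[OF R_closed]) (simp add: right_diff_distrib)
  have xK: "x \<in> rat_adjoin x" unfolding rat_adjoin_eq by (rule image_eqI[of _ _ "[:0, 1:]"]) simp_all
  have SR: "S \<subseteq> R"
    unfolding S_eq int_adjoin_eq R_def ring_of_integers_def
    using cpoly_in_rat_adjoin[OF xK] algebraic_int_cpoly[OF algebraic_int_x] by auto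
  have R_int: "of_int k * z \<in> R" if "z \<in> R" for k z
    using that rat_adjoin_closed(2)[OF rat_in_rat_adjoin[of "of_int k"], of z]
    by (auto simp: R_def ring_of_integers_def intro: algebraic_int_add_mult)
  have div_p: "w \<in> S" if w: "w \<in> R" "of_nat p * w \<in> S" for w
  proof -
    obtain h0 where h0: "of_nat p * w = cpoly h0 x" using w(2) unfolding S_eq int_adjoin_eq by blast
    obtain h where h: "degree h < n" "cpoly h x = cpoly h0 x" using cpoly_reduce by blast
    have "int p dvd Polynomial.coeff h i" for i
      by (rule indep[OF h(1), of w]) (use h(2) h0 w(1) in \<open>simp_all add: R_def ring_of_integers_def\<close>)
    then have "[:int p:] dvd h" by (simp add: const_poly_dvd_iff)
    then obtain q where q: "h = [:int p:] * q" by (rule dvdE)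
    have "of_nat p * w = of_nat p * cpoly q x"
      unfolding h0 h(2)[symmetric] q by (simp only: cpoly_simps) simp
    then have "w = cpoly q x" using p prime_gt_0_nat[OF p] by simp
    then show ?thesis unfolding S_eq int_adjoin_eq by blast
  qed
  obtain N :: int where N: "N > 0" "\<And>g. degree g < n \<Longrightarrow> algebraic_int (qpoly g x) \<Longrightarrow>
      \<exists>h. Polynomial.smult (of_int N) g = map_poly of_int h" using conductor by metis
  have NR: "of_int N * z \<in> S" if z: "z \<in> R" for z
  proof -
    have "z \<in> rat_adjoin x" using z by (simp add: R_def ring_of_integers_def)
    then obtain g0 where g0: "z = qpoly g0 x" unfolding rat_adjoin_eq by blast
    obtain g where g: "degree g < n" "qpoly g x = qpoly g0 x" using qpoly_reduce by blast
    have "algebraic_int (qpoly g x)" using z g0 g(2) by (simp add: R_def ring_of_integers_def)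
    then obtain h where h: "Polynomial.smult (of_int N) g = map_poly of_int h" using N(2)[OF g(1)] by blast
    have "of_int N * z = qpoly (Polynomial.smult (of_int N) g) x" unfolding g0 g(2)[symmetric] by (simp add: qpoly_simps(4))
    then show ?thesis unfolding h qpoly_of_int S_eq int_adjoin_eq by blast
  qed
  define j where "j = multiplicity (int p) N"
  obtain u where u: "N = int p ^ j * u" "\<not> int p dvd u"
    using p_decomp[OF p, of N] N(1) unfolding j_def by auto
  have up: "u > 0" using N(1) u(1) prime_gt_0_nat[OF p] by (simp add: zero_less_mult_iff)
  define k where "k = nat u"
  have k: "of_int u = (of_nat k :: complex)" "k > 0" "\<not> p dvd k"
    using up u(2) by (auto simp: k_def) (metis int_dvd_int_iff int_nat_eq less_imp_le)
  have kR: "of_nat k * z \<in> S" if z: "z \<in> R" for z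
  proof -
    have "of_nat p ^ i * (of_int u * z) \<in> S \<Longrightarrow> of_int u * z \<in> S" for i
    proof (induction i)
      case (Suc i)
      have "of_nat p ^ i * (of_int u * z) \<in> R" using R_int[OF R_int[OF z], of "int p ^ i" u] by simp
      moreover have "of_nat p * (of_nat p ^ i * (of_int u * z)) \<in> S" using Suc.prems by (simp add: mult.assoc)
      ultimately have "of_nat p ^ i * (of_int u * z) \<in> S" by (rule div_p)
      then show ?case by (rule Suc.IH)
    qed simp
    from this[of j] show ?thesis using NR[OF z] by (simp add: u(1) k(1) mult.assoc)
  qed
  let ?k = "of_nat k :: complex"
  have "idx S ((*) ?k ` S) = idx S ((*) ?k ` R) * idx ((*) ?k ` R) ((*) ?k ` S)"
    by (rule idx_tower[OF S_closed R_scaled S_scaled image_mono[OF SR]]) (use kR in auto)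
  also have "idx ((*) ?k ` R) ((*) ?k ` S) = idx R S"
    using k(2) by (intro idx_image[OF S_closed]) (auto simp: right_diff_distrib inj_def)
  finally have "idx R S dvd idx S ((*) ?k ` S)" by simp
  also have "idx S ((*) ?k ` S) = k ^ n"
    unfolding S_def by (rule idx_localized_int) (use k in auto)
  finally have "idx R S dvd k ^ n" .
  then have "\<not> p dvd idx R S" using k(3) p by (meson dvd_trans prime_dvd_power)
  then show ?thesis by (simp add: element_index_eq R_def S_eq)
qed

theorem theorem2p1:
  fixes a b :: int and F :: "int poly" and \<theta> :: complex and K :: "complex set" and p :: nat
  assumes F_eq: "F = Polynomial.monom 1 7 + Polynomial.monom a 5 + [:b:]"
    and ab_nonzero: "a * b \<noteq> 0"
    and irred: "Factorial_Ring.irreducible (map_poly rat_of_int F)"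
    and standing: "\<And>q::nat. Factorial_Ring.prime q \<Longrightarrow>
      Factorial_Ring.multiplicity (int q) a < 2 \<or> Factorial_Ring.multiplicity (int q) b < 7"
    and root: "poly (map_poly complex_of_int F) \<theta> = 0"
    and K_eq: "K = rat_adjoin \<theta>"
    and p_prime: "Factorial_Ring.prime p"
    and p_odd: "odd p"
  shows "\<not> common_index_divisor p K"
proof -
  have cF: "Polynomial.coeff F i = (if i = 7 then 1 else if i = 5 then a else if i = 0 then b else 0)" for i
    unfolding F_eq by (auto simp: coeff_pCons split: nat.splits)
  have dF: "degree F = 7"
  proof (rule antisym)
    show "degree F \<le> 7" by (rule degree_le) (simp add: cF)
    show "7 \<le> degree F" by (rule le_degree) (simp add: cF)
  qed
  have F_poly: "poly F m = m ^ 7 + a * m ^ 5 + b" for m unfolding F_eq by (simp add: poly_monom)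
  interpret T: monic_root F \<theta> by standard (use irred root in \<open>simp_all add: dF cF\<close>)
  have n7: "T.n = 7" by (simp add: T.n_def dF)
  interpret S: semilocal "T.Op p" p 7 using T.semilocal_Op[OF p_prime] unfolding n7 .
  have \<theta>Z: "\<theta> - of_int m \<in> T.localized {m. \<not> int p dvd m}" for m
    using T.cpoly_Zp[OF p_prime, of "[:- m, 1:]"] by (simp add: cpoly_simps)
  have F0: "m ^ 7 + a * m ^ 5 + b \<noteq> 0" for m
    using T.no_integer_root[of m] n7 by (simp add: F_poly)
  have \<theta>0: "\<theta> - of_int m \<noteq> 0" for m
  proof
    assume "\<theta> - of_int m = 0"
    then have "\<theta> = of_int m" by simp
    then have "of_int (poly F m) = (0::complex)" using root by simp
    then show False using F0[of m] by (simp only: F_poly of_int_eq_0_iff)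
  qed
  have few: "card {P \<in> S.spec. S.rdeg P = 1} \<le> p"
  proof (rule S.few_primes_of_degree_one)
    show "\<theta> \<in> T.Op p" using \<theta>Z[of 0] T.Zp_subset_Op[OF p_prime] by auto
    have "poly (map_poly complex_of_int F) \<theta> = \<theta> ^ 7 + of_int a * \<theta> ^ 5 + of_int b"
      unfolding F_eq by (simp add: hom_distribs poly_monom map_poly_monom)
    then show "\<theta> ^ 7 + of_int a * \<theta> ^ 5 + of_int b = 0" using root by simp
    show "a \<noteq> 0" "b \<noteq> 0" using ab_nonzero by auto
    show "m ^ 7 + a * m ^ 5 + b \<noteq> 0" for m by (rule F0)
    \<comment> \<open>The norm in \<open>Op\<close> is replaced by the index in the commensurable
      ring \<open>Zp\<close>, where the quotient by a linear factor is explicit.\<close>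
    show "S.nrm (\<theta> - of_int m) = p ^ multiplicity (int p) (m ^ 7 + a * m ^ 5 + b)" for m
      unfolding S.nrm_def S.princ_def T.idx_Op_eq[OF p_prime \<theta>Z \<theta>0] F_poly[symmetric]
      by (rule T.idx_Zp_linear[OF p_prime]) (simp add: F_poly F0)
    show "odd p" by (rule p_odd)
  qed simp
  have p3: "p \<ge> 3" using p_odd prime_gt_1_nat[OF p_prime] by presburger
  obtain \<eta>0 where \<eta>0: "\<eta>0 \<in> T.Op p" "\<And>z. z \<in> T.Op p \<Longrightarrow> \<exists>h. z - cpoly h \<eta>0 \<in> S.princ (of_nat p)"
    using S.exists_generator_mod_pi[OF p3 _ few] by auto
  obtain m where m: "\<eta>0 \<in> rat_adjoin \<theta>" "\<not> int p dvd m" "algebraic_int (of_int m * \<eta>0)"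
    using \<eta>0(1) by (auto simp: T.Op_def[OF p_prime])
  \<comment> \<open>Multiplying \<open>\<eta>0\<close> by \<open>m * t\<close> clears its
    denominator without changing its class modulo \<open>p\<close>.\<close>
  obtain t where "[m * t = 1] (mod (int p))"
    using cong_solve_coprime_int T.units_p_coprime[OF p_prime, of m] m(2) by auto
  then obtain w where w: "m * t - 1 = int p * w" by (metis cong_iff_dvd_diff dvdE)
  define \<eta> where "\<eta> = of_int t * (of_int m * \<eta>0)"
  have \<eta>K: "\<eta> \<in> rat_adjoin \<theta>"
    unfolding \<eta>_def using T.rat_adjoin_closed(2)[OF T.rat_in_rat_adjoin[of "of_int t"]
      T.rat_adjoin_closed(2)[OF T.rat_in_rat_adjoin[of "of_int m"] m(1)]] by simp
  have \<eta>int: "algebraic_int \<eta>" unfolding \<eta>_def by (intro algebraic_int_add_mult m algebraic_int_of_int)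
  have \<eta>O: "\<eta> \<in> T.Op p" by (rule T.algebraic_int_in_Op[OF p_prime \<eta>K \<eta>int])
  have "\<eta> - \<eta>0 = of_int (m * t - 1) * \<eta>0" by (simp add: \<eta>_def algebra_simps)
  also have "\<dots> = of_nat p * (of_int w * \<eta>0)" unfolding w by (simp add: mult.assoc)
  finally have d\<eta>: "\<eta> - \<eta>0 \<in> S.princ (of_nat p)" using S.princI S.mult_in S.of_int_in \<eta>0(1) by metis
  note I = S.princ_ideal[OF S.of_nat_in, of p]
  have gen: "\<exists>h. z - cpoly h \<eta> \<in> S.princ (of_nat p)" if z: "z \<in> T.Op p" for z
  proof -
    obtain h where h: "z - cpoly h \<eta>0 \<in> S.princ (of_nat p)" using \<eta>0(2)[OF z] by blast
    have "(z - cpoly h \<eta>0) - (cpoly h \<eta> - cpoly h \<eta>0) \<in> S.princ (of_nat p)"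
      by (rule S.is_idealD(4)[OF I h S.ipoly_cong[OF I \<eta>O \<eta>0(1) d\<eta>]])
    then show ?thesis by auto
  qed
  have indep: "int p dvd Polynomial.coeff h i" if "degree h < 7" "cpoly h \<eta> \<in> S.princ (of_nat p)" for h i
    using S.generator_independent[OF \<eta>O gen that] .
  obtain g where "monic_root g \<eta>" using exists_monic_root[OF \<eta>int] by blast
  then interpret E: monic_root g \<eta> .
  have zero: "0 \<in> S.princ (of_nat p)" by (rule S.is_idealD(2)[OF I])
  \<comment> \<open>Were the degree smaller, \<open>indep\<close> would make \<open>p\<close> divide
    the leading coefficient 1 of the minimal polynomial.\<close>
  have E7: "E.n \<ge> 7"
  proof (rule ccontr)
    assume "\<not> E.n \<ge> 7"
    then have "degree g < 7" by (simp add: E.n_def)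
    then have "int p dvd lead_coeff g" using indep E.root zero by simp
    then show False using E.monic prime_gt_1_nat[OF p_prime] by simp
  qed
  have sub: "\<exists>h. degree h < 7 \<and> qpoly q \<eta> = qpoly h \<theta>" for q
  proof -
    have "qpoly q \<eta> \<in> rat_adjoin \<theta>"
    proof (induction q)
      case (pCons c q)
      have "of_rat c - (0 - \<eta> * qpoly q \<eta>) \<in> rat_adjoin \<theta>"
        using T.rat_in_rat_adjoin[of 0] by (intro T.rat_adjoin_closed T.rat_in_rat_adjoin \<eta>K pCons.IH) simp
      then show ?case by (simp add: qpoly_simps)
    qed (use T.rat_in_rat_adjoin[of 0] in simp)
    then obtain q' where "qpoly q \<eta> = qpoly q' \<theta>" unfolding T.rat_adjoin_eq by blast
    then show ?thesis using T.qpoly_reduce[of q'] n7 by metis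
  qed
  have ind: "q = 0" if "degree q < k" "qpoly q \<eta> = 0" "k \<le> E.n" for q k
    by (rule E.qpoly_inj) (use that E.n_pos in \<open>simp_all add: qpoly_simps\<close>)
  obtain q where q: "\<theta> = qpoly q \<eta>"
    using independent_powers_generate[of 7 \<eta> \<theta>] sub ind[of _ 7] E7 by auto
  have K\<eta>: "K = rat_adjoin \<eta>"
  proof (intro equalityI subsetI)
    fix z assume "z \<in> K"
    then obtain r where r: "z = qpoly r \<theta>" unfolding K_eq T.rat_adjoin_eq by blast
    have "qpoly (pcompose r q) \<eta> = qpoly r \<theta>"
      by (simp add: of_rat_hom.map_poly_pcompose poly_pcompose q)
    then show "z \<in> rat_adjoin \<eta>" unfolding E.rat_adjoin_eq r by (metis rangeI)
  next
    fix z assume "z \<in> rat_adjoin \<eta>"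
    then obtain r where "z = qpoly r \<eta>" unfolding E.rat_adjoin_eq by blast
    then show "z \<in> K" unfolding K_eq T.rat_adjoin_eq using sub[of r] by auto
  qed
  \<comment> \<open>Equality with 7 is needed so that \<open>indep\<close> reaches every polynomial
    of degree below \<open>E.n\<close>.\<close>
  have "E.n \<le> 7"
    by (rule independent_powers_le[of E.n \<eta> 7 \<theta>]) (use sub ind[of _ E.n] E.n_pos in auto)
  then have En: "E.n = 7" using E7 by simp
  have "\<not> p dvd element_index (rat_adjoin \<eta>) \<eta>"
  proof (rule E.not_dvd_element_index[OF p_prime])
    fix h w i assume h: "degree h < E.n" "cpoly h \<eta> = of_nat p * w" "algebraic_int w" "w \<in> rat_adjoin \<eta>"
    have "w \<in> T.Op p" using h(3,4) K\<eta> K_eq by (intro T.algebraic_int_in_Op[OF p_prime]) auto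
    then have "cpoly h \<eta> \<in> S.princ (of_nat p)" unfolding h(2) by (rule S.princI)
    then show "int p dvd Polynomial.coeff h i" using indep h(1) En by simp
  qed
  then have "\<not> p dvd element_index K \<eta>" by (simp add: K\<eta>)
  moreover have "field_index K dvd element_index K \<eta>"
    unfolding field_index_def
  proof (rule Gcd_dvd)
    have "\<eta> \<in> ring_of_integers K" using \<eta>K \<eta>int by (simp add: ring_of_integers_def K_eq)
    then show "element_index K \<eta> \<in> {element_index K \<eta> |\<eta>. \<eta> \<in> ring_of_integers K \<and> K = rat_adjoin \<eta>}"
      using K\<eta> by blast
  qed
  ultimately show ?thesis unfolding common_index_divisor_def by (meson dvd_trans)
qed

end
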